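(* Let $d\ge 2$ and let $(\rho,v)$ be a smooth solution on $\mathbb{R}^d$ of the stationary barotropic compressible Navier–Stokes system $$\nabla\cdot(\rho v)=0,\qquad \nabla\cdot(\rho v\otimes v)=-\nabla P+\mu\Delta v+(\mu+\lambda)\nabla(\nabla\cdot v),\qquad P=A\rho^\gamma .$$ Assume: <ul> <li>if $d\le 3$: $\|\rho\|_{L^\infty(\mathbb{R}^d)}+\|\nabla\cdot v\|_{L^2(\mathbb{R}^d)}+\|v\|_{L^{\frac{3d}{d-1}}(\mathbb{R}^d)}<\infty$;</li> <li>if $d\ge 4$: $\|\rho\|_{L^\infty(\mathbb{R}^d)}+\|\nabla\cdot v\|_{L^2(\mathbb{R}^d)}+\|v\|_{L^{\frac{3d}{d-1}}(\mathbb{R}^d)}+\|v\|_{L^{\frac{2d}{d-2}}(\mathbb{R}^d)}<\infty$.</li> </ul> Then $v\equiv 0$ and $\rho$ is constant on $\mathbb{R}^d$.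
   Context: $\rho:\mathbb{R}^d\to[0,\infty)$ is the density, $v:\mathbb{R}^d\to\mathbb{R}^d$ the velocity, $P$ the pressure. The constants satisfy $\mu>0$, $\lambda+2\mu>0$, $A>0$, $\gamma>1$. $(\nabla\cdot(\rho v\otimes v))_j=\sum_i\partial_i(\rho v_iv_j)$. *)

theory Defs
  imports "HOL-Analysis.Analysis"
begin

definition pderiv :: "'n::finite \<Rightarrow> (real^'n \<Rightarrow> real) \<Rightarrow> real^'n \<Rightarrow> real" where
  "pderiv i f x = frechet_derivative f (at x) (axis i 1)"

fun Ck :: "nat \<Rightarrow> (real^'n::finite \<Rightarrow> real) \<Rightarrow> bool" where
  "Ck 0 f = continuous_on UNIV f"
| "Ck (Suc k) f = ((\<forall>x. f differentiable (at x)) \<and> (\<forall>i. Ck k (pderiv i f)))"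

definition smooth :: "(real^'n::finite \<Rightarrow> real) \<Rightarrow> bool" where
  "smooth f = (\<forall>k. Ck k f)"

definition Lp_finite :: "real \<Rightarrow> (real^'n::finite \<Rightarrow> 'b::real_normed_vector) \<Rightarrow> bool" where
  "Lp_finite p f = (f \<in> borel_measurable lborel \<and> integrable lborel (\<lambda>x. norm (f x) powr p))"

end

theory Submission
  imports Defs
begin

text \<open>
  Testing the momentum equation with \<open>v \<phi>\<close> for a cutoff \<open>\<phi>\<close> at scale \<open>R\<close> bounds the Dirichlet energy on the
  ball of radius \<open>R\<close> by integrals over the annulus \<open>R \<le> norm x \<le> 2 R\<close>. By the integrability of \<open>v\<close> all of
  them tend to \<open>0\<close>, except for the pressure term; since \<open>rho v\<close> is divergence free, a constant \<open>P0\<close> may be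
  subtracted from the pressure there.

  The effective flux \<open>G = P - (2 mu + lambda) div v\<close> satisfies \<open>\<Delta> G = - \<partial>\<^sub>i \<partial>\<^sub>j (rho v\<^sub>i v\<^sub>j)\<close>. Rather
  than invoking Calderon-Zygmund theory, \<open>G\<close> is decomposed into dyadic scales by averaging against bumps that
  are divergences of regularised Newtonian kernels. Scales above \<open>R\<close> sum up geometrically. Scales below
  \<open>R powr (-d)\<close> are controlled by \<open>rho v . grad v\<close>, whose integral grows at most polynomially. The roughly
  \<open>log R\<close> scales in between form a convolution operator with \<open>L1\<close> norm of order \<open>log R\<close> and bounded \<open>L2\<close>
  norm, so interpolation bounds it on \<open>Lr\<close> by a small power of \<open>log R\<close>. As the integrals of
  \<open>norm v powr (3 d / (d - 1))\<close> over dyadic annuli are summable, for infinitely many \<open>R = 2 ^ k\<close> this integral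
  is at most \<open>1 / k\<close>, and this gain beats the logarithmic loss.
\<close>

text \<open>The problem is scale critical. By Hoelder, with the exponent q = 3 d / (d - 1), the
  integral of \<open>norm v powr 3\<close> over an annulus divided by R is bounded with no power of
  R to spare, and the pressure term scales alike because the effective flux is governed by a
  quantity quadratic in \<open>v\<close>. Smallness can only come from tails, so every logarithm has
  to be counted. In the middle range the \<open>L2\<close> bound is not obtained scale by scale: the
  sum of the kernels is again curl-free, and for such kernels the \<open>L2\<close> norms of Hessian
  and Laplacian agree. Integration by parts proves this, so kernels of class C1 suffice. The rest of
  the pressure, a multiple of div v, lies in \<open>L2\<close> and is paired with
  \<open>v / R\<close>. Under the exponent q alone the squared \<open>L2\<close> norm of
  \<open>v / R\<close> on an annulus has order R powr ((d - 4) / 3), which is why high dimensions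
  involve the exponent 2 d / (d - 2). Finally, only \<open>rho v\<close> is divergence free and
  \<open>v\<close> is not, so a constant cannot literally be removed from the pressure: a multiple
  of \<open>rho\<close> is, and a pointwise comparison brings the constant in.\<close>

definition csupp :: "('a::real_normed_vector \<Rightarrow> real) \<Rightarrow> bool" where
  "csupp f \<longleftrightarrow> (\<exists>B. \<forall>x. norm x > B \<longrightarrow> f x = 0)"

abbreviation C1 :: "(real^'n::finite \<Rightarrow> real) \<Rightarrow> bool" where
  "C1 \<equiv> Ck (Suc 0)"

section \<open>Calculus of C1 functions of several variables\<close>

lemma pderivI: "(f has_derivative f') (at x) \<Longrightarrow> pderiv i f x = f' (axis i 1)"
  by (simp add: pderiv_def frechet_derivative_at[symmetric])

lemma
  assumes "C1 f"
  shows C1_differentiable: "f differentiable (at x)"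
    and C1_continuous_pderiv: "continuous_on UNIV (pderiv i f)"
    and C1_continuous: "continuous_on UNIV f"
proof -
  show *: "f differentiable (at x)" for x using assms by simp
  show "continuous_on UNIV (pderiv i f)" using assms by simp
  show "continuous_on UNIV f"
    using * differentiable_imp_continuous_within continuous_at_imp_continuous_on by blast
qed

lemma has_derivative_pderiv:
  fixes f :: "real^'n::finite \<Rightarrow> real"
  assumes "f differentiable (at x)"
  shows "(f has_derivative (\<lambda>h. \<Sum>i\<in>UNIV. h $ i * pderiv i f x)) (at x)"
proof -
  let ?L = "frechet_derivative f (at x)"
  have L: "(f has_derivative ?L) (at x)" using assms frechet_derivative_works by blast
  then interpret bounded_linear ?L by (rule has_derivative_bounded_linear)
  have "?L h = (\<Sum>i\<in>UNIV. h $ i * pderiv i f x)" for h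
  proof -
    have "h = (\<Sum>i\<in>UNIV. (h $ i) *\<^sub>R axis i 1)"
      by (simp add: vec_eq_iff axis_def if_distrib cong: if_cong)
    then have "?L h = ?L (\<Sum>i\<in>UNIV. (h $ i) *\<^sub>R axis i 1)" by simp
    also have "\<dots> = (\<Sum>i\<in>UNIV. h $ i * pderiv i f x)"
      by (simp add: sum scaleR pderiv_def)
    finally show ?thesis .
  qed
  then show ?thesis using L by (metis (no_types, lifting) ext)
qed

lemma pderiv_diff:
  assumes "f differentiable (at x)" "g differentiable (at x)"
  shows "pderiv i (\<lambda>y. f y - g y) x = pderiv i f x - pderiv i g x"
  by (subst pderivI[OF has_derivative_diff[OF assms[THEN frechet_derivative_works[THEN iffD1]]]])
    (simp add: pderiv_def)

lemma pderiv_mult: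
  fixes f g :: "real^'n::finite \<Rightarrow> real"
  assumes "f differentiable (at x)" "g differentiable (at x)"
  shows "pderiv i (\<lambda>y. f y * g y) x = pderiv i f x * g x + f x * pderiv i g x"
  by (subst pderivI[OF has_derivative_mult[OF assms[THEN frechet_derivative_works[THEN iffD1]]]])
    (simp add: pderiv_def)

lemma pderiv_sum:
  assumes "\<And>j. j \<in> S \<Longrightarrow> f j differentiable (at x)"
  shows "pderiv i (\<lambda>y. \<Sum>j\<in>S. f j y) x = (\<Sum>j\<in>S. pderiv i (f j) x)"
  by (subst pderivI[OF has_derivative_sum[OF assms[THEN frechet_derivative_works[THEN iffD1]]]])
    (auto simp: pderiv_def)

lemma pderiv_const: "pderiv i (\<lambda>y. c) x = 0"
  by (rule pderivI[where f'="\<lambda>_. 0"]) simp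

lemma C1I:
  assumes "\<And>x. f differentiable (at x)" "\<And>i. pderiv i f = g i" "\<And>i. continuous_on UNIV (g i)"
  shows "C1 f"
  using assms by simp

text \<open>From here on \<open>C1\<close> stays folded and is used only through these three
  consequences.\<close>

declare Ck.simps(2)[simp del]
declare C1_differentiable[simp] C1_continuous[simp] C1_continuous_pderiv[simp]

lemma C1_const: "C1 (\<lambda>x. c)"
  by (rule C1I[where g="\<lambda>_ _. 0"]) (auto simp: pderiv_const)

lemma C1_diff: "C1 f \<Longrightarrow> C1 g \<Longrightarrow> C1 (\<lambda>x. f x - g x)"
  by (rule C1I[where g="\<lambda>i x. pderiv i f x - pderiv i g x"])
    (auto simp: pderiv_diff intro!: continuous_intros)

lemma C1_mult: "C1 f \<Longrightarrow> C1 g \<Longrightarrow> C1 (\<lambda>x. f x * g x)"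
  by (rule C1I[where g="\<lambda>i x. pderiv i f x * g x + f x * pderiv i g x"])
    (auto simp: pderiv_mult intro!: continuous_intros)

lemma C1_sum: "finite S \<Longrightarrow> (\<And>j. j \<in> S \<Longrightarrow> C1 (f j)) \<Longrightarrow> C1 (\<lambda>x. \<Sum>j\<in>S. f j x)"
  by (rule C1I[where g="\<lambda>i x. \<Sum>j\<in>S. pderiv i (f j) x"])
    (auto simp: pderiv_sum intro!: continuous_intros differentiable_sum)

lemma smooth_C1: "smooth f \<Longrightarrow> C1 f"
  by (simp add: smooth_def del: Ck.simps)

lemma smooth_pderiv: "smooth f \<Longrightarrow> smooth (pderiv i f)"
  unfolding smooth_def by (metis Ck.simps(2))

lemma
  fixes f :: "real^'n::finite \<Rightarrow> real"
  assumes "C1 f"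
  shows C1_affine': "C1 (\<lambda>y. f (a + c *\<^sub>R y))"
    and pderiv_affine: "pderiv i (\<lambda>y. f (a + c *\<^sub>R y)) y = c * pderiv i f (a + c *\<^sub>R y)"
proof -
  have D: "((\<lambda>y. f (a + c *\<^sub>R y)) has_derivative
     (\<lambda>h. frechet_derivative f (at (a + c *\<^sub>R y)) (c *\<^sub>R h))) (at y)" for y
    by (rule has_derivative_compose[where f="\<lambda>y. a + c *\<^sub>R y"])
      (auto intro!: derivative_eq_intros C1_differentiable[OF assms] simp: frechet_derivative_works[symmetric])
  show P: "pderiv i (\<lambda>y. f (a + c *\<^sub>R y)) y = c * pderiv i f (a + c *\<^sub>R y)" for i y
  proof -
    interpret bounded_linear "frechet_derivative f (at (a + c *\<^sub>R y))"
      using C1_differentiable[OF assms] frechet_derivative_works has_derivative_bounded_linear by blast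
    show ?thesis unfolding pderivI[OF D] by (simp add: scaleR pderiv_def)
  qed
  show "C1 (\<lambda>y. f (a + c *\<^sub>R y))"
    by (rule C1I[where g="\<lambda>i y. c * pderiv i f (a + c *\<^sub>R y)"])
      (use D P in \<open>auto simp: differentiable_def fun_eq_iff intro!: continuous_intros
        continuous_on_compose2[OF C1_continuous_pderiv[OF assms]]\<close>)
qed

lemma C1_compose:
  fixes f :: "real^'n::finite \<Rightarrow> real"
  assumes f: "C1 f" and F: "\<And>t. (F has_real_derivative F' t) (at t)" and F': "continuous_on UNIV F'"
  shows "C1 (\<lambda>y. F (f y))"
    and "pderiv i (\<lambda>y. F (f y)) y = F' (f y) * pderiv i f y"
proof -
  have D: "((\<lambda>y. F (f y)) has_derivative (\<lambda>h. F' (f y) * frechet_derivative f (at y) h)) (at y)" for y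
    by (rule has_derivative_compose[where f=f])
      (use F[unfolded has_field_derivative_def] C1_differentiable[OF f] frechet_derivative_works in auto)
  show P: "pderiv i (\<lambda>y. F (f y)) y = F' (f y) * pderiv i f y" for i y
    unfolding pderivI[OF D] by (simp add: pderiv_def)
  show "C1 (\<lambda>y. F (f y))"
    by (rule C1I[where g="\<lambda>i y. F' (f y) * pderiv i f y"])
      (use D P f in \<open>auto simp: differentiable_def fun_eq_iff intro!: continuous_intros
        continuous_on_compose2[OF F']\<close>)
qed

subsection \<open>Integrals of compactly supported functions\<close>

lemma csuppI: "(\<And>x. norm x > B \<Longrightarrow> f x = 0) \<Longrightarrow> csupp f"
  by (auto simp: csupp_def)

lemma csupp_mult1: "csupp f \<Longrightarrow> csupp (\<lambda>x. f x * g x)"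
  and csupp_mult2: "csupp g \<Longrightarrow> csupp (\<lambda>x. f x * g x)"
  by (force simp: csupp_def)+

lemma csupp_add: "csupp f \<Longrightarrow> csupp g \<Longrightarrow> csupp (\<lambda>x. f x + g x)"
proof -
  assume "csupp f" "csupp g"
  then obtain B C where "\<forall>x. norm x > B \<longrightarrow> f x = 0" "\<forall>x. norm x > C \<longrightarrow> g x = 0"
    by (auto simp: csupp_def)
  then show ?thesis by (intro csuppI[where B="max B C"]) auto
qed

lemma csupp_diff: "csupp f \<Longrightarrow> csupp g \<Longrightarrow> csupp (\<lambda>x. f x - g x)"
proof -
  assume "csupp f" "csupp g"
  then obtain B C where "\<forall>x. norm x > B \<longrightarrow> f x = 0" "\<forall>x. norm x > C \<longrightarrow> g x = 0"
    by (auto simp: csupp_def)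
  then show ?thesis by (intro csuppI[where B="max B C"]) auto
qed

lemma csupp_pderiv:
  assumes "csupp f"
  shows "csupp (pderiv i f)"
proof -
  obtain B where B: "\<forall>x. norm x > B \<longrightarrow> f x = 0" using assms by (auto simp: csupp_def)
  have "pderiv i f x = 0" if x: "norm x > B" for x
  proof -
    have "open {x::real^'a. norm x > B}" by (intro open_Collect_less continuous_intros)
    then have "(f has_derivative (\<lambda>_. 0)) (at x)"
      by (rule has_derivative_transform_within_open[OF has_derivative_const[of 0]])
        (use B x in auto)
    then show ?thesis by (simp add: pderivI)
  qed
  then show ?thesis by (rule csuppI)
qed

lemma bounded_csupp:
  fixes f :: "'a::euclidean_space \<Rightarrow> real"
  assumes "continuous_on UNIV f" "csupp f"
  obtains C where "C > 0" "\<And>x. \<bar>f x\<bar> \<le> C"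
proof -
  obtain B where B: "\<forall>x. norm x > B \<longrightarrow> f x = 0" using assms by (auto simp: csupp_def)
  have "compact (f ` cball 0 B)"
    using assms(1) by (intro compact_continuous_image) (auto intro: continuous_on_subset)
  then obtain C where "\<And>x. x \<in> cball 0 B \<Longrightarrow> \<bar>f x\<bar> \<le> C"
    using compact_imp_bounded by (force simp: bounded_iff)
  then have "\<bar>f x\<bar> \<le> max 1 C" for x
    using B by (cases "norm x > B") (force simp: not_less le_max_iff_disj)+
  then show ?thesis using that[of "max 1 C"] by auto
qed

lemma integrable_bounded_csupp:
  fixes f :: "'a::euclidean_space \<Rightarrow> real"
  assumes "f \<in> borel_measurable borel" "csupp f" "\<And>x. \<bar>f x\<bar> \<le> C"
  shows "integrable lborel f"
proof -
  obtain B where B: "\<forall>x. norm x > B \<longrightarrow> f x = 0" using assms by (auto simp: csupp_def)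
  show ?thesis
    by (rule integrableI_bounded_set[where A="cball 0 B" and B=C])
      (use assms B emeasure_lborel_cball_finite[of 0 B] in auto)
qed

lemma integrable_csupp:
  fixes f :: "'a::euclidean_space \<Rightarrow> real"
  assumes "continuous_on UNIV f" "csupp f"
  shows "integrable lborel f"
  using bounded_csupp[OF assms] integrable_bounded_csupp[OF _ assms(2)] assms(1)
  by (metis borel_measurable_continuous_onI)

section \<open>Affine substitutions in Lebesgue integrals\<close>

lemma nn_integral_affine:
  fixes f :: "'a::euclidean_space \<Rightarrow> ennreal"
  assumes [measurable]: "f \<in> borel_measurable borel" and "c \<noteq> 0"
  shows "(\<integral>\<^sup>+x. f x \<partial>lborel) = \<bar>c\<bar> ^ DIM('a) * (\<integral>\<^sup>+x. f (t + c *\<^sub>R x) \<partial>lborel)"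
  by (subst lborel_affine[OF assms(2), of t])
    (simp add: nn_integral_density nn_integral_distr nn_integral_cmult ennreal_power)

lemma integrable_affine:
  fixes f :: "'a::euclidean_space \<Rightarrow> real"
  assumes f: "integrable lborel f" and c: "c \<noteq> 0"
  shows "integrable lborel (\<lambda>x. f (t + c *\<^sub>R x))"
  using f f[THEN borel_measurable_integrable] c unfolding integrable_iff_bounded
  by (subst (asm) nn_integral_affine[where c=c and t=t]) (auto simp: ennreal_mult_less_top)

lemma integral_affine:
  fixes f :: "'a::euclidean_space \<Rightarrow> real"
  assumes f: "integrable lborel f" and c: "c \<noteq> 0"
  shows "(\<integral>x. f x \<partial>lborel) = \<bar>c\<bar> ^ DIM('a) * (\<integral>x. f (t + c *\<^sub>R x) \<partial>lborel)"
  using f[THEN borel_measurable_integrable] f[THEN integrable_affine, OF c, of t] c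
  by (subst lborel_affine[OF c, of t]) (simp add: integral_density integral_distr)

lemma integral_translate:
  fixes f :: "'a::euclidean_space \<Rightarrow> real"
  assumes "integrable lborel f"
  shows "(\<integral>x. f (x + t) \<partial>lborel) = (\<integral>x. f x \<partial>lborel)"
  using integral_affine[OF assms, of 1 t] by (simp add: add.commute)

lemma integral_reflect:
  fixes f :: "'a::euclidean_space \<Rightarrow> real"
  assumes "integrable lborel f"
  shows "(\<integral>x. f (t - x) \<partial>lborel) = (\<integral>x. f x \<partial>lborel)"
  using integral_affine[OF assms, of "-1" t] by simp

text \<open>Difference quotients replace second derivatives in the integration by parts below.\<close>

definition dquot :: "'n \<Rightarrow> (real^'n::finite \<Rightarrow> real) \<Rightarrow> real \<Rightarrow> real^'n \<Rightarrow> real" where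
  "dquot i f h x = (f (x + h *\<^sub>R axis i 1) - f x) / h"

lemma dquot_tendsto:
  assumes "C1 f"
  shows "((\<lambda>h. dquot i f h x) \<longlongrightarrow> pderiv i f x) (at 0)"
proof -
  have "((\<lambda>h. f (x + h *\<^sub>R axis i 1)) has_derivative
     (\<lambda>h. frechet_derivative f (at (x + 0 *\<^sub>R axis i 1)) (h *\<^sub>R axis i 1))) (at 0)"
    by (rule has_derivative_compose[where f="\<lambda>h. x + h *\<^sub>R axis i 1"])
      (auto intro!: derivative_eq_intros C1_differentiable[OF assms] simp: frechet_derivative_works[symmetric])
  moreover interpret bounded_linear "frechet_derivative f (at x)"
    using C1_differentiable[OF assms] frechet_derivative_works has_derivative_bounded_linear by blast
  have "(\<lambda>h. frechet_derivative f (at (x + 0 *\<^sub>R axis i 1)) (h *\<^sub>R axis i 1)) = (*) (pderiv i f x)"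
    by (auto simp: scaleR pderiv_def mult.commute)
  ultimately have "((\<lambda>h. f (x + h *\<^sub>R axis i 1)) has_field_derivative pderiv i f x) (at 0)"
    by (simp add: has_field_derivative_def)
  then show ?thesis by (simp add: DERIV_def dquot_def)
qed

text \<open>Mean value inequality along the segment from x to its translate. The margin 1 in the
  radius covers every increment with \<open>\<bar>h\<bar> \<le> 1\<close>, so the bound is uniform
  in h and can dominate the quotients.\<close>

lemma dquot_bound:
  fixes f :: "real^'n::finite \<Rightarrow> real"
  assumes f: "C1 f" and B: "\<And>y. norm y \<le> r + 1 \<Longrightarrow> \<bar>pderiv i f y\<bar> \<le> B"
    and "norm x \<le> r" "\<bar>h\<bar> \<le> 1" "0 \<le> B"
  shows "\<bar>dquot i f h x\<bar> \<le> B"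
proof (cases "h = 0")
  case False
  have D: "((\<lambda>s. f (x + s *\<^sub>R axis i 1)) has_derivative (\<lambda>t. t * pderiv i f (x + s *\<^sub>R axis i 1))) (at s within S)" for s S
  proof -
    have "((\<lambda>s. f (x + s *\<^sub>R axis i 1)) has_derivative
     (\<lambda>h. frechet_derivative f (at (x + s *\<^sub>R axis i 1)) (h *\<^sub>R axis i 1))) (at s)"
    by (rule has_derivative_compose[where f="\<lambda>h. x + h *\<^sub>R axis i 1"])
      (auto intro!: derivative_eq_intros C1_differentiable[OF f] simp: frechet_derivative_works[symmetric])
    moreover interpret bounded_linear "frechet_derivative f (at (x + s *\<^sub>R axis i 1))"
      using C1_differentiable[OF f] frechet_derivative_works has_derivative_bounded_linear by blast
    have "(\<lambda>h. frechet_derivative f (at (x + s *\<^sub>R axis i 1)) (h *\<^sub>R axis i 1)) = (\<lambda>t. t * pderiv i f (x + s *\<^sub>R axis i 1))"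
      by (auto simp: scaleR pderiv_def)
    ultimately show ?thesis by (metis has_derivative_at_withinI)
  qed
  have "norm (f (x + h *\<^sub>R axis i 1) - f (x + 0 *\<^sub>R axis i 1)) \<le> B * norm (h - 0)"
  proof (rule differentiable_bound[of "closed_segment 0 h"])
    show "convex (closed_segment 0 h)" by simp
    fix s assume s: "s \<in> closed_segment 0 h"
    then have "\<bar>s\<bar> \<le> 1" using assms(4) by (auto simp: closed_segment_eq_real_ivl split: if_splits)
    then have "norm (x + s *\<^sub>R axis i 1) \<le> r + 1"
      using assms(3) norm_triangle_ineq[of x "s *\<^sub>R axis i 1"] by simp
    from B[OF this] show "onorm (\<lambda>t. t * pderiv i f (x + s *\<^sub>R axis i 1)) \<le> B"
      by (intro onorm_bound assms(5)) (simp add: abs_mult mult.commute[of B] mult_left_mono)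
  qed (use D in auto)
  then show ?thesis using False by (simp add: dquot_def field_simps)
qed (simp add: dquot_def assms)

text \<open>Dominated convergence. The support of \<open>u\<close> confines everything to a ball, so
  \<open>f\<close> may grow arbitrarily at infinity.\<close>

lemma dquot_integral_tendsto:
  fixes f u :: "real^'n::finite \<Rightarrow> real"
  assumes f: "C1 f" and u: "continuous_on UNIV u" "csupp u"
    and h: "h \<longlonglongrightarrow> 0" "\<And>n. h n \<noteq> 0" "\<And>n. \<bar>h n\<bar> \<le> 1"
  shows "(\<lambda>n. \<integral>x. u x * dquot i f (h n) x \<partial>lborel) \<longlonglongrightarrow> (\<integral>x. u x * pderiv i f x \<partial>lborel)"
proof -
  obtain r where r: "\<forall>x. norm x > r \<longrightarrow> u x = 0" using u by (auto simp: csupp_def)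
  obtain C where C: "\<And>x. \<bar>u x\<bar> \<le> C" using bounded_csupp[OF u] by auto
  have "compact (pderiv i f ` cball 0 (r+1))"
    using C1_continuous_pderiv[OF f] by (intro compact_continuous_image) (auto intro: continuous_on_subset)
  then obtain B where B: "\<And>x. x \<in> cball 0 (r+1) \<Longrightarrow> \<bar>pderiv i f x\<bar> \<le> B"
    using compact_imp_bounded by (force simp: bounded_iff)
  define B' where "B' = max 0 B"
  have B'0: "B' \<ge> 0" by (simp add: B'_def)
  have B': "\<bar>pderiv i f x\<bar> \<le> B'" if "norm x \<le> r+1" for x
    using B[of x] that by (auto simp: B'_def)
  have [measurable]: "u \<in> borel_measurable borel" "f \<in> borel_measurable borel" "pderiv i f \<in> borel_measurable borel"
    using u C1_continuous[OF f] C1_continuous_pderiv[OF f] by (auto intro: borel_measurable_continuous_onI)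
  have [measurable]: "dquot i f h \<in> borel_measurable borel" for h
    unfolding dquot_def by measurable
  show ?thesis
  proof (rule integral_dominated_convergence[where w="\<lambda>x. B' * \<bar>u x\<bar>"])
    show "integrable lborel (\<lambda>x. B' * \<bar>u x\<bar>)"
      using integrable_csupp[OF u] by auto
    have "(\<lambda>n. dquot i f (h n) x) \<longlonglongrightarrow> pderiv i f x" for x
      by (rule filterlim_compose[OF dquot_tendsto[OF f]]) (use h in \<open>auto simp: filterlim_at\<close>)
    then show "AE x in lborel. (\<lambda>n. u x * dquot i f (h n) x) \<longlonglongrightarrow> u x * pderiv i f x"
      by (auto intro!: tendsto_intros)
    fix n
    have "norm (u x * dquot i f (h n) x) \<le> B' * \<bar>u x\<bar>" for x
    proof (cases "norm x \<le> r")
      case True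
      have "\<bar>dquot i f (h n) x\<bar> \<le> B'"
        by (rule dquot_bound[OF f B' True h(3) B'0])
      then show ?thesis by (simp add: abs_mult mult.commute[of B'] mult_left_mono)
    qed (use r in auto)
    then show "AE x in lborel. norm (u x * dquot i f (h n) x) \<le> B' * \<bar>u x\<bar>" by simp
  qed auto
qed

text \<open>Translation invariance makes the integral of every difference quotient zero, and the
  derivative is their limit. No iterated one-dimensional integration is involved.\<close>

lemma integral_pderiv_eq_0:
  fixes f :: "real^'n::finite \<Rightarrow> real"
  assumes f: "C1 f" "csupp f"
  shows "(\<integral>x. pderiv i f x \<partial>lborel) = 0"
proof -
  obtain r where r: "\<forall>x. norm x > r \<longrightarrow> f x = 0" using f by (auto simp: csupp_def)
  define h where "h n = 1 / real (Suc n)" for n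
  have h: "h \<longlonglongrightarrow> 0" "\<And>n. h n \<noteq> 0" "\<And>n. \<bar>h n\<bar> \<le> 1"
    using LIMSEQ_inverse_real_of_nat by (auto simp: h_def[abs_def] inverse_eq_divide)
  \<comment> \<open>\<open>u\<close> is 1 on the supports of all the quotients, which lie in the
    ball of radius r + 1. It changes no integral and supplies the compactly supported weight that
    the limit lemma expects.\<close>
  define u :: "real^'n \<Rightarrow> real" where "u x = max 0 (min 1 (r + 2 - norm x))" for x
  have u: "continuous_on UNIV u" "csupp u"
    unfolding u_def by (auto intro!: continuous_intros csuppI[where B="r+2"])
  have f_int: "integrable lborel f" using integrable_csupp[OF C1_continuous[OF f(1)] f(2)] .
  have u1: "u x = 1" if "norm x \<le> r + 1" for x using that by (auto simp: u_def)
  have "(\<integral>x. u x * dquot i f (h n) x \<partial>lborel) = 0" for n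
  proof -
    have "u x * dquot i f (h n) x = (f (x + h n *\<^sub>R axis i 1) - f x) / h n" for x
    proof (cases "norm x \<le> r + 1")
      case False
      have "norm x \<le> norm (x + h n *\<^sub>R axis i 1) + norm (h n *\<^sub>R axis i (1::real))"
        using norm_triangle_ineq4[of "x + h n *\<^sub>R axis i 1" "h n *\<^sub>R axis i 1"] by simp
      then have "norm (x + h n *\<^sub>R axis i 1) > r" using False h(3)[of n] by simp
      then show ?thesis using False r by (simp add: dquot_def)
    qed (simp add: u1 dquot_def)
    then show ?thesis
      using integral_translate[OF f_int, of "h n *\<^sub>R axis i 1"] f_int
        integrable_affine[OF f_int, of 1 "h n *\<^sub>R axis i 1"]
      by (simp add: add.commute)
  qed
  with dquot_integral_tendsto[OF f(1) u h, of i]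
  have "(\<lambda>n. 0) \<longlonglongrightarrow> (\<integral>x. u x * pderiv i f x \<partial>lborel)" by simp
  then have "(\<integral>x. u x * pderiv i f x \<partial>lborel) = 0" by (simp add: LIMSEQ_const_iff)
  moreover have "u x * pderiv i f x = pderiv i f x" for x
  proof (cases "norm x \<le> r + 1")
    case False
    have "open {x::real^'n. norm x > r}" by (intro open_Collect_less continuous_intros)
    then have "(f has_derivative (\<lambda>_. 0)) (at x)"
      by (rule has_derivative_transform_within_open[OF has_derivative_const[of 0]])
        (use r False in auto)
    then show ?thesis by (simp add: pderivI)
  qed (simp add: u1)
  ultimately show ?thesis by simp
qed

lemma integral_by_parts:
  fixes f g :: "real^'n::finite \<Rightarrow> real"
  assumes "C1 f" "C1 g" "csupp f \<or> csupp g"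
  shows "(\<integral>x. pderiv i f x * g x \<partial>lborel) = - (\<integral>x. f x * pderiv i g x \<partial>lborel)"
proof -
  have "csupp (\<lambda>x. f x * g x)" using assms(3) csupp_mult1 csupp_mult2 by blast
  from integral_pderiv_eq_0[OF C1_mult[OF assms(1,2)] this, of i]
  have "(\<integral>x. pderiv i f x * g x + f x * pderiv i g x \<partial>lborel) = 0"
    using assms by (simp add: pderiv_mult)
  moreover have "integrable lborel (\<lambda>x. pderiv i f x * g x)" "integrable lborel (\<lambda>x. f x * pderiv i g x)"
    using assms by (auto intro!: integrable_csupp continuous_intros
        intro: csupp_mult1 csupp_mult2 csupp_pderiv)
  ultimately show ?thesis by simp
qed

text \<open>For C2 functions this is two integrations by parts with commuting derivatives, but here
  neither function has second derivatives. One derivative of \<open>w\<close> is replaced by a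
  difference quotient, which is C1 and can be integrated by parts in the other direction; a
  translation then moves the quotient onto \<open>u\<close>.\<close>

lemma integral_pderiv_swap:
  fixes u w :: "real^'n::finite \<Rightarrow> real"
  assumes u: "C1 u" and w: "C1 w" "csupp w"
  shows "(\<integral>x. pderiv j u x * pderiv i w x \<partial>lborel) = (\<integral>x. pderiv i u x * pderiv j w x \<partial>lborel)"
proof -
  obtain r where r: "\<forall>x. norm x > r \<longrightarrow> w x = 0" using w by (auto simp: csupp_def)
  define p where "p x = max 0 (min 1 (r + 2 - norm x))" for x :: "real^'n"
  define h where "h n = 1 / real (Suc n)" for n
  have h: "h \<longlonglongrightarrow> 0" "\<And>n. h n \<noteq> 0" "\<And>n. \<bar>h n\<bar> \<le> 1"
    using LIMSEQ_inverse_real_of_nat by (auto simp: h_def[abs_def] inverse_eq_divide)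
  have h': "(\<lambda>n. - h n) \<longlonglongrightarrow> 0" "\<And>n. - h n \<noteq> 0" "\<And>n. \<bar>- h n\<bar> \<le> 1"
    using h tendsto_minus[OF h(1)] by auto
  have pcont: "continuous_on UNIV (\<lambda>x. p x * pderiv j u x)" "csupp (\<lambda>x. p x * pderiv j u x)"
    unfolding p_def by (auto intro!: continuous_intros u csuppI[where B="r+2"] simp: u)
  have p1: "p x = 1" if "norm x \<le> r + 1" for x using that by (auto simp: p_def)
  let ?e = "\<lambda>n. h n *\<^sub>R axis i (1::real)"
  have shift: "w (x + ?e n) = 0" if "norm x > r + 1" for n x
  proof -
    have "norm x \<le> norm (x + ?e n) + norm (?e n)"
      using norm_triangle_ineq4[of "x + ?e n" "?e n"] by simp
    then have "norm (x + ?e n) > r" using that h(3)[of n] by simp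
    then show ?thesis using r by simp
  qed
  have p_dq: "p x * (a * dquot i w (h n) x) = a * dquot i w (h n) x" for x n a
    using p1[of x] shift[of x n] r by (cases "norm x \<le> r + 1") (auto simp: dquot_def)
  have wj: "continuous_on UNIV (pderiv j w)" "csupp (pderiv j w)"
    using w C1_continuous_pderiv csupp_pderiv by auto
  have eq: "(\<integral>x. (p x * pderiv j u x) * dquot i w (h n) x \<partial>lborel) =
    (\<integral>x. pderiv j w x * dquot i u (- h n) x \<partial>lborel)" for n
  proof -
    let ?W = "dquot i w (h n)"
    have wsh: "C1 (\<lambda>x. w (x + ?e n))"
      using C1_affine'[OF w(1), of "?e n" 1] by (simp add: add.commute)
    have pw: "pderiv j (\<lambda>x. w (x + ?e n)) x = pderiv j w (x + ?e n)" for x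
      using pderiv_affine[OF w(1), of j "?e n" 1 x] by (simp add: add.commute)
    have csh: "csupp (\<lambda>x. w (x + ?e n))" by (rule csuppI[OF shift])
    have Weq: "?W = (\<lambda>x. (w (x + ?e n) - w x) * (1 / h n))" by (auto simp: dquot_def)
    have W: "C1 ?W" "csupp ?W" unfolding Weq
      by (rule C1_mult[OF C1_diff[OF wsh w(1)] C1_const], rule csupp_mult1[OF csupp_diff[OF csh w(2)]])
    have pW: "pderiv j ?W x = (pderiv j w (x + ?e n) - pderiv j w x) / h n" for x
      unfolding Weq using C1_differentiable[OF w(1)] C1_differentiable[OF wsh]
      by (subst pderiv_mult) (auto simp: pderiv_diff pw pderiv_const C1_const simp del: mult_1_right times_divide_eq_right, simp)
    have "(\<integral>x. (p x * pderiv j u x) * ?W x \<partial>lborel) = (\<integral>x. pderiv j u x * ?W x \<partial>lborel)"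
      by (intro Bochner_Integration.integral_cong refl) (simp only: mult.assoc p_dq)
    also have "\<dots> = - (\<integral>x. u x * pderiv j ?W x \<partial>lborel)"
      by (rule integral_by_parts) (use u W in auto)
    also have "\<dots> = - (\<integral>x. u x * pderiv j w (x + ?e n) / h n - u x * pderiv j w x / h n \<partial>lborel)"
      by (simp add: pW algebra_simps diff_divide_distrib)
    also have "\<dots> = - ((\<integral>x. u x * pderiv j w (x + ?e n) / h n \<partial>lborel) - (\<integral>x. u x * pderiv j w x / h n \<partial>lborel))"
    proof (subst Bochner_Integration.integral_diff)
      have "csupp (pderiv j (\<lambda>x. w (x + ?e n)))" by (rule csupp_pderiv[OF csh])
      then have "csupp (\<lambda>x. pderiv j w (x + ?e n))" unfolding pw[abs_def, symmetric] by (simp add: pw)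
      then show "integrable lborel (\<lambda>x. u x * pderiv j w (x + ?e n) / h n)"
        using u w by (auto intro!: integrable_divide integrable_csupp continuous_intros
            continuous_on_compose2[OF wj(1)] csupp_mult2)
      show "integrable lborel (\<lambda>x. u x * pderiv j w x / h n)"
        using u w wj by (auto intro!: integrable_divide integrable_csupp continuous_intros csupp_mult2)
    qed simp
    \<comment> \<open>The translation moves the increment from \<open>w\<close> to \<open>u\<close>,
      which is why the quotient of \<open>u\<close> has the step \<open>- h n\<close>.\<close>
    also have "(\<integral>x. u x * pderiv j w (x + ?e n) / h n \<partial>lborel) = (\<integral>x. u (x - ?e n) * pderiv j w x / h n \<partial>lborel)"
    proof -
      have "integrable lborel (\<lambda>x. u (x - ?e n) * pderiv j w x / h n)"
        using u w wj by (auto intro!: integrable_divide integrable_csupp continuous_intros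
           continuous_on_compose2[OF C1_continuous[OF u]] csupp_mult2)
      from integral_translate[OF this, of "?e n"] show ?thesis by simp
    qed
    also have "- ((\<integral>x. u (x - ?e n) * pderiv j w x / h n \<partial>lborel) - (\<integral>x. u x * pderiv j w x / h n \<partial>lborel)) =
      - (\<integral>x. u (x - ?e n) * pderiv j w x / h n - u x * pderiv j w x / h n \<partial>lborel)"
      using u w wj by (subst Bochner_Integration.integral_diff) (auto intro!: integrable_divide integrable_csupp
          continuous_intros continuous_on_compose2[OF C1_continuous[OF u]] csupp_mult2)
    also have "\<dots> = (\<integral>x. pderiv j w x * dquot i u (- h n) x \<partial>lborel)"
      unfolding Bochner_Integration.integral_minus[symmetric]
      by (intro Bochner_Integration.integral_cong) (auto simp: dquot_def divide_simps algebra_simps h(2))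
    finally show ?thesis .
  qed
  have "(\<lambda>n. \<integral>x. (p x * pderiv j u x) * dquot i w (h n) x \<partial>lborel) \<longlonglongrightarrow>
      (\<integral>x. (p x * pderiv j u x) * pderiv i w x \<partial>lborel)"
    by (rule dquot_integral_tendsto[OF w(1) pcont h])
  moreover have "(\<lambda>n. \<integral>x. pderiv j w x * dquot i u (- h n) x \<partial>lborel) \<longlonglongrightarrow>
      (\<integral>x. pderiv j w x * pderiv i u x \<partial>lborel)"
    by (rule dquot_integral_tendsto[OF u wj h'])
  ultimately have "(\<integral>x. (p x * pderiv j u x) * pderiv i w x \<partial>lborel) = (\<integral>x. pderiv j w x * pderiv i u x \<partial>lborel)"
    unfolding eq by (rule LIMSEQ_unique)
  moreover have "(\<lambda>x. (p x * pderiv j u x) * pderiv i w x) = (\<lambda>x. pderiv j u x * pderiv i w x)"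
  proof
    fix x
    show "(p x * pderiv j u x) * pderiv i w x = pderiv j u x * pderiv i w x"
    proof (cases "norm x \<le> r + 1")
      case False
      have "open {x::real^'n. norm x > r}" by (intro open_Collect_less continuous_intros)
      then have "(w has_derivative (\<lambda>_. 0)) (at x)"
        by (rule has_derivative_transform_within_open[OF has_derivative_const[of 0]])
          (use r False in auto)
      then show ?thesis by (simp add: pderivI)
    qed (simp add: p1)
  qed
  ultimately show ?thesis by (simp only: mult.commute)
qed

subsection \<open>Convolution of bounded compactly supported functions\<close>

text \<open>Bounded, compactly supported Borel functions: a class closed under products, affine
  substitution, sharp truncation and convolution, on which Fubini comes without side conditions.
  Continuity is left out because the interpolation argument cuts functions at a height.\<close>

definition bcs :: "('a::euclidean_space \<Rightarrow> real) \<Rightarrow> bool" where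
  "bcs f \<longleftrightarrow> f \<in> borel_measurable borel \<and> csupp f \<and> (\<exists>C. \<forall>x. \<bar>f x\<bar> \<le> C)"

definition conv :: "('a::euclidean_space \<Rightarrow> real) \<Rightarrow> ('a \<Rightarrow> real) \<Rightarrow> 'a \<Rightarrow> real" where
  "conv k w x = (\<integral>y. k (x - y) * w y \<partial>lborel)"

lemma bcs_measurable: "bcs f \<Longrightarrow> f \<in> borel_measurable borel"
  and bcs_csupp: "bcs f \<Longrightarrow> csupp f"
  by (auto simp: bcs_def)

lemma bcsE:
  assumes "bcs f"
  obtains C where "C > 0" "\<And>x. \<bar>f x\<bar> \<le> C"
proof -
  obtain C where C: "\<forall>x. \<bar>f x\<bar> \<le> C" using assms by (auto simp: bcs_def)
  show ?thesis by (rule that[of "max 1 C"]) (use C in \<open>auto simp: le_max_iff_disj\<close>)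
qed

lemma bcs_integrable: "bcs f \<Longrightarrow> integrable lborel f"
  by (auto simp: bcs_def intro: integrable_bounded_csupp)

lemma bcsI:
  assumes "f \<in> borel_measurable borel" "\<And>x. norm x > B \<Longrightarrow> f x = 0" "\<And>x. norm x \<le> B \<Longrightarrow> \<bar>f x\<bar> \<le> C"
  shows "bcs f"
proof -
  have "\<bar>f x\<bar> \<le> max 0 C" for x using assms(2,3)[of x] by (cases "norm x > B") auto
  then show ?thesis using assms csuppI unfolding bcs_def by blast
qed

lemma continuous_bcs: "continuous_on UNIV f \<Longrightarrow> csupp f \<Longrightarrow> bcs f"
  unfolding bcs_def using bounded_csupp by (metis borel_measurable_continuous_onI)

lemma bcs_mult_bounded:
  assumes "bcs f" "g \<in> borel_measurable borel" "\<And>x. \<bar>g x\<bar> \<le> C"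
  shows "bcs (\<lambda>x. f x * g x)"
proof -
  obtain D where D: "D > 0" "\<And>x. \<bar>f x\<bar> \<le> D" using bcsE[OF assms(1)] by blast
  have "\<bar>f x * g x\<bar> \<le> D * C" for x
    unfolding abs_mult using D assms(3)[of x] by (intro mult_mono) auto
  then show ?thesis using assms by (auto simp: bcs_def intro: csupp_mult1)
qed

lemma bcs_mult: "bcs f \<Longrightarrow> bcs g \<Longrightarrow> bcs (\<lambda>x. f x * g x)"
  using bcs_mult_bounded bcsE bcs_measurable by metis

lemma bcs_const_mult: "bcs f \<Longrightarrow> bcs (\<lambda>x. c * f x)"
  using bcs_mult_bounded[of f "\<lambda>_. c" "\<bar>c\<bar>"] by (simp add: mult.commute)

lemma bcs_add: "bcs f \<Longrightarrow> bcs g \<Longrightarrow> bcs (\<lambda>x. f x + g x)"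
proof -
  assume f: "bcs f" and g: "bcs g"
  obtain C where C: "C > 0" "\<And>x. \<bar>f x\<bar> \<le> C" using bcsE[OF f] by blast
  obtain D where D: "D > 0" "\<And>x. \<bar>g x\<bar> \<le> D" using bcsE[OF g] by blast
  have "\<bar>f x + g x\<bar> \<le> C + D" for x using C(2)[of x] D(2)[of x] by linarith
  then show ?thesis using f g unfolding bcs_def by (auto intro: csupp_add)
qed

lemma bcs_diff: "bcs f \<Longrightarrow> bcs g \<Longrightarrow> bcs (\<lambda>x. f x - g x)"
  using bcs_add[of f "\<lambda>x. -1 * g x"] bcs_const_mult[of g "-1"] by simp

lemma bcs_compose:
  assumes "bcs f" "F \<in> borel_measurable borel" "F 0 = 0" "\<And>C. \<exists>D. \<forall>t. \<bar>t\<bar> \<le> C \<longrightarrow> \<bar>F t\<bar> \<le> D"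
  shows "bcs (\<lambda>x. F (f x))"
proof -
  obtain C where C: "C > 0" "\<And>x. \<bar>f x\<bar> \<le> C" using bcsE[OF assms(1)] by blast
  obtain D where "\<forall>t. \<bar>t\<bar> \<le> C \<longrightarrow> \<bar>F t\<bar> \<le> D" using assms(4) by blast
  with C have "\<And>x. \<bar>F (f x)\<bar> \<le> D" by blast
  moreover have "csupp (\<lambda>x. F (f x))" using bcs_csupp[OF assms(1)] assms(3) by (force simp: csupp_def)
  moreover have "(\<lambda>x. F (f x)) \<in> borel_measurable borel"
    using measurable_compose[OF bcs_measurable[OF assms(1)] assms(2)] .
  ultimately show ?thesis unfolding bcs_def by blast
qed

lemma bcs_abs: "bcs f \<Longrightarrow> bcs (\<lambda>x. \<bar>f x\<bar>)"
  by (rule bcs_compose) auto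

lemma bcs_abs_powr: "bcs f \<Longrightarrow> r > 0 \<Longrightarrow> bcs (\<lambda>x. \<bar>f x\<bar> powr r)"
  by (rule bcs_compose[where F="\<lambda>t. \<bar>t\<bar> powr r"])
    (auto intro!: powr_mono2 exI[of _ "_ powr r"])

lemma bcs_power2: "bcs f \<Longrightarrow> bcs (\<lambda>x. (f x)\<^sup>2)"
  by (simp add: power2_eq_square bcs_mult)

lemma bcs_affine:
  fixes f :: "'a::euclidean_space \<Rightarrow> real"
  assumes "bcs f" "c \<noteq> 0"
  shows "bcs (\<lambda>y. f (a + c *\<^sub>R y))"
proof -
  obtain B where B: "\<forall>x. norm x > B \<longrightarrow> f x = 0" using assms by (auto simp: csupp_def bcs_def)
  have "f (a + c *\<^sub>R y) = 0" if "norm y > (\<bar>B\<bar> + norm a) / \<bar>c\<bar>" for y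
  proof -
    have "norm (c *\<^sub>R y) \<le> norm (a + c *\<^sub>R y) + norm a"
      using norm_triangle_ineq4[of "a + c *\<^sub>R y" a] by simp
    moreover have "norm (c *\<^sub>R y) > \<bar>B\<bar> + norm a" using that assms(2) by (simp add: field_simps)
    ultimately show ?thesis using B by auto
  qed
  moreover have [measurable]: "f \<in> borel_measurable borel" using assms bcs_measurable by auto
  ultimately show ?thesis using assms by (auto simp: bcs_def intro: csuppI)
qed

lemma bcs_minus_shift: "bcs f \<Longrightarrow> bcs (\<lambda>y. f (x - y))"
  using bcs_affine[of f "-1" x] by simp

lemma bcs_shift: "bcs f \<Longrightarrow> bcs (\<lambda>y. f (y - x))"
  using bcs_affine[of f "1" "-x"] by simp

text \<open>The integrand of a convolution lies in the same class on the product space: if x - y and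
  y are bounded, so is x.\<close>

lemma conv_integrand_bcs:
  fixes k w :: "'a::euclidean_space \<Rightarrow> real"
  assumes "bcs k" "bcs w"
  shows "bcs (\<lambda>p::'a\<times>'a. k (fst p - snd p) * w (snd p))"
proof -
  obtain C where C: "C > 0" "\<And>x. \<bar>k x\<bar> \<le> C" using bcsE[OF assms(1)] by blast
  obtain D where D: "D > 0" "\<And>x. \<bar>w x\<bar> \<le> D" using bcsE[OF assms(2)] by blast
  obtain A where A: "\<forall>x. norm x > A \<longrightarrow> k x = 0" using assms by (auto simp: csupp_def bcs_def)
  obtain B where B: "\<forall>x. norm x > B \<longrightarrow> w x = 0" using assms by (auto simp: csupp_def bcs_def)
  have [measurable]: "k \<in> borel_measurable borel" "w \<in> borel_measurable borel"
    using assms bcs_measurable by auto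
  show ?thesis
  proof (rule bcsI[where B="\<bar>A\<bar> + 2*\<bar>B\<bar>" and C="C*D"])
    show "(\<lambda>p::'a\<times>'a. k (fst p - snd p) * w (snd p)) \<in> borel_measurable borel"
      unfolding borel_prod[symmetric] by measurable
    fix p :: "'a \<times> 'a"
    show "\<bar>k (fst p - snd p) * w (snd p)\<bar> \<le> C * D"
      unfolding abs_mult using C D by (intro mult_mono) (auto intro: less_imp_le)
    assume p: "norm p > \<bar>A\<bar> + 2*\<bar>B\<bar>"
    have "norm p \<le> norm (fst p) + norm (snd p)" using norm_Pair_le[of "fst p" "snd p"] by simp
    moreover have "norm (fst p) \<le> norm (fst p - snd p) + norm (snd p)"
      using norm_triangle_sub by (metis add.commute)
    ultimately have "norm (fst p - snd p) > A \<or> norm (snd p) > B" using p by linarith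
    then show "k (fst p - snd p) * w (snd p) = 0" using A B by auto
  qed
qed

lemma fubini_bcs:
  fixes F :: "'a::euclidean_space \<times> 'a \<Rightarrow> real"
  assumes "bcs F"
  shows "(\<integral>x. (\<integral>y. F (x, y) \<partial>lborel) \<partial>lborel) = (\<integral>y. (\<integral>x. F (x, y) \<partial>lborel) \<partial>lborel)"
    and "integrable lborel (\<lambda>x. \<integral>y. F (x, y) \<partial>lborel)"
proof -
  have int: "integrable (lborel \<Otimes>\<^sub>M lborel) F"
    using bcs_integrable[OF assms] by (simp add: lborel_prod)
  show "(\<integral>x. (\<integral>y. F (x, y) \<partial>lborel) \<partial>lborel) = (\<integral>y. (\<integral>x. F (x, y) \<partial>lborel) \<partial>lborel)"
    using lborel_pair.Fubini_integral[of "\<lambda>x y. F (x, y)"] int by (simp add: case_prod_eta)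
  show "integrable lborel (\<lambda>x. \<integral>y. F (x, y) \<partial>lborel)"
    using lborel_pair.integrable_fst[of "\<lambda>x y. F (x, y)"] int by (simp add: case_prod_eta)
qed

lemma bcs_conv:
  fixes k w :: "'a::euclidean_space \<Rightarrow> real"
  assumes "bcs k" "bcs w"
  shows "bcs (conv k w)"
proof -
  obtain C where C: "C > 0" "\<And>x. \<bar>k x\<bar> \<le> C" using bcsE[OF assms(1)] by blast
  obtain A where A: "\<forall>x. norm x > A \<longrightarrow> k x = 0" using assms by (auto simp: csupp_def bcs_def)
  obtain B where B: "\<forall>x. norm x > B \<longrightarrow> w x = 0" using assms by (auto simp: csupp_def bcs_def)
  have [measurable]: "k \<in> borel_measurable borel" "w \<in> borel_measurable borel"
    using assms bcs_measurable by auto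
  have iw: "integrable lborel (\<lambda>y. \<bar>w y\<bar>)" using bcs_integrable[OF assms(2)] by simp
  have "\<bar>conv k w x\<bar> \<le> C * (\<integral>y. \<bar>w y\<bar> \<partial>lborel)" for x
  proof -
    have "\<bar>conv k w x\<bar> \<le> (\<integral>y. \<bar>k (x - y) * w y\<bar> \<partial>lborel)" unfolding conv_def by (rule integral_abs_bound)
    also have "\<dots> \<le> (\<integral>y. C * \<bar>w y\<bar> \<partial>lborel)"
      using C bcs_integrable[OF assms(2)] bcs_mult[OF bcs_minus_shift[OF assms(1), of x] assms(2)]
      by (intro integral_mono integrable_abs integrable_mult_right)
        (auto simp: abs_mult mult_right_mono intro: bcs_integrable)
    finally show ?thesis by simp
  qed
  moreover have "conv k w x = 0" if "norm x > \<bar>A\<bar> + \<bar>B\<bar>" for x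
  proof -
    have "k (x - y) * w y = 0" for y
    proof -
      have "norm x \<le> norm (x - y) + norm y" using norm_triangle_sub by (metis add.commute)
      then have "norm (x - y) > A \<or> norm y > B" using that by linarith
      then show ?thesis using A B by auto
    qed
    then show ?thesis unfolding conv_def by (simp only:) simp
  qed
  moreover have "conv k w \<in> borel_measurable borel"
    unfolding conv_def by measurable
  ultimately show ?thesis unfolding bcs_def by (auto intro: csuppI)
qed

lemma conv_bilinear:
  fixes k w h :: "'a::euclidean_space \<Rightarrow> real"
  assumes "bcs k" "bcs w" "bcs h"
  shows "(\<integral>x. conv k w x * h x \<partial>lborel) = (\<integral>y. w y * (\<integral>x. k (x - y) * h x \<partial>lborel) \<partial>lborel)"
proof -
  obtain D where D: "D > 0" "\<And>x. \<bar>h x\<bar> \<le> D" using bcsE[OF assms(3)] by blast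
  have [measurable]: "h \<in> borel_measurable borel" using assms bcs_measurable by auto
  have F: "bcs (\<lambda>p::'a\<times>'a. k (fst p - snd p) * w (snd p) * h (fst p))"
    by (rule bcs_mult_bounded[OF conv_integrand_bcs[OF assms(1,2)], where C=D])
      (use D in \<open>auto simp: borel_prod[symmetric]\<close>)
  have "(\<integral>x. conv k w x * h x \<partial>lborel) = (\<integral>x. (\<integral>y. k (x - y) * w y * h x \<partial>lborel) \<partial>lborel)"
    by (simp add: conv_def)
  also have "\<dots> = (\<integral>y. (\<integral>x. k (x - y) * w y * h x \<partial>lborel) \<partial>lborel)"
    using fubini_bcs(1)[OF F] by simp
  also have "\<dots> = (\<integral>y. w y * (\<integral>x. k (x - y) * h x \<partial>lborel) \<partial>lborel)"
  proof (rule Bochner_Integration.integral_cong[OF refl])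
    fix y
    have "(\<integral>x. k (x - y) * w y * h x \<partial>lborel) = (\<integral>x. w y * (k (x - y) * h x) \<partial>lborel)"
      by (simp add: mult_ac)
    then show "(\<integral>x. k (x - y) * w y * h x \<partial>lborel) = w y * (\<integral>x. k (x - y) * h x \<partial>lborel)"
      by simp
  qed
  finally show ?thesis .
qed

text \<open>The inner product of two convolutions depends on the kernels only through their
  cross-correlation. An identity between integrals of translated kernels therefore passes to the
  operators, although \<open>w\<close> and \<open>w'\<close> are merely bounded.\<close>

lemma conv_cong_autocorrelation:
  fixes k k' l l' w w' :: "'a::euclidean_space \<Rightarrow> real"
  assumes bcs: "bcs k" "bcs k'" "bcs l" "bcs l'" "bcs w" "bcs w'"
    and eq: "\<And>y z. (\<integral>x. k (x - y) * k' (x - z) \<partial>lborel) = (\<integral>x. l (x - y) * l' (x - z) \<partial>lborel)"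
  shows "(\<integral>x. conv k w x * conv k' w' x \<partial>lborel) = (\<integral>x. conv l w x * conv l' w' x \<partial>lborel)"
proof -
  have *: "(\<integral>x. conv k w x * conv k' w' x \<partial>lborel) =
    (\<integral>y. w y * (\<integral>z. w' z * (\<integral>x. k (x - y) * k' (x - z) \<partial>lborel) \<partial>lborel) \<partial>lborel)"
    if "bcs k" "bcs k'" for k k' :: "'a \<Rightarrow> real"
  proof -
    have "(\<integral>x. k (x - y) * conv k' w' x \<partial>lborel) = (\<integral>z. w' z * (\<integral>x. k (x - y) * k' (x - z) \<partial>lborel) \<partial>lborel)" for y
      using conv_bilinear[OF that(2) bcs(6) bcs_shift[OF that(1), of y]] by (simp add: mult.commute)
    then show ?thesis
      using conv_bilinear[OF that(1) bcs(5) bcs_conv[OF that(2) bcs(6)]] by simp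
  qed
  show ?thesis unfolding *[OF bcs(1,2)] *[OF bcs(3,4)] eq ..
qed

lemma conv_abs_le:
  assumes "bcs k" "bcs w"
  shows "\<bar>conv k w x\<bar> \<le> conv (\<lambda>x. \<bar>k x\<bar>) (\<lambda>x. \<bar>w x\<bar>) x"
  unfolding conv_def using integral_abs_bound[of lborel "\<lambda>y. k (x - y) * w y"] by (simp add: abs_mult)

lemma integral_conv:
  fixes k w :: "'a::euclidean_space \<Rightarrow> real"
  assumes "bcs k" "bcs w"
  shows "(\<integral>x. conv k w x \<partial>lborel) = (\<integral>x. k x \<partial>lborel) * (\<integral>x. w x \<partial>lborel)"
proof -
  have "(\<integral>x. conv k w x \<partial>lborel) = (\<integral>y. (\<integral>x. k (x - y) * w y \<partial>lborel) \<partial>lborel)"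
    using fubini_bcs(1)[OF conv_integrand_bcs[OF assms]] by (simp add: conv_def)
  also have "\<dots> = (\<integral>y. (\<integral>x. k x \<partial>lborel) * w y \<partial>lborel)"
    using integral_translate[OF bcs_integrable[OF assms(1)], of "- _"] by simp
  finally show ?thesis by simp
qed

lemma conv_L1:
  fixes k w :: "'a::euclidean_space \<Rightarrow> real"
  assumes "bcs k" "bcs w"
  shows "(\<integral>x. \<bar>conv k w x\<bar> \<partial>lborel) \<le> (\<integral>x. \<bar>k x\<bar> \<partial>lborel) * (\<integral>x. \<bar>w x\<bar> \<partial>lborel)"
proof -
  have "(\<integral>x. \<bar>conv k w x\<bar> \<partial>lborel) \<le> (\<integral>x. conv (\<lambda>x. \<bar>k x\<bar>) (\<lambda>x. \<bar>w x\<bar>) x \<partial>lborel)"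
    by (intro integral_mono bcs_integrable bcs_abs bcs_conv conv_abs_le assms)
  then show ?thesis using integral_conv[OF assms[THEN bcs_abs]] by simp
qed

text \<open>Young's inequality for an \<open>L1\<close> kernel. Instead of Cauchy-Schwarz,
  \<open>2 * s\<close> times the squared convolution is estimated under the integral by the
  arithmetic-geometric mean. The choice \<open>s = 1 / ?N\<close> yields the factor
  \<open>?N\<^sup>2\<close>, and \<open>s = 1\<close> settles a kernel of norm 0.\<close>

lemma conv_L2:
  fixes k w :: "'a::euclidean_space \<Rightarrow> real"
  assumes "bcs k" "bcs w"
  shows "(\<integral>x. (conv k w x)\<^sup>2 \<partial>lborel) \<le> (\<integral>x. \<bar>k x\<bar> \<partial>lborel)\<^sup>2 * (\<integral>x. (w x)\<^sup>2 \<partial>lborel)"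
proof -
  let ?N = "\<integral>x. \<bar>k x\<bar> \<partial>lborel" and ?k = "\<lambda>x. \<bar>k x\<bar>" and ?u = "conv k w"
  have u: "bcs ?u" using assms by (rule bcs_conv)
  have N0: "?N \<ge> 0" by simp
  have young: "2 * s * (\<integral>x. (?u x)\<^sup>2 \<partial>lborel) \<le> ?N * (\<integral>x. (w x)\<^sup>2 \<partial>lborel) + s\<^sup>2 * ?N * (\<integral>x. (?u x)\<^sup>2 \<partial>lborel)"
    if "s \<ge> 0" for s
  proof -
    have k1: "bcs (\<lambda>y. k (x - y) * w y)" for x
      using bcs_mult[OF bcs_minus_shift[OF assms(1), of x] assms(2)] .
    have k2: "bcs (\<lambda>y. \<bar>k (x - y)\<bar> * (w y)\<^sup>2)" for x
      using bcs_mult[OF bcs_minus_shift[OF bcs_abs[OF assms(1)], of x] bcs_power2[OF assms(2)]] .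
    have k3: "bcs (\<lambda>y. \<bar>k (x - y)\<bar>)" for x
      using bcs_minus_shift[OF bcs_abs[OF assms(1)], of x] .
    have "2 * s * (?u x)\<^sup>2 \<le> conv ?k (\<lambda>x. (w x)\<^sup>2) x + s\<^sup>2 * ?N * (?u x)\<^sup>2" for x
    proof -
      have "2 * s * (?u x)\<^sup>2 = (\<integral>y. (2 * s * ?u x) * (k (x - y) * w y) \<partial>lborel)"
        by (simp add: conv_def power2_eq_square)
      also have "\<dots> \<le> (\<integral>y. \<bar>k (x - y)\<bar> * (w y)\<^sup>2 + (s\<^sup>2 * (?u x)\<^sup>2) * \<bar>k (x - y)\<bar> \<partial>lborel)"
      proof (intro integral_mono bcs_integrable bcs_add bcs_const_mult k1 k2 k3)
        fix y
        have "0 \<le> (\<bar>w y\<bar> - s * \<bar>?u x\<bar>)\<^sup>2" by simp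
        then have *: "2 * s * \<bar>?u x\<bar> * \<bar>w y\<bar> \<le> (w y)\<^sup>2 + s\<^sup>2 * (?u x)\<^sup>2"
          by (simp add: power2_diff power_mult_distrib algebra_simps)
        have "(2 * s * ?u x) * (k (x - y) * w y) \<le> \<bar>k (x - y)\<bar> * (2 * s * \<bar>?u x\<bar> * \<bar>w y\<bar>)"
          using abs_ge_self[of "(2 * s * ?u x) * (k (x - y) * w y)"] that by (simp add: abs_mult mult_ac)
        also have "\<dots> \<le> \<bar>k (x - y)\<bar> * ((w y)\<^sup>2 + s\<^sup>2 * (?u x)\<^sup>2)" using * by (rule mult_left_mono) simp
        finally show "(2 * s * ?u x) * (k (x - y) * w y) \<le> \<bar>k (x - y)\<bar> * (w y)\<^sup>2 + (s\<^sup>2 * (?u x)\<^sup>2) * \<bar>k (x - y)\<bar>"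
          by (simp add: algebra_simps)
      qed
      also have "\<dots> = conv ?k (\<lambda>x. (w x)\<^sup>2) x + s\<^sup>2 * (?u x)\<^sup>2 * (\<integral>y. \<bar>k (x - y)\<bar> \<partial>lborel)"
        using bcs_integrable[OF k2] bcs_integrable[OF k3] by (simp add: conv_def)
      also have "(\<integral>y. \<bar>k (x - y)\<bar> \<partial>lborel) = ?N"
        using integral_reflect[OF bcs_integrable[OF bcs_abs[OF assms(1)]], of x] .
      finally show ?thesis by (simp add: mult_ac)
    qed
    then have "(\<integral>x. 2 * s * (?u x)\<^sup>2 \<partial>lborel) \<le> (\<integral>x. conv ?k (\<lambda>x. (w x)\<^sup>2) x + s\<^sup>2 * ?N * (?u x)\<^sup>2 \<partial>lborel)"
      by (intro integral_mono bcs_integrable bcs_add bcs_const_mult bcs_conv bcs_power2 u bcs_abs assms)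
    also have "\<dots> = (\<integral>x. conv ?k (\<lambda>x. (w x)\<^sup>2) x \<partial>lborel) + s\<^sup>2 * ?N * (\<integral>x. (?u x)\<^sup>2 \<partial>lborel)"
      using bcs_integrable[OF bcs_conv[OF bcs_abs[OF assms(1)] bcs_power2[OF assms(2)]]] bcs_integrable[OF bcs_power2[OF u]]
      by simp
    finally show ?thesis using integral_conv[OF bcs_abs[OF assms(1)] bcs_power2[OF assms(2)]] by simp
  qed
  show ?thesis
  proof (cases "?N = 0")
    case True
    from young[of 1] True show ?thesis by simp
  next
    case False
    with N0 have "?N > 0" by linarith
    then show ?thesis using young[of "1 / ?N"] by (simp add: field_simps power2_eq_square)
  qed
qed

text \<open>Hessian and Laplacian of a potential have the same \<open>L2\<close> norm, proved
  without Fourier transform. By symmetry the square of an off-diagonal entry is the product of the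
  (i, j) and (j, i) entries; exchanging derivatives turns it into the product of the two diagonal
  ones, and the double sum of these is the square of the divergence. A single entry is bounded by
  the whole sum.\<close>

lemma conv_L2_symmetric_jacobian:
  fixes \<kappa> :: "'n \<Rightarrow> real^'n::finite \<Rightarrow> real"
  assumes \<kappa>: "\<And>i. C1 (\<kappa> i)" "\<And>i. csupp (\<kappa> i)"
    and sym: "\<And>i j. pderiv i (\<kappa> j) = pderiv j (\<kappa> i)" and w: "bcs w"
  shows "(\<integral>x. (conv (pderiv i (\<kappa> j)) w x)\<^sup>2 \<partial>lborel) \<le>
    (\<integral>x. (conv (\<lambda>x. \<Sum>i\<in>UNIV. pderiv i (\<kappa> i) x) w x)\<^sup>2 \<partial>lborel)"
proof -
  have pb: "bcs (pderiv i (\<kappa> j))" for i j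
    using \<kappa> by (intro continuous_bcs csupp_pderiv) auto
  have shift: "C1 (\<lambda>x. \<kappa> i (x - y))" "pderiv j (\<lambda>x. \<kappa> i (x - y)) x = pderiv j (\<kappa> i) (x - y)"
    "csupp (\<lambda>x. \<kappa> i (x - y))" for i j y x
    using C1_affine'[OF \<kappa>(1), of i "-y" 1] pderiv_affine[OF \<kappa>(1), of j i "-y" 1 x]
      bcs_csupp[OF bcs_shift[OF continuous_bcs[OF C1_continuous[OF \<kappa>(1)] \<kappa>(2)]]] by auto
  have swap: "(\<integral>x. conv (pderiv j (\<kappa> i)) w x * conv (pderiv i (\<kappa> j)) w x \<partial>lborel) =
     (\<integral>x. conv (pderiv i (\<kappa> i)) w x * conv (pderiv j (\<kappa> j)) w x \<partial>lborel)" for i j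
  proof (rule conv_cong_autocorrelation[OF pb pb pb pb w w])
    fix y z
    show "(\<integral>x. pderiv j (\<kappa> i) (x - y) * pderiv i (\<kappa> j) (x - z) \<partial>lborel) =
      (\<integral>x. pderiv i (\<kappa> i) (x - y) * pderiv j (\<kappa> j) (x - z) \<partial>lborel)"
      using integral_pderiv_swap[OF shift(1)[of i y] shift(1)[of j z] shift(3), of j i]
      by (simp add: shift(2))
  qed
  have int: "integrable lborel (\<lambda>x. conv (pderiv i (\<kappa> j)) w x * conv (pderiv k (\<kappa> l)) w x)" for i j k l
    by (intro bcs_integrable bcs_mult bcs_conv pb w)
  have div: "conv (\<lambda>x. \<Sum>i\<in>UNIV. pderiv i (\<kappa> i) x) w x = (\<Sum>i\<in>UNIV. conv (pderiv i (\<kappa> i)) w x)" for x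
    unfolding conv_def using bcs_mult[OF bcs_minus_shift[OF pb] w]
    by (subst Bochner_Integration.integral_sum[symmetric]) (auto simp: sum_distrib_right intro: bcs_integrable)
  have "(\<integral>x. (conv (pderiv i (\<kappa> j)) w x)\<^sup>2 \<partial>lborel) \<le>
     (\<Sum>k\<in>UNIV. \<Sum>l\<in>UNIV. \<integral>x. (conv (pderiv k (\<kappa> l)) w x)\<^sup>2 \<partial>lborel)"
    by (rule order_trans[OF member_le_sum[where f="\<lambda>l. \<integral>x. (conv (pderiv i (\<kappa> l)) w x)\<^sup>2 \<partial>lborel" and i=j]
        member_le_sum[where f="\<lambda>k. \<Sum>l\<in>UNIV. \<integral>x. (conv (pderiv k (\<kappa> l)) w x)\<^sup>2 \<partial>lborel"]])
      (auto intro!: sum_nonneg)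
  also have "\<dots> = (\<Sum>k\<in>UNIV. \<Sum>l\<in>UNIV. \<integral>x. conv (pderiv k (\<kappa> k)) w x * conv (pderiv l (\<kappa> l)) w x \<partial>lborel)"
  proof (intro sum.cong refl)
    fix k l
    show "(\<integral>x. (conv (pderiv k (\<kappa> l)) w x)\<^sup>2 \<partial>lborel) =
      (\<integral>x. conv (pderiv k (\<kappa> k)) w x * conv (pderiv l (\<kappa> l)) w x \<partial>lborel)"
      using swap[of k l] unfolding sym[of l k] by (simp only: power2_eq_square mult.commute)
  qed
  also have "\<dots> = (\<integral>x. (\<Sum>k\<in>UNIV. \<Sum>l\<in>UNIV. conv (pderiv k (\<kappa> k)) w x * conv (pderiv l (\<kappa> l)) w x) \<partial>lborel)"
    using int by simp
  also have "\<dots> = (\<integral>x. (conv (\<lambda>x. \<Sum>i\<in>UNIV. pderiv i (\<kappa> i) x) w x)\<^sup>2 \<partial>lborel)"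
    by (simp add: div power2_eq_square sum_product)
  finally show ?thesis .
qed

subsection \<open>Interpolation between the two endpoints\<close>

lemma nn_integral_powr_below:
  fixes s b :: real
  assumes "s > -1" "b \<ge> 0"
  shows "(\<integral>\<^sup>+t. ennreal (t powr s) * indicator {0<..<b} t \<partial>lborel) = ennreal (b powr (s+1) / (s+1))"
proof -
  have "((\<lambda>x. x powr s) has_integral b powr (s+1) / (s+1)) {0<..<b}"
    using has_integral_powr_from_0[OF assms] has_integral_Icc_iff_Ioo by blast
  from nn_integral_has_integral_lebesgue[OF _ this]
  have "(\<integral>\<^sup>+t. ennreal (indicator {0<..<b} t * t powr s) \<partial>lborel) = ennreal (b powr (s+1) / (s+1))" by simp
  then show ?thesis by (simp add: ennreal_mult' ennreal_indicator mult.commute)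
qed

lemma nn_integral_powr_above:
  fixes s b :: real
  assumes "s < -1" "b > 0"
  shows "(\<integral>\<^sup>+t. ennreal (t powr s) * indicator {b..} t \<partial>lborel) = ennreal (- (b powr (s+1)) / (s+1))"
proof -
  from nn_integral_has_integral_lebesgue[OF _ has_integral_powr_to_inf[OF assms]]
  have "(\<integral>\<^sup>+t. ennreal (indicator {b..} t * t powr s) \<partial>lborel) = ennreal (- (b powr (s+1)) / (s+1))" by simp
  then show ?thesis by (simp add: ennreal_mult' ennreal_indicator mult.commute)
qed

text \<open>Marcinkiewicz interpolation carried out by hand. In the application the
  \<open>L1\<close> constant \<open>N\<close> counts scales while the \<open>L2\<close> constant
  \<open>C\<close> stays fixed, so what matters is the power \<open>N powr (2 - r)\<close>; the
  dependence on \<open>r\<close> is left crude.\<close>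

lemma conv_interpolation:
  fixes k w :: "'a::euclidean_space \<Rightarrow> real"
  assumes k: "bcs k" and N: "N > 0" "(\<integral>x. \<bar>k x\<bar> \<partial>lborel) \<le> N"
    and L2: "\<And>w. bcs w \<Longrightarrow> (\<integral>x. (conv k w x)\<^sup>2 \<partial>lborel) \<le> C * (\<integral>x. (w x)\<^sup>2 \<partial>lborel)"
    and C: "C \<ge> 0" and r: "1 < r" "r < 2" and w: "bcs w"
  shows "(\<integral>x. \<bar>conv k w x\<bar> powr r \<partial>lborel) \<le>
    2 powr r * (C * r / (2 - r) + r / (r - 1)) * N powr (2 - r) * (\<integral>x. \<bar>w x\<bar> powr r \<partial>lborel)"
proof -
  let ?T = "conv k"
  have [measurable]: "w \<in> borel_measurable borel" "?T w \<in> borel_measurable borel"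
    using w bcs_conv[OF k w] bcs_measurable by auto
  \<comment> \<open>Cutting at height \<open>t * N\<close> rather than \<open>t\<close> balances the
    two halves: both end up with the same factor \<open>N powr (2 - r)\<close>.\<close>
  define wl where "wl t = (\<lambda>x. w x * (if \<bar>w x\<bar> \<le> t * N then 1 else 0))" for t
  define wu where "wu t = (\<lambda>x. w x * (if \<bar>w x\<bar> > t * N then 1 else 0))" for t
  have wl: "bcs (wl t)" and wu: "bcs (wu t)" for t
    unfolding wl_def wu_def by (rule bcs_mult_bounded[OF w, where C=1]; simp; measurable)+
  have split: "?T w x = ?T (wl t) x + ?T (wu t) x" for t x
  proof -
    have "?T w x = (\<integral>y. k (x - y) * wl t y + k (x - y) * wu t y \<partial>lborel)"
      unfolding conv_def by (rule Bochner_Integration.integral_cong) (auto simp: wl_def wu_def)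
    then show ?thesis
      using bcs_mult[OF bcs_minus_shift[OF k] wl] bcs_mult[OF bcs_minus_shift[OF k] wu]
      by (simp add: conv_def bcs_integrable)
  qed
  \<comment> \<open>Level \<open>2 * t\<close>: where the sum exceeds it, one of the two pieces
    exceeds \<open>t\<close>.\<close>
  define A where "A t = emeasure lborel {x. \<bar>?T w x\<bar> > 2 * t}" for t
  have weak: "A t \<le> ennreal (C * t powr (-2)) * (\<integral>\<^sup>+x. ennreal ((wl t x)\<^sup>2) \<partial>lborel)
      + ennreal (N * t powr (-1)) * (\<integral>\<^sup>+x. ennreal \<bar>wu t x\<bar> \<partial>lborel)" if "t > 0" for t
  proof -
    have [measurable]: "?T (wl t) \<in> borel_measurable borel" "?T (wu t) \<in> borel_measurable borel"
      using wl wu bcs_conv[OF k] bcs_measurable by auto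
    have "A t = (\<integral>\<^sup>+x. indicator {x. \<bar>?T w x\<bar> > 2 * t} x \<partial>lborel)" by (simp add: A_def)
    also have "\<dots> \<le> (\<integral>\<^sup>+x. ennreal (t powr (-2) * (?T (wl t) x)\<^sup>2 + t powr (-1) * \<bar>?T (wu t) x\<bar>) \<partial>lborel)"
    proof (rule nn_integral_mono)
      fix x
      have "1 \<le> t powr (-2) * (?T (wl t) x)\<^sup>2 + t powr (-1) * \<bar>?T (wu t) x\<bar>" if "\<bar>?T w x\<bar> > 2 * t"
      proof -
        have "\<bar>?T (wl t) x\<bar> > t \<or> \<bar>?T (wu t) x\<bar> > t" using that split[of x t] by linarith
        then show ?thesis
        proof
          assume *: "\<bar>?T (wl t) x\<bar> > t"
          then have "(?T (wl t) x)\<^sup>2 \<ge> t\<^sup>2" using \<open>t > 0\<close> power_mono[of t "\<bar>?T (wl t) x\<bar>" 2] by simp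
          then have "1 \<le> t powr (-2) * (?T (wl t) x)\<^sup>2"
            using \<open>t > 0\<close> by (simp add: powr_minus powr_numeral field_simps)
          then show ?thesis by (smt (verit) abs_ge_zero mult_nonneg_nonneg powr_ge_zero)
        next
          assume *: "\<bar>?T (wu t) x\<bar> > t"
          then have "1 \<le> t powr (-1) * \<bar>?T (wu t) x\<bar>"
            using \<open>t > 0\<close> by (simp add: powr_minus field_simps)
          then show ?thesis by (smt (verit) zero_le_power2 mult_nonneg_nonneg powr_ge_zero)
        qed
      qed
      then show "indicator {x. \<bar>?T w x\<bar> > 2 * t} x \<le>
         ennreal (t powr (-2) * (?T (wl t) x)\<^sup>2 + t powr (-1) * \<bar>?T (wu t) x\<bar>)"
        unfolding ennreal_indicator[symmetric]
        by (intro ennreal_leI) (auto simp: indicator_def intro!: add_nonneg_nonneg)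
    qed
    also have "\<dots> = ennreal (\<integral>x. t powr (-2) * (?T (wl t) x)\<^sup>2 + t powr (-1) * \<bar>?T (wu t) x\<bar> \<partial>lborel)"
      by (intro nn_integral_eq_integral bcs_integrable bcs_add bcs_const_mult bcs_power2 bcs_abs bcs_conv k wl wu)
        (auto intro!: add_nonneg_nonneg)
    also have "\<dots> \<le> ennreal (C * t powr (-2) * (\<integral>x. (wl t x)\<^sup>2 \<partial>lborel) + N * t powr (-1) * (\<integral>x. \<bar>wu t x\<bar> \<partial>lborel))"
    proof (rule ennreal_leI)
      have i: "integrable lborel (\<lambda>x. (?T (wl t) x)\<^sup>2)" "integrable lborel (\<lambda>x. \<bar>?T (wu t) x\<bar>)"
        by (intro bcs_integrable bcs_power2 bcs_abs bcs_conv k wl wu)+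
      have "(\<integral>x. \<bar>?T (wu t) x\<bar> \<partial>lborel) \<le> N * (\<integral>x. \<bar>wu t x\<bar> \<partial>lborel)"
        by (rule order_trans[OF conv_L1[OF k wu]]) (intro mult_right_mono N, simp)
      from mult_left_mono[OF this, of "t powr (-1)"] mult_left_mono[OF L2[OF wl], of "t powr (-2)" t]
      show "(\<integral>x. t powr (-2) * (?T (wl t) x)\<^sup>2 + t powr (-1) * \<bar>?T (wu t) x\<bar> \<partial>lborel)
        \<le> C * t powr (-2) * (\<integral>x. (wl t x)\<^sup>2 \<partial>lborel) + N * t powr (-1) * (\<integral>x. \<bar>wu t x\<bar> \<partial>lborel)"
        using i by (simp add: mult_ac)
    qed
    also have "\<dots> = ennreal (C * t powr (-2)) * ennreal (\<integral>x. (wl t x)\<^sup>2 \<partial>lborel)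
       + ennreal (N * t powr (-1)) * ennreal (\<integral>x. \<bar>wu t x\<bar> \<partial>lborel)"
      using C N by (simp flip: ennreal_mult ennreal_plus)
    also have "ennreal (\<integral>x. (wl t x)\<^sup>2 \<partial>lborel) = (\<integral>\<^sup>+x. ennreal ((wl t x)\<^sup>2) \<partial>lborel)"
      by (rule nn_integral_eq_integral[symmetric]) (auto intro: bcs_integrable bcs_power2 wl)
    also have "ennreal (\<integral>x. \<bar>wu t x\<bar> \<partial>lborel) = (\<integral>\<^sup>+x. ennreal \<bar>wu t x\<bar> \<partial>lborel)"
      by (rule nn_integral_eq_integral[symmetric]) (auto intro: bcs_integrable bcs_abs wu)
    finally show ?thesis .
  qed
  \<comment> \<open>Layer-cake formula, written with \<open>\<bar>a\<bar> / 2\<close> to match the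
    level \<open>2 * t\<close>; this produces the factor \<open>2 powr r\<close>.\<close>
  have layer: "ennreal (\<bar>a\<bar> powr r) = ennreal (2 powr r * r) * (\<integral>\<^sup>+t. ennreal (t powr (r-1)) * indicator {0<..<\<bar>a\<bar>/2} t \<partial>lborel)" for a
    using r by (subst nn_integral_powr_below)
      (auto simp: powr_divide simp flip: ennreal_mult)
  have start: "(\<integral>\<^sup>+x. ennreal (\<bar>?T w x\<bar> powr r) \<partial>lborel) =
    ennreal (2 powr r * r) * (\<integral>\<^sup>+x. (\<integral>\<^sup>+t. ennreal (t powr (r-1)) * indicator {0<..<\<bar>?T w x\<bar>/2} t \<partial>lborel) \<partial>lborel)"
    unfolding layer by (subst nn_integral_cmult) (auto simp: greaterThanLessThan_def greaterThan_def lessThan_def)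
  have "(\<integral>\<^sup>+x. (\<integral>\<^sup>+t. ennreal (t powr (r-1)) * indicator {0<..<\<bar>?T w x\<bar>/2} t \<partial>lborel) \<partial>lborel)
    = (\<integral>\<^sup>+t. (\<integral>\<^sup>+x. ennreal (t powr (r-1)) * indicator {0<..<\<bar>?T w x\<bar>/2} t \<partial>lborel) \<partial>lborel)"
    by (rule lborel_pair.Fubini'[symmetric]) (simp add: indicator_def)
  also have "\<dots> = (\<integral>\<^sup>+t. ennreal (t powr (r-1)) * indicator {0<..} t * A t \<partial>lborel)"
  proof (rule nn_integral_cong)
    fix t
    have "(\<integral>\<^sup>+x. ennreal (t powr (r-1)) * indicator {0<..<\<bar>?T w x\<bar>/2} t \<partial>lborel) =
      (\<integral>\<^sup>+x. (ennreal (t powr (r-1)) * indicator {0<..} t) * indicator {x. \<bar>?T w x\<bar> > 2 * t} x \<partial>lborel)"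
      by (rule nn_integral_cong) (auto simp: indicator_def)
    then show "(\<integral>\<^sup>+x. ennreal (t powr (r-1)) * indicator {0<..<\<bar>?T w x\<bar>/2} t \<partial>lborel) =
      ennreal (t powr (r-1)) * indicator {0<..} t * A t"
      by (simp add: A_def nn_integral_cmult)
  qed
  also have "\<dots> \<le> (\<integral>\<^sup>+t. (\<integral>\<^sup>+x. ennreal (C * (w x)\<^sup>2) * (ennreal (t powr (r-3)) * indicator {\<bar>w x\<bar> / N..} t * indicator {0<..} t) \<partial>lborel)
     + (\<integral>\<^sup>+x. ennreal (N * \<bar>w x\<bar>) * (ennreal (t powr (r-2)) * indicator {0<..<\<bar>w x\<bar> / N} t) \<partial>lborel) \<partial>lborel)"
  proof (rule nn_integral_mono)
    fix t :: real
    show "ennreal (t powr (r-1)) * indicator {0<..} t * A t \<le>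
     (\<integral>\<^sup>+x. ennreal (C * (w x)\<^sup>2) * (ennreal (t powr (r-3)) * indicator {\<bar>w x\<bar> / N..} t * indicator {0<..} t) \<partial>lborel)
     + (\<integral>\<^sup>+x. ennreal (N * \<bar>w x\<bar>) * (ennreal (t powr (r-2)) * indicator {0<..<\<bar>w x\<bar> / N} t) \<partial>lborel)"
    proof (cases "t > 0")
      case True
      have [measurable]: "wl t \<in> borel_measurable borel" "wu t \<in> borel_measurable borel"
        using wl wu bcs_measurable by auto
      have p: "t powr (r-1) * t powr (-2) = t powr (r-3)" "t powr (r-1) * t powr (-1) = t powr (r-2)"
        by (simp_all only: powr_add[symmetric]) simp_all
      have "ennreal (t powr (r-1)) * indicator {0<..} t * A t \<le> ennreal (t powr (r-1)) *
         (ennreal (C * t powr (-2)) * (\<integral>\<^sup>+x. ennreal ((wl t x)\<^sup>2) \<partial>lborel)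
      + ennreal (N * t powr (-1)) * (\<integral>\<^sup>+x. ennreal \<bar>wu t x\<bar> \<partial>lborel))"
        using weak[OF True] True by (auto intro: mult_left_mono)
      also have "\<dots> = (\<integral>\<^sup>+x. ennreal (t powr (r-1)) * (ennreal (C * t powr (-2)) * ennreal ((wl t x)\<^sup>2)) \<partial>lborel)
        + (\<integral>\<^sup>+x. ennreal (t powr (r-1)) * (ennreal (N * t powr (-1)) * ennreal \<bar>wu t x\<bar>) \<partial>lborel)"
        by (simp add: nn_integral_cmult distrib_left)
      also have "(\<integral>\<^sup>+x. ennreal (t powr (r-1)) * (ennreal (C * t powr (-2)) * ennreal ((wl t x)\<^sup>2)) \<partial>lborel) =
        (\<integral>\<^sup>+x. ennreal (C * (w x)\<^sup>2) * (ennreal (t powr (r-3)) * indicator {\<bar>w x\<bar> / N..} t * indicator {0<..} t) \<partial>lborel)"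
        using True N C by (intro nn_integral_cong)
          (auto simp: wl_def indicator_def field_simps p[symmetric] simp flip: ennreal_mult)
      also have "(\<integral>\<^sup>+x. ennreal (t powr (r-1)) * (ennreal (N * t powr (-1)) * ennreal \<bar>wu t x\<bar>) \<partial>lborel) =
        (\<integral>\<^sup>+x. ennreal (N * \<bar>w x\<bar>) * (ennreal (t powr (r-2)) * indicator {0<..<\<bar>w x\<bar> / N} t) \<partial>lborel)"
        using True N C by (intro nn_integral_cong)
          (auto simp: wu_def indicator_def field_simps p[symmetric] simp flip: ennreal_mult)
      finally show ?thesis .
    qed simp
  qed
  also have "\<dots> = (\<integral>\<^sup>+t. (\<integral>\<^sup>+x. ennreal (C * (w x)\<^sup>2) * (ennreal (t powr (r-3)) * indicator {\<bar>w x\<bar> / N..} t * indicator {0<..} t) \<partial>lborel) \<partial>lborel)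
     + (\<integral>\<^sup>+t. (\<integral>\<^sup>+x. ennreal (N * \<bar>w x\<bar>) * (ennreal (t powr (r-2)) * indicator {0<..<\<bar>w x\<bar> / N} t) \<partial>lborel) \<partial>lborel)"
    by (rule nn_integral_add) (simp_all add: indicator_def)
  also have "(\<integral>\<^sup>+t. (\<integral>\<^sup>+x. ennreal (C * (w x)\<^sup>2) * (ennreal (t powr (r-3)) * indicator {\<bar>w x\<bar> / N..} t * indicator {0<..} t) \<partial>lborel) \<partial>lborel)
    = (\<integral>\<^sup>+x. (\<integral>\<^sup>+t. ennreal (C * (w x)\<^sup>2) * (ennreal (t powr (r-3)) * indicator {\<bar>w x\<bar> / N..} t * indicator {0<..} t) \<partial>lborel) \<partial>lborel)"
    by (rule lborel_pair.Fubini') (simp add: indicator_def)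
  \<comment> \<open>The \<open>L2\<close> half integrates \<open>t powr (r - 3)\<close> from
    \<open>\<bar>w x\<bar> / N\<close> to infinity, which converges because
    \<open>r < 2\<close>.\<close>
  also have "\<dots> = (\<integral>\<^sup>+x. ennreal (C / (2 - r) * N powr (2-r)) * ennreal (\<bar>w x\<bar> powr r) \<partial>lborel)"
  proof (rule nn_integral_cong)
    fix x
    show "(\<integral>\<^sup>+t. ennreal (C * (w x)\<^sup>2) * (ennreal (t powr (r-3)) * indicator {\<bar>w x\<bar> / N..} t * indicator {0<..} t) \<partial>lborel)
      = ennreal (C / (2 - r) * N powr (2-r)) * ennreal (\<bar>w x\<bar> powr r)"
    proof (cases "w x = 0")
      case False
      then have b: "\<bar>w x\<bar> / N > 0" using N by simp
      have e: "(w x)\<^sup>2 * (\<bar>w x\<bar> / N) powr (r-2) = N powr (2-r) * \<bar>w x\<bar> powr r"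
      proof -
        have "(w x)\<^sup>2 = \<bar>w x\<bar> powr 2" using False by (simp add: powr_numeral)
        then have "(w x)\<^sup>2 * (\<bar>w x\<bar> / N) powr (r-2) = \<bar>w x\<bar> powr (2 + (r-2)) / N powr (r-2)"
          using N by (simp only: powr_add) (simp add: powr_divide del: powr_numeral)
        then show ?thesis using N by (simp add: powr_diff field_simps)
      qed
      have "(\<integral>\<^sup>+t. ennreal (C * (w x)\<^sup>2) * (ennreal (t powr (r-3)) * indicator {\<bar>w x\<bar> / N..} t * indicator {0<..} t) \<partial>lborel)
        = (\<integral>\<^sup>+t. ennreal (C * (w x)\<^sup>2) * (ennreal (t powr (r-3)) * indicator {\<bar>w x\<bar> / N..} t) \<partial>lborel)"
        using b by (intro nn_integral_cong) (auto simp: indicator_def)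
      also have "\<dots> = ennreal (C * (w x)\<^sup>2) * (\<integral>\<^sup>+t. ennreal (t powr (r-3)) * indicator {\<bar>w x\<bar> / N..} t \<partial>lborel)"
        by (rule nn_integral_cmult) measurable
      also have "(\<integral>\<^sup>+t. ennreal (t powr (r-3)) * indicator {\<bar>w x\<bar> / N..} t \<partial>lborel) = ennreal ((\<bar>w x\<bar> / N) powr (r-2) / (2 - r))"
        using nn_integral_powr_above[of "r-3", OF _ b] r by (simp add: minus_divide_right)
      also have "ennreal (C * (w x)\<^sup>2) * ennreal ((\<bar>w x\<bar> / N) powr (r-2) / (2 - r)) =
         ennreal (C / (2 - r) * ((w x)\<^sup>2 * (\<bar>w x\<bar> / N) powr (r-2)))"
        using C r by (simp add: mult_ac flip: ennreal_mult)
      finally show ?thesis unfolding e using C r by (simp add: mult_ac flip: ennreal_mult)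
    qed (use r in simp)
  qed
  also have "\<dots> = ennreal (C / (2 - r) * N powr (2-r)) * (\<integral>\<^sup>+x. ennreal (\<bar>w x\<bar> powr r) \<partial>lborel)"
    by (rule nn_integral_cmult) measurable
  also have "(\<integral>\<^sup>+t. (\<integral>\<^sup>+x. ennreal (N * \<bar>w x\<bar>) * (ennreal (t powr (r-2)) * indicator {0<..<\<bar>w x\<bar> / N} t) \<partial>lborel) \<partial>lborel)
    = (\<integral>\<^sup>+x. (\<integral>\<^sup>+t. ennreal (N * \<bar>w x\<bar>) * (ennreal (t powr (r-2)) * indicator {0<..<\<bar>w x\<bar> / N} t) \<partial>lborel) \<partial>lborel)"
    by (rule lborel_pair.Fubini') (simp add: indicator_def)
  \<comment> \<open>The \<open>L1\<close> half integrates \<open>t powr (r - 2)\<close> from 0 to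
    \<open>\<bar>w x\<bar> / N\<close>, which converges because \<open>r > 1\<close>.\<close>
  also have "\<dots> = (\<integral>\<^sup>+x. ennreal (1 / (r - 1) * N powr (2-r)) * ennreal (\<bar>w x\<bar> powr r) \<partial>lborel)"
  proof (rule nn_integral_cong)
    fix x
    have b: "\<bar>w x\<bar> / N \<ge> 0" using N by simp
    have e: "N * \<bar>w x\<bar> * (\<bar>w x\<bar> / N) powr (r-1) = N powr (2-r) * \<bar>w x\<bar> powr r"
    proof (cases "w x = 0")
      case False
      then have "N * \<bar>w x\<bar> * (\<bar>w x\<bar> / N) powr (r-1) = (N * N powr (1-r)) * (\<bar>w x\<bar> * \<bar>w x\<bar> powr (r-1))"
        using N by (simp add: powr_divide powr_diff field_simps)
      also have "\<bar>w x\<bar> * \<bar>w x\<bar> powr (r-1) = \<bar>w x\<bar> powr r" using False by (simp add: powr_mult_base)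
      also have "N * N powr (1-r) = N powr (2-r)" using N by (simp add: powr_mult_base)
      finally show ?thesis .
    qed (use r in simp)
    have "(\<integral>\<^sup>+t. ennreal (N * \<bar>w x\<bar>) * (ennreal (t powr (r-2)) * indicator {0<..<\<bar>w x\<bar> / N} t) \<partial>lborel)
       = ennreal (N * \<bar>w x\<bar>) * (\<integral>\<^sup>+t. ennreal (t powr (r-2)) * indicator {0<..<\<bar>w x\<bar> / N} t \<partial>lborel)"
      by (rule nn_integral_cmult) measurable
    also have "(\<integral>\<^sup>+t. ennreal (t powr (r-2)) * indicator {0<..<\<bar>w x\<bar> / N} t \<partial>lborel) = ennreal ((\<bar>w x\<bar> / N) powr (r-1) / (r-1))"
      using nn_integral_powr_below[of "r-2", OF _ b] r by simp
    also have "ennreal (N * \<bar>w x\<bar>) * ennreal ((\<bar>w x\<bar> / N) powr (r-1) / (r-1)) =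
       ennreal (1 / (r-1) * (N * \<bar>w x\<bar> * (\<bar>w x\<bar> / N) powr (r-1)))"
      using N r by (simp add: mult_ac flip: ennreal_mult)
    finally show "(\<integral>\<^sup>+t. ennreal (N * \<bar>w x\<bar>) * (ennreal (t powr (r-2)) * indicator {0<..<\<bar>w x\<bar> / N} t) \<partial>lborel)
      = ennreal (1 / (r - 1) * N powr (2-r)) * ennreal (\<bar>w x\<bar> powr r)"
      unfolding e using r by (simp add: mult_ac flip: ennreal_mult)
  qed
  also have "\<dots> = ennreal (1 / (r - 1) * N powr (2-r)) * (\<integral>\<^sup>+x. ennreal (\<bar>w x\<bar> powr r) \<partial>lborel)"
    by (rule nn_integral_cmult) measurable
  also have "(\<integral>\<^sup>+x. ennreal (\<bar>w x\<bar> powr r) \<partial>lborel) = ennreal (\<integral>x. \<bar>w x\<bar> powr r \<partial>lborel)"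
    by (rule nn_integral_eq_integral) (use r bcs_integrable[OF bcs_abs_powr[OF w, of r]] in auto)
  finally have fin: "(\<integral>\<^sup>+x. (\<integral>\<^sup>+t. ennreal (t powr (r-1)) * indicator {0<..<\<bar>?T w x\<bar>/2} t \<partial>lborel) \<partial>lborel) \<le>
    ennreal (C / (2 - r) * N powr (2-r)) * ennreal (\<integral>x. \<bar>w x\<bar> powr r \<partial>lborel) +
    ennreal (1 / (r - 1) * N powr (2-r)) * ennreal (\<integral>x. \<bar>w x\<bar> powr r \<partial>lborel)" .
  have "ennreal (\<integral>x. \<bar>?T w x\<bar> powr r \<partial>lborel) = (\<integral>\<^sup>+x. ennreal (\<bar>?T w x\<bar> powr r) \<partial>lborel)"
    by (rule nn_integral_eq_integral[symmetric]) (use r bcs_integrable[OF bcs_abs_powr[OF bcs_conv[OF k w], of r]] in auto)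
  also have "\<dots> \<le> ennreal (2 powr r * r) * (ennreal (C / (2 - r) * N powr (2-r)) * ennreal (\<integral>x. \<bar>w x\<bar> powr r \<partial>lborel) +
    ennreal (1 / (r - 1) * N powr (2-r)) * ennreal (\<integral>x. \<bar>w x\<bar> powr r \<partial>lborel))"
    unfolding start using fin by (rule mult_left_mono) simp
  also have "\<dots> =
    ennreal (2 powr r * r * (C / (2 - r) * N powr (2-r) * (\<integral>x. \<bar>w x\<bar> powr r \<partial>lborel)
      + 1 / (r - 1) * N powr (2-r) * (\<integral>x. \<bar>w x\<bar> powr r \<partial>lborel)))"
    using r C by (simp flip: ennreal_mult ennreal_plus)
  finally have "ennreal (\<integral>x. \<bar>?T w x\<bar> powr r \<partial>lborel) \<le> \<dots>" .
  then have "(\<integral>x. \<bar>?T w x\<bar> powr r \<partial>lborel) \<le>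
    2 powr r * r * (C / (2 - r) * N powr (2-r) * (\<integral>x. \<bar>w x\<bar> powr r \<partial>lborel)
      + 1 / (r - 1) * N powr (2-r) * (\<integral>x. \<bar>w x\<bar> powr r \<partial>lborel))"
    using r C by (subst (asm) ennreal_le_iff) (auto intro!: mult_nonneg_nonneg add_nonneg_nonneg)
  then show ?thesis by (simp add: field_simps)
qed

subsection \<open>Regularised Newtonian kernels\<close>

text \<open>The profile continues \<open>s powr (-d/2)\<close> below \<open>s = 1\<close> by its first-order Taylor polynomial. Hence
  \<open>newton l\<close> agrees with the gradient of the fundamental solution outside the ball of radius \<open>l\<close>,
  and its divergence is a nonnegative bump supported in that ball.\<close>

definition prof :: "real \<Rightarrow> real \<Rightarrow> real" where
  "prof d s = (if s \<le> 1 then 1 + d / 2 * (1 - s) else s powr (- d / 2))"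

definition prof' :: "real \<Rightarrow> real \<Rightarrow> real" where
  "prof' d s = (if s \<le> 1 then - d / 2 else - d / 2 * s powr (- d / 2 - 1))"

lemma prof_has_derivative: "(prof d has_real_derivative prof' d s) (at s)"
proof -
  have "((\<lambda>x. if x \<in> {..1} then 1 + d / 2 * (1 - x) else x powr (- d / 2)) has_derivative
      (if s \<in> {..1} then (*) (- d / 2) else (*) (- d / 2 * s powr (- d / 2 - 1)))) (at s within ({..1} \<union> {1..}))"
  proof (rule has_derivative_If_within_closures[where f'="\<lambda>_. (*) (- d / 2)" and g'="\<lambda>s. (*) (- d / 2 * s powr (- d / 2 - 1))"])
    show "((\<lambda>x. 1 + d / 2 * (1 - x)) has_derivative (*) (- d / 2)) (at s within {..1} \<union> (closure {..1} \<inter> closure {1..}))"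
      by (auto intro!: derivative_eq_intros)
    assume "s \<in> {1..} \<union> (closure {..1} \<inter> closure {1..})"
    then have "s \<ge> 1" by auto
    then have "((\<lambda>x. x powr (- d / 2)) has_real_derivative (- d / 2 * s powr (- d / 2 - 1))) (at s within X)" for X
      by (intro DERIV_subset[OF DERIV_powr[where g="\<lambda>x. x" and m=1 and f="\<lambda>_. - d / 2" and r=0, THEN DERIV_cong]])
        (auto simp: powr_diff)
    then show "((\<lambda>x. x powr (- d / 2)) has_derivative (*) (- d / 2 * s powr (- d / 2 - 1)))
       (at s within {1..} \<union> (closure {..1} \<inter> closure {1..}))"
      by (simp add: has_field_derivative_def)
  qed auto
  moreover have "{..1} \<union> {1..} = (UNIV :: real set)" by auto
  moreover have "(\<lambda>x. if x \<in> {..1} then 1 + d / 2 * (1 - x) else x powr (- d / 2)) = prof d"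
    by (auto simp: prof_def)
  moreover have "(if s \<in> {..1} then (*) (- d / 2) else (*) (- d / 2 * s powr (- d / 2 - 1))) = (*) (prof' d s)"
    by (auto simp: prof'_def)
  ultimately show ?thesis by (simp add: has_field_derivative_def)
qed

lemma prof'_continuous: "continuous_on UNIV (prof' d)"
proof -
  have "continuous_on ({..1} \<union> {1..}) (\<lambda>s. if s \<le> 1 then - d / 2 else - d / 2 * s powr (- d / 2 - 1))"
    by (rule continuous_on_If) (auto intro!: continuous_intros)
  moreover have "{..1} \<union> {1..} = (UNIV :: real set)" by auto
  ultimately show ?thesis by (simp add: prof'_def[abs_def])
qed

definition newton :: "real \<Rightarrow> 'n \<Rightarrow> real^'n::finite \<Rightarrow> real" where
  "newton l i x = x $ i * (prof CARD('n) ((norm x)\<^sup>2 / l\<^sup>2) / l ^ CARD('n))"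

text \<open>The divergence of \<open>newton l\<close>. With s the quotient of the squared norm of x
  by the square of l, \<open>d * prof d s + 2 * s * prof' d s\<close> equals (d + d^2 / 2) * (1 - s)
  for s \<le> 1 and 0 beyond; this is the origin of the constant. The mass is not
  normalised.\<close>

definition bump :: "real \<Rightarrow> real^'n::finite \<Rightarrow> real" where
  "bump l x = (CARD('n) + (CARD('n))\<^sup>2 / 2) * max 0 (1 - (norm x)\<^sup>2 / l\<^sup>2) / l ^ CARD('n)"

section \<open>Derivatives, divergence and scaling of the kernels\<close>

lemma component_C1: "C1 (\<lambda>x::real^'n::finite. x $ i)"
  and pderiv_component: "pderiv j (\<lambda>x. x $ i) x = (if i = j then 1 else 0)"
proof -
  have D: "((\<lambda>x::real^'n. x $ i) has_derivative (\<lambda>h. h $ i)) (at x)" for x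
    by (rule bounded_linear_imp_has_derivative[OF bounded_linear_vec_nth])
  show P: "pderiv j (\<lambda>x. x $ i) x = (if i = j then 1 else 0)" for j x
    unfolding pderivI[OF D] by (auto simp: axis_def)
  show "C1 (\<lambda>x::real^'n::finite. x $ i)"
    by (rule C1I[where g="\<lambda>j _. if i = j then 1 else 0"]) (use D P in \<open>auto simp: differentiable_def\<close>)
qed

lemma norm_sq_C1: "C1 (\<lambda>x::real^'n::finite. (norm x)\<^sup>2 / c)"
  and pderiv_norm_sq: "pderiv j (\<lambda>x::real^'n. (norm x)\<^sup>2 / c) x = 2 * x $ j / c"
proof -
  have D: "((\<lambda>x::real^'n. (norm x)\<^sup>2 / c) has_derivative (\<lambda>h. 2 * (x \<bullet> h) / c)) (at x)" for x
  proof -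
    have "((\<lambda>x::real^'n. inverse c * (x \<bullet> x)) has_derivative (\<lambda>h. inverse c * (2 * (x \<bullet> h)))) (at x)"
      by (auto intro!: derivative_eq_intros simp: inner_commute)
    then show ?thesis by (simp add: power2_norm_eq_inner field_class.field_divide_inverse mult_ac)
  qed
  show P: "pderiv j (\<lambda>x. (norm x)\<^sup>2 / c) x = 2 * x $ j / c" for j and x :: "real^'n"
    unfolding pderivI[OF D] by (auto simp: inner_axis)
  show "C1 (\<lambda>x::real^'n::finite. (norm x)\<^sup>2 / c)"
    by (rule C1I[where g="\<lambda>j x. 2 * x $ j / c"])
      (use D P in \<open>auto simp: differentiable_def divide_inverse intro!: continuous_intros\<close>)
qed

lemma newton_C1: "C1 (newton l i :: real^'n::finite \<Rightarrow> real)"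
  and pderiv_newton: "pderiv j (newton l i) x =
    ((if i = j then prof CARD('n) ((norm x)\<^sup>2 / l\<^sup>2) else 0)
      + 2 * x $ i * x $ j / l\<^sup>2 * prof' CARD('n) ((norm x)\<^sup>2 / l\<^sup>2)) / l ^ CARD('n)"
proof -
  have F: "((\<lambda>s. prof CARD('n) s / l ^ CARD('n)) has_real_derivative prof' CARD('n) s / l ^ CARD('n)) (at s)" for s
    by (rule DERIV_cdivide[OF prof_has_derivative])
  have F': "continuous_on UNIV (\<lambda>s. prof' CARD('n) s / l ^ CARD('n))"
    using prof'_continuous by (auto simp: divide_inverse intro!: continuous_intros)
  note c = C1_compose[OF norm_sq_C1[of "l\<^sup>2"] F F']
  have eq: "newton l i = (\<lambda>x::real^'n. x $ i * (prof CARD('n) ((norm x)\<^sup>2 / l\<^sup>2) / l ^ CARD('n)))"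
    by (auto simp: newton_def)
  show "C1 (newton l i :: real^'n::finite \<Rightarrow> real)"
    unfolding eq by (rule C1_mult[OF component_C1 c(1)])
  show "pderiv j (newton l i) x =
    ((if i = j then prof CARD('n) ((norm x)\<^sup>2 / l\<^sup>2) else 0)
      + 2 * x $ i * x $ j / l\<^sup>2 * prof' CARD('n) ((norm x)\<^sup>2 / l\<^sup>2)) / l ^ CARD('n)"
    unfolding eq by (subst pderiv_mult[OF C1_differentiable[OF component_C1] C1_differentiable[OF c(1)]])
      (simp add: pderiv_component c(2) pderiv_norm_sq field_simps add_divide_distrib)
qed

text \<open>A radial multiple of the position vector is a gradient.\<close>

lemma pderiv_newton_sym: "pderiv j (newton l i) = pderiv i (newton l j)"
  by (rule ext) (simp add: pderiv_newton mult.assoc mult.left_commute mult.commute)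

lemma divergence_newton:
  fixes x :: "real^'n::finite"
  assumes l: "l > 0"
  shows "(\<Sum>i\<in>UNIV. pderiv i (newton l i) x) = bump l x"
proof -
  let ?d = "real CARD('n)" and ?s = "(norm x)\<^sup>2 / l\<^sup>2"
  have sq: "(\<Sum>i\<in>UNIV. x $ i * x $ i) = (norm x)\<^sup>2"
    by (simp add: power2_norm_eq_inner inner_vec_def)
  have "(\<Sum>i\<in>UNIV. pderiv i (newton l i) x) = (?d * prof ?d ?s + 2 * ?s * prof' ?d ?s) / l ^ CARD('n)"
    by (simp add: pderiv_newton sum.distrib sq[symmetric] sum_distrib_right sum_distrib_left
        sum_divide_distrib[symmetric] flip: sum_divide_distrib)
       (simp add: sum_divide_distrib sum_distrib_right sum_distrib_left mult_ac)
  also have "?d * prof ?d ?s + 2 * ?s * prof' ?d ?s = (?d + ?d\<^sup>2 / 2) * max 0 (1 - ?s)"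
  proof (cases "?s \<le> 1")
    case True
    then show ?thesis by (simp add: prof_def prof'_def field_simps power2_eq_square)
  next
    case False
    then have "?s * ?s powr (- ?d / 2 - 1) = ?s powr (- ?d / 2)"
      by (subst powr_mult_base) auto
    moreover have "2 * a * (- ?d / 2 * b) = - ?d * (a * b)" for a b :: real by simp
    ultimately have "2 * ?s * (- ?d / 2 * ?s powr (- ?d / 2 - 1)) = - ?d * ?s powr (- ?d / 2)"
      by (simp only:)
    then show ?thesis using False by (simp add: prof_def prof'_def)
  qed
  finally show ?thesis by (simp add: bump_def)
qed

lemma newton_outside:
  fixes x :: "real^'n::finite"
  assumes l: "l > 0" and x: "norm x \<ge> l"
  shows "newton l i x = x $ i / norm x ^ CARD('n)"
proof -
  have s: "(norm x)\<^sup>2 / l\<^sup>2 = (norm x / l)\<^sup>2" by (simp add: power_divide)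
  have ge: "norm x / l \<ge> 1" using l x by simp
  have "prof CARD('n) ((norm x)\<^sup>2 / l\<^sup>2) = (norm x / l) powr (- real CARD('n))"
  proof (cases "norm x / l = 1")
    case True
    show ?thesis unfolding s True by (simp add: prof_def)
  next
    case False
    then have "norm x / l > 1" using ge by linarith
    then have "(norm x / l)\<^sup>2 > 1" by (rule one_less_power) simp
    then have "prof CARD('n) ((norm x / l)\<^sup>2) = ((norm x / l)\<^sup>2) powr (- real CARD('n) / 2)"
      by (simp add: prof_def)
    also have "((norm x / l)\<^sup>2) powr (- real CARD('n) / 2) = ((norm x / l) powr 2) powr (- real CARD('n) / 2)"
      using ge by simp
    also have "\<dots> = (norm x / l) powr (- real CARD('n))" by (simp only: powr_powr) simp
    finally show ?thesis unfolding s .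
  qed
  also have "\<dots> = l ^ CARD('n) / norm x ^ CARD('n)"
  proof -
    have "norm x / l > 0" using ge by linarith
    moreover have "x \<noteq> 0" using l x by auto
    ultimately show ?thesis using l by (simp add: powr_minus powr_realpow power_divide inverse_eq_divide)
  qed
  finally show ?thesis using l by (simp add: newton_def)
qed

lemma newton_scale:
  fixes x :: "real^'n::finite"
  assumes "l > 0"
  shows "newton l i x = l / l ^ CARD('n) * newton 1 i ((1 / l) *\<^sub>R x)"
  using assms by (simp add: newton_def power_divide)

lemma bump_scale:
  fixes x :: "real^'n::finite"
  assumes "l > 0"
  shows "bump l x = bump 1 ((1 / l) *\<^sub>R x) / l ^ CARD('n)"
  using assms by (simp add: bump_def power_divide)

text \<open>Outside its core every \<open>newton l\<close> is the same field, so consecutive ones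
  cancel there. What remains is a compactly supported curl-free field with divergence
  \<open>bump l - bump (2 * l)\<close>: testing with it compares the averages at two adjacent
  scales.\<close>

definition dker :: "real \<Rightarrow> 'n \<Rightarrow> real^'n::finite \<Rightarrow> real" where
  "dker l i x = newton l i x - newton (2 * l) i x"

lemma dker_C1: "C1 (dker l i)"
  unfolding dker_def by (intro C1_diff newton_C1)

lemma pderiv_dker: "pderiv j (dker l i) x = pderiv j (newton l i) x - pderiv j (newton (2 * l) i) x"
  unfolding dker_def by (rule pderiv_diff) (auto intro: C1_differentiable newton_C1)

lemma pderiv_dker_sym: "pderiv j (dker l i) = pderiv i (dker l j)"
  by (rule ext) (simp add: pderiv_dker pderiv_newton_sym[of j _ i])

lemma divergence_dker: "l > 0 \<Longrightarrow> (\<Sum>i\<in>UNIV. pderiv i (dker l i) x) = bump l x - bump (2 * l) x"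
  by (simp add: pderiv_dker sum_subtractf divergence_newton)

lemma dker_outside: "l > 0 \<Longrightarrow> norm x \<ge> 2 * l \<Longrightarrow> dker l i x = 0"
  by (simp add: dker_def newton_outside)

lemma dker_csupp: "l > 0 \<Longrightarrow> csupp (dker l i)"
  by (rule csuppI[where B="2*l"]) (simp add: dker_outside)

lemma pderiv_dker_outside: "l > 0 \<Longrightarrow> norm x > 2 * l \<Longrightarrow> pderiv j (dker l i) x = 0"
proof -
  assume l: "l > 0" and x: "norm x > 2 * l"
  have "open {x::real^'a. norm x > 2 * l}" by (intro open_Collect_less continuous_intros)
  then have "(dker l i has_derivative (\<lambda>_. 0)) (at x)"
    by (rule has_derivative_transform_within_open[OF has_derivative_const[of 0]])
      (use l x in \<open>auto simp: dker_outside\<close>)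
  then show ?thesis by (simp add: pderivI)
qed

lemma dker_bcs: "l > 0 \<Longrightarrow> bcs (dker l i)"
  and pderiv_dker_bcs: "l > 0 \<Longrightarrow> bcs (pderiv j (dker l i))"
  by (auto intro!: continuous_bcs csupp_pderiv dker_csupp simp: dker_C1)

lemma dker_scale:
  fixes x :: "real^'n::finite"
  assumes "l > 0"
  shows "dker l i x = l / l ^ CARD('n) * dker 1 i ((1 / l) *\<^sub>R x)"
proof -
  have "newton (2 * l) i x = l / l ^ CARD('n) * newton 2 i ((1 / l) *\<^sub>R x)"
    using assms newton_scale[of "2 * l" i x] newton_scale[of 2 i "(1 / l) *\<^sub>R x"]
    by (simp add: power_mult_distrib mult_ac)
  then show ?thesis using newton_scale[OF assms, of i x] by (simp add: dker_def right_diff_distrib)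
qed

lemma pderiv_dker_scale:
  fixes x :: "real^'n::finite"
  assumes "l > 0"
  shows "pderiv j (dker l i) x = pderiv j (dker 1 i) ((1 / l) *\<^sub>R x) / l ^ CARD('n)"
proof -
  have "dker l i = (\<lambda>x::real^'n. (l / l ^ CARD('n)) * dker 1 i (0 + (1 / l) *\<^sub>R x))"
    using dker_scale[OF assms] by auto
  then have "pderiv j (dker l i) x = (l / l ^ CARD('n)) * ((1 / l) * pderiv j (dker 1 i) (0 + (1 / l) *\<^sub>R x))"
    using C1_affine'[OF dker_C1[of 1 i], of 0 "1 / l"] pderiv_affine[OF dker_C1[of 1 i], of j 0 "1 / l" x]
    by (simp only:) (subst pderiv_mult, auto simp: pderiv_const)
  then show ?thesis using assms by simp
qed

lemma integral_scale:
  fixes f :: "real^'n::finite \<Rightarrow> real"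
  assumes "integrable lborel f" "l > 0"
  shows "(\<integral>x. f ((1 / l) *\<^sub>R x) \<partial>lborel) = l ^ CARD('n) * (\<integral>x. f x \<partial>lborel)"
  using integral_affine[OF assms(1), of "1 / l" 0] assms(2) by (simp add: power_divide field_simps)

text \<open>A whole power of \<open>l\<close> is gained. In the estimate that leaves the derivative
  on the velocity, the contributions of small scales therefore form a geometric series.\<close>

lemma dker_L1:
  assumes "l > 0"
  shows "(\<integral>x. \<bar>dker l i x\<bar> \<partial>lborel) = l * (\<integral>x. \<bar>dker 1 i x\<bar> \<partial>lborel)"
proof -
  have "(\<integral>x. \<bar>dker l i x\<bar> \<partial>lborel) = (\<integral>x. (l / l ^ CARD('a)) * \<bar>dker 1 i ((1 / l) *\<^sub>R x)\<bar> \<partial>lborel)"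
    using assms by (simp add: dker_scale[OF assms] abs_mult)
  also have "\<dots> = (l / l ^ CARD('a)) * (\<integral>x. \<bar>dker 1 i ((1 / l) *\<^sub>R x)\<bar> \<partial>lborel)" by simp
  finally show ?thesis
    using integral_scale[OF bcs_integrable[OF bcs_abs[OF dker_bcs[of 1 i]]] assms] assms by simp
qed

text \<open>The derivative scales with the power -d of \<open>l\<close>, so every scale has the same
  \<open>L1\<close> norm and n scales cost a factor n.\<close>

lemma pderiv_dker_L1:
  assumes "l > 0"
  shows "(\<integral>x. \<bar>pderiv j (dker l i) x\<bar> \<partial>lborel) = (\<integral>x. \<bar>pderiv j (dker 1 i) x\<bar> \<partial>lborel)"
proof -
  have "(\<integral>x. \<bar>pderiv j (dker l i) x\<bar> \<partial>lborel) = (\<integral>x. (1 / l ^ CARD('a)) * \<bar>pderiv j (dker 1 i) ((1 / l) *\<^sub>R x)\<bar> \<partial>lborel)"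
    using assms by (simp add: pderiv_dker_scale[OF assms])
  also have "\<dots> = (1 / l ^ CARD('a)) * (\<integral>x. \<bar>pderiv j (dker 1 i) ((1 / l) *\<^sub>R x)\<bar> \<partial>lborel)"
    by (subst integral_mult_right_zero[symmetric]) simp
  finally show ?thesis
    using integral_scale[OF bcs_integrable[OF bcs_abs[OF pderiv_dker_bcs[of 1 j i]]] assms] assms by simp
qed

section \<open>Averages against the bumps at very small and very large scales\<close>

lemma bump_nonneg: "l > 0 \<Longrightarrow> bump l x \<ge> 0"
  by (simp add: bump_def)

lemma bump_continuous: "continuous_on UNIV (bump l)"
  unfolding bump_def divide_inverse by (intro continuous_intros)

lemma bump_outside: "l > 0 \<Longrightarrow> norm x \<ge> l \<Longrightarrow> bump l x = 0"
  by (simp add: bump_def power_mono)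

lemma bump_bcs: "l > 0 \<Longrightarrow> bcs (bump l)"
  by (intro continuous_bcs bump_continuous csuppI[where B=l] bump_outside) auto

text \<open>The type token carries the dimension. An average against \<open>bump l\<close>
  approximates this constant times the averaged function.\<close>

definition bump_mass :: "('n::finite) itself \<Rightarrow> real" where
  "bump_mass T = (\<integral>x. bump 1 (x::real^'n) \<partial>lborel)"

lemma integral_bump:
  assumes "l > 0"
  shows "(\<integral>x. bump l (x::real^'n::finite) \<partial>lborel) = bump_mass TYPE('n)"
proof -
  have "(\<integral>x. bump l (x::real^'n) \<partial>lborel) = (\<integral>x. (1 / l ^ CARD('n)) * bump 1 ((1 / l) *\<^sub>R x :: real^'n) \<partial>lborel)"
    by (subst bump_scale[OF assms]) simp
  also have "\<dots> = (1 / l ^ CARD('n)) * (\<integral>x. bump 1 ((1 / l) *\<^sub>R x :: real^'n) \<partial>lborel)"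
    by (subst integral_mult_right_zero[symmetric]) simp
  finally show ?thesis
    using integral_scale[OF bcs_integrable[OF bump_bcs[of 1]] assms, where 'n='n] assms by (simp add: bump_mass_def)
qed

lemma bump_mass_pos: "bump_mass TYPE('n::finite) > 0"
proof -
  have "(\<integral>x. indicator (cball 0 (1/2)) (x::real^'n) * (1/2) \<partial>lborel) \<le> (\<integral>x. bump 1 (x::real^'n) \<partial>lborel)"
  proof (rule integral_mono)
    show "integrable lborel (\<lambda>x::real^'n. indicator (cball 0 (1/2)) x * (1/2) :: real)"
      using emeasure_lborel_cball_finite[of "0::real^'n" "1/2"] by (auto intro!: integrable_mult_left integrable_real_indicator)
    show "integrable lborel (bump 1 :: real^'n \<Rightarrow> real)" by (rule bcs_integrable[OF bump_bcs]) simp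
    fix x :: "real^'n"
    show "indicator (cball 0 (1/2)) x * (1/2) \<le> bump 1 x"
    proof (cases "norm x \<le> 1/2")
      case True
      then have "(norm x)\<^sup>2 \<le> (1/2)\<^sup>2" by (rule power_mono) simp
      then have *: "max 0 (1 - (norm x)\<^sup>2) \<ge> 1/2" by (simp add: power2_eq_square)
      have "real CARD('n) \<ge> 1" using zero_less_card_finite[where 'a='n] by linarith
      then have "real CARD('n) + (real CARD('n))\<^sup>2 / 2 \<ge> 1" by (simp add: add_increasing2)
      from mult_mono[OF this *] have "1 * (1/2) \<le> bump 1 x" by (simp add: bump_def)
      then show ?thesis using True by simp
    qed (simp add: bump_nonneg)
  qed
  moreover have "0 < measure lborel (cball (0::real^'n) (1/2))"
    by (rule content_cball_pos) simp
  moreover have "(\<integral>x. indicator (cball 0 (1/2)) (x::real^'n) * (1/2) \<partial>lborel) = measure lborel (cball (0::real^'n) (1/2)) / 2"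
    by simp
  ultimately show ?thesis unfolding bump_mass_def by linarith
qed

lemma measure_cball:
  assumes "r \<ge> 0"
  shows "measure lborel (cball (c::real^'n::finite) r) = unit_ball_vol CARD('n) * r ^ CARD('n)"
  using emeasure_cball[OF assms, of c] assms by (simp add: measure_def)

text \<open>Uniform continuity on a slightly larger ball gives one threshold for all points with
  \<open>norm x \<le> B\<close>. It serves every smaller \<open>l\<close>, so some member of a
  dyadic sequence of scales meets it.\<close>

lemma bump_average_limit:
  fixes G :: "real^'n::finite \<Rightarrow> real"
  assumes G: "continuous_on UNIV G" and "e > 0" "B \<ge> 0"
  obtains l0 where "l0 > 0" "\<And>l x. 0 < l \<Longrightarrow> l < l0 \<Longrightarrow> norm x \<le> B \<Longrightarrow>
    \<bar>(\<integral>y. bump l (x - y) * G y \<partial>lborel) - bump_mass TYPE('n) * G x\<bar> \<le> e"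
proof -
  let ?m = "bump_mass TYPE('n)"
  have m: "?m > 0" by (rule bump_mass_pos)
  have "uniformly_continuous_on (cball 0 (B+1)) G"
    using G by (intro compact_uniformly_continuous) (auto intro: continuous_on_subset)
  moreover have "e / ?m > 0" using \<open>e > 0\<close> m by simp
  ultimately obtain \<delta> where \<delta>: "\<delta> > 0" "\<And>x y. x \<in> cball 0 (B+1) \<Longrightarrow> y \<in> cball 0 (B+1) \<Longrightarrow> dist y x < \<delta> \<Longrightarrow> dist (G y) (G x) < e / ?m"
    by (rule uniformly_continuous_onE) blast
  show ?thesis
  proof (rule that[of "min 1 \<delta>"])
    show "min 1 \<delta> > 0" using \<delta> by simp
    fix l :: real and x :: "real^'n" assume l: "0 < l" "l < min 1 \<delta>" and x: "norm x \<le> B"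
    have b: "bcs (\<lambda>y::real^'n. bump l (x - y))" by (rule bcs_minus_shift[OF bump_bcs[OF l(1)]])
    have [measurable]: "G \<in> borel_measurable borel" using G by (rule borel_measurable_continuous_onI)
    have "continuous_on UNIV (\<lambda>y. bump l (x - y) * G y)"
      by (intro continuous_intros G continuous_on_compose2[OF bump_continuous]) auto
    then have bG: "bcs (\<lambda>y. bump l (x - y) * G y)"
      by (rule continuous_bcs[OF _ csupp_mult1[OF bcs_csupp[OF b]]])
    have bGx: "integrable lborel (\<lambda>y. bump l (x - y) * G x)" using bcs_integrable[OF b] by simp
    have int: "(\<integral>y. bump l (x - y) \<partial>lborel) = ?m"
      using integral_reflect[OF bcs_integrable[OF bump_bcs[OF l(1)]], of x] integral_bump[OF l(1), where 'n='n] by simp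
    have "(\<integral>y. bump l (x - y) * G y \<partial>lborel) - ?m * G x = (\<integral>y. bump l (x - y) * G y - bump l (x - y) * G x \<partial>lborel)"
      using bcs_integrable[OF bG] bGx int by simp
    also have "\<bar>\<dots>\<bar> \<le> (\<integral>y. \<bar>bump l (x - y) * G y - bump l (x - y) * G x\<bar> \<partial>lborel)"
      by (rule integral_abs_bound)
    also have "\<dots> \<le> (\<integral>y. e / ?m * bump l (x - y) \<partial>lborel)"
    proof (rule integral_mono)
      show "integrable lborel (\<lambda>y. \<bar>bump l (x - y) * G y - bump l (x - y) * G x\<bar>)"
        using bcs_integrable[OF bG] bGx by simp
      show "integrable lborel (\<lambda>y. e / ?m * bump l (x - y))" using bcs_integrable[OF b] by simp
      fix y
      show "\<bar>bump l (x - y) * G y - bump l (x - y) * G x\<bar> \<le> e / ?m * bump l (x - y)"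
      proof (cases "norm (x - y) \<ge> l")
        case False
        then have d: "dist y x < \<delta>" using l by (simp add: dist_norm norm_minus_commute)
        have "norm y \<le> norm x + norm (x - y)" using norm_triangle_ineq4[of x "x - y"] by simp
        then have "\<bar>G y - G x\<bar> \<le> e / ?m"
          using \<delta>(2)[of x y] d x l False by (simp add: dist_real_def)
        then have "bump l (x - y) * \<bar>G y - G x\<bar> \<le> bump l (x - y) * (e / ?m)"
          by (rule mult_left_mono) (rule bump_nonneg[OF l(1)])
        moreover have "\<bar>bump l (x - y) * G y - bump l (x - y) * G x\<bar> = bump l (x - y) * \<bar>G y - G x\<bar>"
          using bump_nonneg[OF l(1), of "x - y"] by (simp add: right_diff_distrib[symmetric] abs_mult)
        ultimately show ?thesis by (simp add: mult.commute)
      qed (simp add: bump_outside l)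
    qed
    also have "\<dots> = e" using int m by simp
    finally show "\<bar>(\<integral>y. bump l (x - y) * G y \<partial>lborel) - ?m * G x\<bar> \<le> e" .
  qed
qed

text \<open>The positive part is Lipschitz in the squared norm, and a difference of squares factors.
  Both terms vanish if \<open>norm y > 2 * l\<close>; otherwise \<open>norm (x - y) + norm y\<close>
  is at most 3 l + 2 l, whence the 5.\<close>

lemma bump_lipschitz:
  fixes x y :: "real^'n::finite"
  assumes l: "l > 0" and x: "norm x \<le> l"
  shows "\<bar>bump l (x - y) - bump l (- y)\<bar> \<le>
    5 * (CARD('n) + (CARD('n))\<^sup>2 / 2) * (norm x / l) / l ^ CARD('n) * indicator (cball 0 (2*l)) y"
proof -
  let ?c = "real CARD('n) + (real CARD('n))\<^sup>2 / 2"
  show ?thesis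
  proof (cases "norm y \<le> 2 * l")
    case True
    have "\<bar>max 0 (1 - (norm (x - y))\<^sup>2 / l\<^sup>2) - max 0 (1 - (norm y)\<^sup>2 / l\<^sup>2)\<bar> \<le>
      \<bar>(norm (x - y))\<^sup>2 / l\<^sup>2 - (norm y)\<^sup>2 / l\<^sup>2\<bar>" by linarith
    also have "\<dots> = \<bar>(norm (x - y))\<^sup>2 - (norm y)\<^sup>2\<bar> / l\<^sup>2"
      using l by (simp add: diff_divide_distrib[symmetric])
    also have "(norm (x - y))\<^sup>2 - (norm y)\<^sup>2 = (norm (x - y) - norm y) * (norm (x - y) + norm y)"
      by (simp add: power2_eq_square algebra_simps)
    also have "\<bar>\<dots>\<bar> \<le> norm x * (5 * l)"
      unfolding abs_mult
    proof (rule mult_mono)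
      show "\<bar>norm (x - y) - norm y\<bar> \<le> norm x"
        using norm_triangle_ineq4[of x y] norm_triangle_ineq4[of x "x - y"] by (simp add: abs_le_iff)
      show "\<bar>norm (x - y) + norm y\<bar> \<le> 5 * l"
        using norm_triangle_ineq4[of x y] True x by simp
    qed auto
    finally have "\<bar>max 0 (1 - (norm (x - y))\<^sup>2 / l\<^sup>2) - max 0 (1 - (norm y)\<^sup>2 / l\<^sup>2)\<bar> \<le> norm x * (5 * l) / l\<^sup>2"
      using l by (simp add: divide_right_mono)
    also have "\<dots> = 5 * (norm x / l)" using l by (simp add: power2_eq_square)
    finally have "?c / l ^ CARD('n) * \<bar>max 0 (1 - (norm (x - y))\<^sup>2 / l\<^sup>2) - max 0 (1 - (norm y)\<^sup>2 / l\<^sup>2)\<bar>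
       \<le> ?c / l ^ CARD('n) * (5 * (norm x / l))"
      using l by (intro mult_left_mono) auto
    moreover have "bump l (x - y) - bump l (- y) =
       ?c / l ^ CARD('n) * (max 0 (1 - (norm (x - y))\<^sup>2 / l\<^sup>2) - max 0 (1 - (norm y)\<^sup>2 / l\<^sup>2))"
      by (simp add: bump_def diff_divide_distrib algebra_simps)
    moreover have "\<bar>?c / l ^ CARD('n) * z\<bar> = ?c / l ^ CARD('n) * \<bar>z\<bar>" for z
      using l by (simp add: abs_mult)
    ultimately have "\<bar>bump l (x - y) - bump l (- y)\<bar> \<le> ?c / l ^ CARD('n) * (5 * (norm x / l))" by simp
    then show ?thesis using True by (simp add: mult_ac)
  next
    case False
    then have "norm (x - y) \<ge> l" using x norm_triangle_ineq4[of x "x - y"] by simp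
    then show ?thesis using False l x by (simp add: bump_outside)
  qed
qed

text \<open>At a scale far above the size of a ball, the averages of a bounded function are nearly
  constant on the ball. This is where the constant subtracted from the pressure comes from.\<close>

lemma bump_average_lipschitz:
  fixes P :: "real^'n::finite \<Rightarrow> real"
  assumes P: "continuous_on UNIV P" "\<And>x. \<bar>P x\<bar> \<le> M" and l: "l > 0" and x: "norm x \<le> l"
  shows "\<bar>(\<integral>y. bump l (x - y) * P y \<partial>lborel) - (\<integral>y. bump l (- y) * P y \<partial>lborel)\<bar> \<le>
    5 * (CARD('n) + (CARD('n))\<^sup>2 / 2) * unit_ball_vol CARD('n) * 2 ^ CARD('n) * M * (norm x / l)"
proof -
  have [measurable]: "P \<in> borel_measurable borel" using P by (auto intro: borel_measurable_continuous_onI)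
  have M: "M \<ge> 0" using P(2)[of 0] by linarith
  have b: "integrable lborel (\<lambda>y. bump l (z - y) * P y)" for z :: "real^'n"
    by (rule bcs_integrable[OF bcs_mult_bounded[OF bcs_minus_shift[OF bump_bcs[OF l]]]]) (use P in auto)
  let ?K = "5 * (CARD('n) + (CARD('n))\<^sup>2 / 2) * (norm x / l) / l ^ CARD('n)"
  have "\<bar>(\<integral>y. bump l (x - y) * P y \<partial>lborel) - (\<integral>y. bump l (- y) * P y \<partial>lborel)\<bar> =
    \<bar>\<integral>y. bump l (x - y) * P y - bump l (- y) * P y \<partial>lborel\<bar>"
    using b[of x] b[of 0] by simp
  also have "\<dots> \<le> (\<integral>y. \<bar>bump l (x - y) * P y - bump l (- y) * P y\<bar> \<partial>lborel)"
    by (rule integral_abs_bound)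
  also have "\<dots> \<le> (\<integral>y. ?K * M * indicator (cball 0 (2*l)) (y::real^'n) \<partial>lborel)"
  proof (rule integral_mono)
    show "integrable lborel (\<lambda>y. \<bar>bump l (x - y) * P y - bump l (- y) * P y\<bar>)"
      using b[of x] b[of 0] by simp
    show "integrable lborel (\<lambda>y::real^'n. ?K * M * indicator (cball 0 (2*l)) y)"
      using emeasure_lborel_cball_finite[of "0::real^'n" "2*l"] by (auto intro!: integrable_mult_right integrable_real_indicator)
    fix y :: "real^'n"
    have "\<bar>bump l (x - y) * P y - bump l (- y) * P y\<bar> = \<bar>bump l (x - y) - bump l (- y)\<bar> * \<bar>P y\<bar>"
      by (simp add: left_diff_distrib[symmetric] abs_mult)
    also have "\<dots> \<le> (?K * indicator (cball 0 (2*l)) y) * M"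
      by (rule mult_mono[OF bump_lipschitz[OF l x] P(2)]) (use l in auto)
    finally show "\<bar>bump l (x - y) * P y - bump l (- y) * P y\<bar> \<le> ?K * M * indicator (cball 0 (2*l)) y"
      by (simp add: mult_ac)
  qed
  also have "\<dots> = ?K * M * measure lborel (cball (0::real^'n) (2*l))" by simp
  also have "\<dots> = 5 * (CARD('n) + (CARD('n))\<^sup>2 / 2) * unit_ball_vol CARD('n) * 2 ^ CARD('n) * M * (norm x / l)"
    using l by (simp add: measure_cball power_mult_distrib field_simps)
  finally show ?thesis .
qed

subsection \<open>Identities for stationary solutions\<close>

text \<open>The density may vanish, where the derivative rule for \<open>powr\<close> at positive
  arguments does not apply. Continued by 0 to negative arguments, the power is differentiable on the
  whole line because \<open>a > 1\<close>, so the pressure is C1 across vacuum.\<close>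

lemma pospow_has_derivative:
  fixes a :: real
  assumes a: "a > 1"
  shows "((\<lambda>t. max 0 t powr a) has_real_derivative a * max 0 t powr (a - 1)) (at t)"
proof -
  consider "t < 0" | "t = 0" | "t > 0" by linarith
  then show ?thesis
  proof cases
    case 1
    have "((\<lambda>t. 0) has_real_derivative 0) (at t)" by simp
    from has_field_derivative_transform_within_open[OF this, of "{..<0}" "\<lambda>t. max 0 t powr a"]
    show ?thesis using 1 by simp
  next
    case 2
    \<comment> \<open>At 0 the difference quotient is bounded by
      \<open>\<bar>h\<bar> powr (a - 1)\<close>, which tends to 0 because the exponent is
      positive.\<close>
    have "((\<lambda>h. \<bar>h\<bar> powr (a - 1)) \<longlongrightarrow> \<bar>0\<bar> powr (a - 1)) (at (0::real))"
      using a by (intro tendsto_intros) auto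
    then have lim: "((\<lambda>h. \<bar>h\<bar> powr (a - 1)) \<longlongrightarrow> 0) (at (0::real))" by simp
    have "((\<lambda>h. max 0 h powr a / h) \<longlongrightarrow> 0) (at 0)"
    proof (rule Lim_null_comparison[OF always_eventually lim], rule allI)
      fix h :: real
      show "norm (max 0 h powr a / h) \<le> \<bar>h\<bar> powr (a - 1)"
      proof (cases "h > 0")
        case False
        then have "max 0 h = 0" by simp
        then show ?thesis by simp
      qed (simp add: powr_diff)
    qed
    then show ?thesis using 2 a by (simp add: DERIV_def)
  next
    case 3
    have "((\<lambda>t. t powr a) has_real_derivative a * t powr (a - 1)) (at t)"
      using 3 by (rule has_real_derivative_powr)
    from has_field_derivative_transform_within_open[OF this, of "{0<..}" "\<lambda>t. max 0 t powr a"]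
    show ?thesis using 3 by simp
  qed
qed

lemma pospow_continuous:
  fixes a :: real
  assumes a: "a > 0"
  shows "continuous_on UNIV (\<lambda>t. max 0 t powr a)"
  using a by (intro continuous_on_powr' continuous_intros) auto

text \<open>The equations with a pointwise bound \<open>M\<close> on the density but without
  integrability: everything in this locale is pointwise or tested with functions of compact
  support.\<close>

locale stationary_flow =
  fixes rho :: "real^'n::finite \<Rightarrow> real"
    and v :: "real^'n \<Rightarrow> real^'n"
    and mu lambda A gamma M :: real
  assumes mu: "mu > 0" and lam: "lambda + 2 * mu > 0" and A: "A > 0" and gam: "gamma > 1"
    and rho_nonneg: "rho x \<ge> 0" and rho_le: "rho x \<le> M"
    and smooth_rho: "smooth rho"
    and smooth_v: "smooth (\<lambda>x. v x $ j)"
    and mass: "(\<Sum>i\<in>UNIV. pderiv i (\<lambda>y. rho y * v y $ i) x) = 0"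
    and momentum: "(\<Sum>i\<in>UNIV. pderiv i (\<lambda>y. rho y * v y $ i * v y $ j) x)
        = - pderiv j (\<lambda>y. A * rho y powr gamma) x
          + mu * (\<Sum>i\<in>UNIV. pderiv i (pderiv i (\<lambda>y. v y $ j)) x)
          + (mu + lambda) * pderiv j (\<lambda>y. \<Sum>i\<in>UNIV. pderiv i (\<lambda>z. v z $ i) y) x"
begin

definition "press x = A * rho x powr gamma"
definition "dv i j = pderiv i (\<lambda>y. v y $ j)"
definition "divv x = (\<Sum>i\<in>UNIV. dv i i x)"
definition "gradsq x = (\<Sum>i\<in>UNIV. \<Sum>j\<in>UNIV. (dv i j x)\<^sup>2)"
definition "flux i j x = rho x * v x $ i * v x $ j"
definition "force j x = (\<Sum>i\<in>UNIV. rho x * v x $ i * dv i j x)"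
definition "eff x = press x - (2 * mu + lambda) * divv x"

lemma v_C1: "C1 (\<lambda>x. v x $ j)" and dv_C1: "C1 (dv i j)" and rho_C1: "C1 rho"
  unfolding dv_def using smooth_v smooth_rho smooth_C1 smooth_pderiv by blast+

lemma divv_C1: "C1 divv"
  unfolding divv_def by (intro C1_sum dv_C1) auto

lemma flux_C1: "C1 (flux i j)"
  unfolding flux_def by (intro C1_mult rho_C1 v_C1)

lemma press_eq: "press x = A * max 0 (rho x) powr gamma"
  using rho_nonneg[of x] by (simp add: press_def max_def)

lemma press_C1: "C1 press"
  and pderiv_press: "pderiv i press x = A * (gamma * max 0 (rho x) powr (gamma - 1)) * pderiv i rho x"
proof -
  have F: "((\<lambda>t. A * max 0 t powr gamma) has_real_derivative A * (gamma * max 0 t powr (gamma - 1))) (at t)" for t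
    using pospow_has_derivative[OF gam] by (rule DERIV_cmult)
  have F': "continuous_on UNIV (\<lambda>t. A * (gamma * max 0 t powr (gamma - 1)))"
    using gam by (intro continuous_intros pospow_continuous) auto
  have eq: "press = (\<lambda>x. A * max 0 (rho x) powr gamma)" by (simp add: press_eq fun_eq_iff)
  show "C1 press" "pderiv i press x = A * (gamma * max 0 (rho x) powr (gamma - 1)) * pderiv i rho x"
    unfolding eq using C1_compose[OF rho_C1 F F'] by auto
qed

lemma mass': "(\<Sum>i\<in>UNIV. pderiv i rho x * v x $ i) + rho x * divv x = 0"
proof -
  have "pderiv i (\<lambda>y. rho y * v y $ i) x = pderiv i rho x * v x $ i + rho x * dv i i x" for i
    unfolding dv_def by (rule pderiv_mult) (simp_all add: rho_C1 v_C1)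
  then show ?thesis using mass[of x] by (simp add: sum.distrib divv_def sum_distrib_left)
qed

text \<open>Conservation of mass turns the divergence form of the convective term into rho v . grad
  v. The two forms serve different ranges of scales.\<close>

lemma div_flux: "(\<Sum>i\<in>UNIV. pderiv i (flux i j) x) = force j x"
proof -
  have "pderiv i (flux i j) x = pderiv i (\<lambda>y. rho y * v y $ i) x * v x $ j + rho x * v x $ i * dv i j x" for i
    unfolding flux_def[abs_def] dv_def
    by (rule pderiv_mult) (simp_all add: C1_mult rho_C1 v_C1)
  then show ?thesis using mass[of x] by (simp add: sum.distrib force_def sum_distrib_right[symmetric])
qed

lemma momentum': "force j x = - pderiv j press x + mu * (\<Sum>i\<in>UNIV. pderiv i (dv i j) x) + (mu + lambda) * pderiv j divv x"
  using momentum[of j x] div_flux[of j x]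
  unfolding flux_def[abs_def] press_def[abs_def] dv_def[abs_def] divv_def[abs_def] by simp

text \<open>Renormalised continuity equation: multiply it by the derivative of the pressure law;
  density times that derivative is gamma times the pressure. This ties the work of the pressure to
  div v.\<close>

lemma pressure_transport: "(\<Sum>i\<in>UNIV. pderiv i press x * v x $ i) = - gamma * press x * divv x"
proof -
  have "(\<Sum>i\<in>UNIV. pderiv i press x * v x $ i) =
    A * (gamma * max 0 (rho x) powr (gamma - 1)) * (\<Sum>i\<in>UNIV. pderiv i rho x * v x $ i)"
    by (simp add: pderiv_press sum_distrib_left mult_ac)
  also have "(\<Sum>i\<in>UNIV. pderiv i rho x * v x $ i) = - rho x * divv x" using mass'[of x] by simp
  also have "A * (gamma * max 0 (rho x) powr (gamma - 1)) * (- rho x * divv x) =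
    - gamma * (A * (rho x * max 0 (rho x) powr (gamma - 1))) * divv x" by simp
  also have "rho x * max 0 (rho x) powr (gamma - 1) = rho x powr gamma"
    using rho_nonneg[of x] by (cases "rho x = 0") (auto simp: max_def powr_mult_base)
  finally show ?thesis by (simp only: press_def[of x])
qed

lemmas C1s [simp] = v_C1 dv_C1 rho_C1 divv_C1 flux_C1 press_C1

lemma v_continuous [simp]: "continuous_on UNIV v"
  using continuous_on_vec_lambda[of UNIV "\<lambda>i x. v x $ i"] C1_continuous[OF v_C1] by simp

lemma force_continuous: "continuous_on UNIV (force j)"
  unfolding force_def by (intro continuous_intros C1_continuous C1s)

lemma eff_continuous: "continuous_on UNIV eff"
  unfolding eff_def by (intro continuous_intros C1_continuous C1s)

lemma gradsq_continuous: "continuous_on UNIV gradsq"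
  unfolding gradsq_def by (intro continuous_intros C1_continuous C1s)

text \<open>For a curl-free test field both viscous terms reduce to div v times div Z, with total
  coefficient mu + (mu + lambda), so it is exactly \<open>eff\<close> that meets the divergence of
  \<open>Z\<close>. The convective side is given in two forms, with the derivative on the test field
  and on the velocity, for large and small scales respectively.\<close>

lemma weak_identity:
  assumes Z: "\<And>j. C1 (Z j)" "\<And>j. csupp (Z j)" and sym: "\<And>i j. pderiv i (Z j) = pderiv j (Z i)"
  shows "(\<integral>x. eff x * (\<Sum>j\<in>UNIV. pderiv j (Z j) x) \<partial>lborel) =
      - (\<Sum>j\<in>UNIV. \<Sum>i\<in>UNIV. \<integral>x. flux i j x * pderiv i (Z j) x \<partial>lborel)" (is "?L = - ?W")
    and "(\<Sum>j\<in>UNIV. \<integral>x. force j x * Z j x \<partial>lborel) =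
      - (\<Sum>j\<in>UNIV. \<Sum>i\<in>UNIV. \<integral>x. flux i j x * pderiv i (Z j) x \<partial>lborel)"
proof -
  have int: "integrable lborel (\<lambda>x. g x * Z j x)" if "continuous_on UNIV g" for g j
    using that Z by (intro integrable_csupp continuous_intros csupp_mult2) auto
  have int': "integrable lborel (\<lambda>x. g x * pderiv i (Z j) x)" if "continuous_on UNIV g" for g i j
    using that Z by (intro integrable_csupp continuous_intros csupp_mult2 csupp_pderiv) auto
  have parts: "(\<integral>x. pderiv i g x * Z j x \<partial>lborel) = - (\<integral>x. g x * pderiv i (Z j) x \<partial>lborel)" if "C1 g" for g i j
    by (rule integral_by_parts) (use that Z in auto)
  have f: "(\<integral>x. force j x * Z j x \<partial>lborel) = - (\<Sum>i\<in>UNIV. \<integral>x. flux i j x * pderiv i (Z j) x \<partial>lborel)" for j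
  proof -
    have "(\<integral>x. force j x * Z j x \<partial>lborel) = (\<integral>x. (\<Sum>i\<in>UNIV. pderiv i (flux i j) x * Z j x) \<partial>lborel)"
      by (simp add: div_flux[symmetric] sum_distrib_right)
    also have "\<dots> = (\<Sum>i\<in>UNIV. \<integral>x. pderiv i (flux i j) x * Z j x \<partial>lborel)"
      by (rule Bochner_Integration.integral_sum) (auto intro!: int C1s)
    finally show ?thesis by (simp add: parts[OF flux_C1] sum_negf)
  qed
  show W: "(\<Sum>j\<in>UNIV. \<integral>x. force j x * Z j x \<partial>lborel) = - ?W"
    by (simp add: f sum_negf)
  have m: "(\<integral>x. force j x * Z j x \<partial>lborel) = (\<integral>x. press x * pderiv j (Z j) x \<partial>lborel)
     - mu * (\<Sum>i\<in>UNIV. \<integral>x. dv i j x * pderiv i (Z j) x \<partial>lborel)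
     - (mu + lambda) * (\<integral>x. divv x * pderiv j (Z j) x \<partial>lborel)" for j
  proof -
    have "(\<integral>x. force j x * Z j x \<partial>lborel) = (\<integral>x. - (pderiv j press x * Z j x)
       + mu * (\<Sum>i\<in>UNIV. pderiv i (dv i j) x * Z j x) + (mu + lambda) * (pderiv j divv x * Z j x) \<partial>lborel)"
      by (rule Bochner_Integration.integral_cong) (auto simp: momentum' algebra_simps sum_distrib_left sum_distrib_right)
    also have "\<dots> = - (\<integral>x. pderiv j press x * Z j x \<partial>lborel)
       + mu * (\<Sum>i\<in>UNIV. \<integral>x. pderiv i (dv i j) x * Z j x \<partial>lborel) + (mu + lambda) * (\<integral>x. pderiv j divv x * Z j x \<partial>lborel)"
      by ((subst Bochner_Integration.integral_add Bochner_Integration.integral_minus Bochner_Integration.integral_sum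
          Bochner_Integration.integral_mult_right_zero;
        (intro Bochner_Integration.integrable_add Bochner_Integration.integrable_minus integrable_mult_right
          Bochner_Integration.integrable_sum int C1_continuous_pderiv C1s)?)+, rule refl)
    finally show ?thesis by (simp add: parts[OF press_C1] parts[OF dv_C1] parts[OF divv_C1] sum_negf)
  qed
  \<comment> \<open>The symmetric Jacobian allows writing the i-th derivative of \<open>Z j\<close>
    as the j-th derivative of \<open>Z i\<close>; exchanging derivatives with the velocity component
    then leaves a product of diagonal entries.\<close>
  have s: "(\<Sum>j\<in>UNIV. \<Sum>i\<in>UNIV. \<integral>x. dv i j x * pderiv i (Z j) x \<partial>lborel) =
     (\<Sum>j\<in>UNIV. \<integral>x. divv x * pderiv j (Z j) x \<partial>lborel)"
  proof -
    have "(\<integral>x. dv i j x * pderiv i (Z j) x \<partial>lborel) = (\<integral>x. dv j j x * pderiv i (Z i) x \<partial>lborel)" for i j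
      using integral_pderiv_swap[OF v_C1[of j] Z, of i j i] unfolding dv_def sym[of i j] by simp
    then have "(\<Sum>j\<in>UNIV. \<Sum>i\<in>UNIV. \<integral>x. dv i j x * pderiv i (Z j) x \<partial>lborel) =
       (\<Sum>i\<in>UNIV. \<Sum>j\<in>UNIV. \<integral>x. dv j j x * pderiv i (Z i) x \<partial>lborel)"
      by (simp only:) (rule sum.swap)
    also have "\<dots> = (\<Sum>i\<in>UNIV. \<integral>x. divv x * pderiv i (Z i) x \<partial>lborel)"
      unfolding divv_def sum_distrib_right
      by (intro sum.cong refl Bochner_Integration.integral_sum[symmetric]) (auto intro!: int' C1s)
    finally show ?thesis .
  qed
  have "?L = (\<integral>x. (\<Sum>j\<in>UNIV. press x * pderiv j (Z j) x - (2 * mu + lambda) * (divv x * pderiv j (Z j) x)) \<partial>lborel)"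
    by (rule Bochner_Integration.integral_cong) (auto simp: eff_def algebra_simps sum_distrib_left sum_subtractf sum.distrib)
  also have "\<dots> = (\<Sum>j\<in>UNIV. (\<integral>x. press x * pderiv j (Z j) x \<partial>lborel) - (2 * mu + lambda) * (\<integral>x. divv x * pderiv j (Z j) x \<partial>lborel))"
    by (subst Bochner_Integration.integral_sum)
      (auto intro!: int' C1s sum.cong Bochner_Integration.integrable_diff integrable_mult_right simp: int' C1s)
  also have "\<dots> = (\<Sum>j\<in>UNIV. \<integral>x. force j x * Z j x \<partial>lborel)"
  proof -
    let ?p = "\<Sum>j\<in>UNIV. \<integral>x. press x * pderiv j (Z j) x \<partial>lborel" and ?q = "\<Sum>j\<in>UNIV. \<integral>x. divv x * pderiv j (Z j) x \<partial>lborel"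
    have "(\<Sum>j\<in>UNIV. \<integral>x. force j x * Z j x \<partial>lborel) = ?p - mu * ?q - (mu + lambda) * ?q"
      by (simp only: m sum_subtractf sum_distrib_left[symmetric] s)
    then show ?thesis unfolding sum_subtractf sum_distrib_left[symmetric] by (simp add: algebra_simps)
  qed
  finally show "?L = - ?W" using W by simp
qed

lemma mass_weak:
  assumes g: "C1 g" "csupp g"
  shows "(\<integral>x. (\<Sum>i\<in>UNIV. rho x * v x $ i * pderiv i g x) \<partial>lborel) = 0"
proof -
  have rv: "C1 (\<lambda>x. rho x * v x $ i)" for i by (intro C1_mult rho_C1 v_C1)
  have "(\<integral>x. (\<Sum>i\<in>UNIV. rho x * v x $ i * pderiv i g x) \<partial>lborel) =
    (\<Sum>i\<in>UNIV. \<integral>x. rho x * v x $ i * pderiv i g x \<partial>lborel)"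
    using g rv by (intro Bochner_Integration.integral_sum integrable_csupp continuous_intros csupp_mult2 csupp_pderiv) auto
  also have "\<dots> = (\<Sum>i\<in>UNIV. - (\<integral>x. pderiv i (\<lambda>y. rho y * v y $ i) x * g x \<partial>lborel))"
    using integral_by_parts[OF rv g(1)] g(2) by simp
  also have "\<dots> = - (\<integral>x. (\<Sum>i\<in>UNIV. pderiv i (\<lambda>y. rho y * v y $ i) x * g x) \<partial>lborel)"
    using g rv by (subst Bochner_Integration.integral_sum)
     (auto intro!: integrable_csupp continuous_intros csupp_mult2 simp: sum_negf)
  also have "\<dots> = 0" by (simp add: sum_distrib_right[symmetric] mass)
  finally show ?thesis .
qed

text \<open>The first identity is the momentum equation tested with
  \<open>v x $ j * \<phi> x\<close>. The second says that the trace of the squared velocity gradient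
  and the square of div v differ by a divergence. It is wanted because mu + lambda may be negative,
  so that the left side of the first is not visibly coercive.\<close>

lemma
  assumes \<phi>: "C1 \<phi>" "csupp \<phi>"
  shows energy_identity: "mu * (\<integral>x. gradsq x * \<phi> x \<partial>lborel) + (mu + lambda) * (\<integral>x. (divv x)\<^sup>2 * \<phi> x \<partial>lborel) =
    1 / 2 * (\<integral>x. rho x * (norm (v x))\<^sup>2 * (\<Sum>i\<in>UNIV. v x $ i * pderiv i \<phi> x) \<partial>lborel)
    + gamma / (gamma - 1) * (\<integral>x. press x * (\<Sum>i\<in>UNIV. v x $ i * pderiv i \<phi> x) \<partial>lborel)
    - mu * (\<integral>x. (\<Sum>i\<in>UNIV. \<Sum>j\<in>UNIV. dv i j x * v x $ j * pderiv i \<phi> x) \<partial>lborel)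
    - (mu + lambda) * (\<integral>x. divv x * (\<Sum>i\<in>UNIV. v x $ i * pderiv i \<phi> x) \<partial>lborel)"
    (is ?energy)
  and stress_identity: "(\<integral>x. (\<Sum>i\<in>UNIV. \<Sum>j\<in>UNIV. dv j i x * dv i j x) * \<phi> x \<partial>lborel) - (\<integral>x. (divv x)\<^sup>2 * \<phi> x \<partial>lborel) =
    (\<integral>x. divv x * (\<Sum>i\<in>UNIV. v x $ i * pderiv i \<phi> x) \<partial>lborel)
    - (\<integral>x. (\<Sum>i\<in>UNIV. \<Sum>j\<in>UNIV. dv j i x * v x $ j * pderiv i \<phi> x) \<partial>lborel)" (is ?stress)
proof -
  let ?vp = "\<lambda>x. \<Sum>i\<in>UNIV. v x $ i * pderiv i \<phi> x"
  have int: "integrable lborel (\<lambda>x. g x * \<phi> x)" if "continuous_on UNIV g" for g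
    using that \<phi> by (intro integrable_csupp continuous_intros csupp_mult2) auto
  have int': "integrable lborel (\<lambda>x. g x * pderiv i \<phi> x)" if "continuous_on UNIV g" for g i
    using that \<phi> by (intro integrable_csupp continuous_intros csupp_mult2 csupp_pderiv) auto
  have intv: "integrable lborel (\<lambda>x. g x * ?vp x)" if "continuous_on UNIV g" for g
  proof -
    have "integrable lborel (\<lambda>x. \<Sum>i\<in>UNIV. (g x * v x $ i) * pderiv i \<phi> x)"
      using that by (intro Bochner_Integration.integrable_sum int' continuous_intros) auto
    then show ?thesis by (simp add: sum_distrib_left mult.assoc)
  qed
  have vp: "C1 (\<lambda>x. v x $ j * \<phi> x)" "csupp (\<lambda>x. v x $ j * \<phi> x)" for j
    using \<phi> by (auto intro: C1_mult csupp_mult2)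
  have dvp: "pderiv i (\<lambda>x. v x $ j * \<phi> x) x = dv i j x * \<phi> x + v x $ j * pderiv i \<phi> x" for i j x
    unfolding dv_def using \<phi> by (intro pderiv_mult) auto
  have nsq: "(norm (v x))\<^sup>2 = (\<Sum>j\<in>UNIV. v x $ j * v x $ j)" for x
    by (simp add: power2_norm_eq_inner inner_vec_def)
  have nv: "C1 (\<lambda>x. (norm (v x))\<^sup>2)" unfolding nsq by (intro C1_sum C1_mult v_C1) auto
  have dnv: "pderiv i (\<lambda>x. (norm (v x))\<^sup>2) x = 2 * (\<Sum>j\<in>UNIV. dv i j x * v x $ j)" for i x
    unfolding nsq by (subst pderiv_sum) (auto simp: C1_mult pderiv_mult sum.distrib dv_def[symmetric] mult.commute sum_distrib_left)
  have parts: "(\<integral>x. pderiv i g x * (v x $ j * \<phi> x) \<partial>lborel) =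
      - (\<integral>x. g x * (dv i j x * \<phi> x + v x $ j * pderiv i \<phi> x) \<partial>lborel)" if "C1 g" for g i j
    using integral_by_parts[OF that vp(1)[of j]] vp(2) by (simp add: dvp)

  \<comment> \<open>Contracting rho v . grad v with \<open>v\<close> gives rho v . grad of half the
    squared speed; conservation of mass then leaves a term with the gradient of
    \<open>\<phi>\<close> only.\<close>
  have e1: "(\<integral>x. (\<Sum>j\<in>UNIV. force j x * v x $ j) * \<phi> x \<partial>lborel) = - 1/2 * (\<integral>x. rho x * (norm (v x))\<^sup>2 * ?vp x \<partial>lborel)"
  proof -
    have "C1 (\<lambda>x. (norm (v x))\<^sup>2 * \<phi> x)" "csupp (\<lambda>x. (norm (v x))\<^sup>2 * \<phi> x)"
      using nv \<phi> by (auto intro: C1_mult csupp_mult2)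
    from mass_weak[OF this]
    have "0 = (\<integral>x. (\<Sum>i\<in>UNIV. rho x * v x $ i * (2 * (\<Sum>j\<in>UNIV. dv i j x * v x $ j) * \<phi> x + (norm (v x))\<^sup>2 * pderiv i \<phi> x)) \<partial>lborel)"
      using nv \<phi> by (simp add: pderiv_mult dnv)
    also have "\<dots> = (\<integral>x. 2 * ((\<Sum>j\<in>UNIV. force j x * v x $ j) * \<phi> x) + rho x * (norm (v x))\<^sup>2 * ?vp x \<partial>lborel)"
    proof (rule Bochner_Integration.integral_cong[OF refl])
      fix x
      have "(\<Sum>j\<in>UNIV. force j x * v x $ j) = (\<Sum>i\<in>UNIV. rho x * v x $ i * (\<Sum>j\<in>UNIV. dv i j x * v x $ j))"
        unfolding force_def sum_distrib_right sum_distrib_left by (subst sum.swap) (simp add: mult_ac)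
      then show "(\<Sum>i\<in>UNIV. rho x * v x $ i * (2 * (\<Sum>j\<in>UNIV. dv i j x * v x $ j) * \<phi> x + (norm (v x))\<^sup>2 * pderiv i \<phi> x)) =
        2 * ((\<Sum>j\<in>UNIV. force j x * v x $ j) * \<phi> x) + rho x * (norm (v x))\<^sup>2 * ?vp x"
        by (simp add: sum_distrib_left sum_distrib_right sum.distrib distrib_left mult_ac)
    qed
    also have "\<dots> = 2 * (\<integral>x. (\<Sum>j\<in>UNIV. force j x * v x $ j) * \<phi> x \<partial>lborel) + (\<integral>x. rho x * (norm (v x))\<^sup>2 * ?vp x \<partial>lborel)"
      by (subst Bochner_Integration.integral_add)
        (auto intro!: int intv continuous_intros integrable_mult_right force_continuous)
    finally show ?thesis by simp
  qed
  \<comment> \<open>Integration by parts produces pressure times div v, which is -1 / gamma times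
    the integrand one started from. Solving for the integral uses gamma > 1 and yields the factor
    gamma / (gamma - 1).\<close>
  have e2: "(\<integral>x. (\<Sum>j\<in>UNIV. pderiv j press x * v x $ j) * \<phi> x \<partial>lborel) = - gamma / (gamma - 1) * (\<integral>x. press x * ?vp x \<partial>lborel)"
  proof -
    have "(\<integral>x. (\<Sum>j\<in>UNIV. pderiv j press x * v x $ j) * \<phi> x \<partial>lborel) =
      (\<Sum>j\<in>UNIV. \<integral>x. pderiv j press x * (v x $ j * \<phi> x) \<partial>lborel)"
      unfolding sum_distrib_right mult.assoc[symmetric]
      by (rule Bochner_Integration.integral_sum) (auto intro!: int continuous_intros)
    also have "\<dots> = (\<Sum>j\<in>UNIV. - (\<integral>x. press x * (dv j j x * \<phi> x + v x $ j * pderiv j \<phi> x) \<partial>lborel))"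
      by (simp add: parts)
    also have "\<dots> = - (\<integral>x. (\<Sum>j\<in>UNIV. press x * (dv j j x * \<phi> x + v x $ j * pderiv j \<phi> x)) \<partial>lborel)"
      by (subst Bochner_Integration.integral_sum)
        (auto simp: sum_negf distrib_left mult.assoc[symmetric] intro!: Bochner_Integration.integrable_add int int' continuous_intros)
    also have "(\<integral>x. (\<Sum>j\<in>UNIV. press x * (dv j j x * \<phi> x + v x $ j * pderiv j \<phi> x)) \<partial>lborel) =
      (\<integral>x. (- 1 / gamma) * ((\<Sum>j\<in>UNIV. pderiv j press x * v x $ j) * \<phi> x) + press x * ?vp x \<partial>lborel)"
    proof (rule Bochner_Integration.integral_cong[OF refl])
      fix x
      show "(\<Sum>j\<in>UNIV. press x * (dv j j x * \<phi> x + v x $ j * pderiv j \<phi> x)) =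
        (- 1 / gamma) * ((\<Sum>j\<in>UNIV. pderiv j press x * v x $ j) * \<phi> x) + press x * ?vp x"
        unfolding pressure_transport sum_distrib_left[symmetric] sum.distrib sum_distrib_right[symmetric] divv_def[symmetric]
        using gam by (simp add: field_simps)
    qed
    also have "\<dots> = (- 1 / gamma) * (\<integral>x. (\<Sum>j\<in>UNIV. pderiv j press x * v x $ j) * \<phi> x \<partial>lborel) + (\<integral>x. press x * ?vp x \<partial>lborel)"
      by (subst Bochner_Integration.integral_add) (auto intro!: int intv continuous_intros integrable_mult_right)
    finally have "(1 - 1 / gamma) * (\<integral>x. (\<Sum>j\<in>UNIV. pderiv j press x * v x $ j) * \<phi> x \<partial>lborel) = - (\<integral>x. press x * ?vp x \<partial>lborel)"
      by (simp add: algebra_simps)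
    then show ?thesis using gam by (simp add: field_simps)
  qed
  have e3: "(\<Sum>i\<in>UNIV. \<Sum>j\<in>UNIV. \<integral>x. pderiv i (dv i j) x * (v x $ j * \<phi> x) \<partial>lborel) =
     - (\<integral>x. gradsq x * \<phi> x \<partial>lborel) - (\<integral>x. (\<Sum>i\<in>UNIV. \<Sum>j\<in>UNIV. dv i j x * v x $ j * pderiv i \<phi> x) \<partial>lborel)"
  proof -
    have "(\<integral>x. pderiv i (dv i j) x * (v x $ j * \<phi> x) \<partial>lborel) =
       - (\<integral>x. (dv i j x)\<^sup>2 * \<phi> x \<partial>lborel) - (\<integral>x. dv i j x * v x $ j * pderiv i \<phi> x \<partial>lborel)" for i j
    proof -
      have "(\<integral>x. dv i j x * (dv i j x * \<phi> x + v x $ j * pderiv i \<phi> x) \<partial>lborel) =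
        (\<integral>x. (dv i j x)\<^sup>2 * \<phi> x + dv i j x * v x $ j * pderiv i \<phi> x \<partial>lborel)"
        by (simp add: algebra_simps power2_eq_square)
      also have "\<dots> = (\<integral>x. (dv i j x)\<^sup>2 * \<phi> x \<partial>lborel) + (\<integral>x. dv i j x * v x $ j * pderiv i \<phi> x \<partial>lborel)"
        by (rule Bochner_Integration.integral_add) (auto intro!: int int' continuous_intros)
      finally show ?thesis by (simp add: parts)
    qed
    then have "(\<Sum>i\<in>UNIV. \<Sum>j\<in>UNIV. \<integral>x. pderiv i (dv i j) x * (v x $ j * \<phi> x) \<partial>lborel) =
      - (\<Sum>i\<in>UNIV. \<Sum>j\<in>UNIV. \<integral>x. (dv i j x)\<^sup>2 * \<phi> x \<partial>lborel) - (\<Sum>i\<in>UNIV. \<Sum>j\<in>UNIV. \<integral>x. dv i j x * v x $ j * pderiv i \<phi> x \<partial>lborel)"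
      by (simp add: sum_negf sum_subtractf)
    also have "(\<Sum>i\<in>UNIV. \<Sum>j\<in>UNIV. \<integral>x. (dv i j x)\<^sup>2 * \<phi> x \<partial>lborel) = (\<integral>x. gradsq x * \<phi> x \<partial>lborel)"
      unfolding gradsq_def sum_distrib_right
      by (subst Bochner_Integration.integral_sum, (auto intro!: Bochner_Integration.integrable_sum int continuous_intros)[1],
          subst Bochner_Integration.integral_sum) (auto intro!: int continuous_intros)
    also have "(\<Sum>i\<in>UNIV. \<Sum>j\<in>UNIV. \<integral>x. dv i j x * v x $ j * pderiv i \<phi> x \<partial>lborel) =
       (\<integral>x. (\<Sum>i\<in>UNIV. \<Sum>j\<in>UNIV. dv i j x * v x $ j * pderiv i \<phi> x) \<partial>lborel)"
      by (subst Bochner_Integration.integral_sum, (auto intro!: Bochner_Integration.integrable_sum int' continuous_intros)[1],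
          subst Bochner_Integration.integral_sum) (auto intro!: int' continuous_intros)
    finally show ?thesis .
  qed
  have e4: "(\<Sum>j\<in>UNIV. \<integral>x. pderiv j divv x * (v x $ j * \<phi> x) \<partial>lborel) =
     - (\<integral>x. (divv x)\<^sup>2 * \<phi> x \<partial>lborel) - (\<integral>x. divv x * ?vp x \<partial>lborel)"
  proof -
    have "(\<Sum>j\<in>UNIV. \<integral>x. pderiv j divv x * (v x $ j * \<phi> x) \<partial>lborel) =
      - (\<Sum>j\<in>UNIV. \<integral>x. divv x * (dv j j x * \<phi> x + v x $ j * pderiv j \<phi> x) \<partial>lborel)"
      by (simp add: parts sum_negf)
    also have "\<dots> = - (\<integral>x. (\<Sum>j\<in>UNIV. divv x * (dv j j x * \<phi> x + v x $ j * pderiv j \<phi> x)) \<partial>lborel)"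
      by (subst Bochner_Integration.integral_sum)
        (auto simp: distrib_left mult.assoc[symmetric] intro!: Bochner_Integration.integrable_add int int' continuous_intros)
    also have "\<dots> = - (\<integral>x. (divv x)\<^sup>2 * \<phi> x + divv x * ?vp x \<partial>lborel)"
    proof -
      have "(\<Sum>j\<in>UNIV. divv x * (dv j j x * \<phi> x + v x $ j * pderiv j \<phi> x)) = (divv x)\<^sup>2 * \<phi> x + divv x * ?vp x" for x
        unfolding power2_eq_square sum_distrib_left[symmetric] sum.distrib sum_distrib_right[symmetric] divv_def[symmetric]
        by (simp add: algebra_simps)
      then show ?thesis by simp
    qed
    also have "(\<integral>x. (divv x)\<^sup>2 * \<phi> x + divv x * ?vp x \<partial>lborel) = (\<integral>x. (divv x)\<^sup>2 * \<phi> x \<partial>lborel) + (\<integral>x. divv x * ?vp x \<partial>lborel)"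
      by (rule Bochner_Integration.integral_add) (auto intro!: int intv continuous_intros)
    finally show ?thesis by simp
  qed
  have mom: "(\<integral>x. (\<Sum>j\<in>UNIV. force j x * v x $ j) * \<phi> x \<partial>lborel) =
    - (\<integral>x. (\<Sum>j\<in>UNIV. pderiv j press x * v x $ j) * \<phi> x \<partial>lborel)
    + mu * (\<Sum>i\<in>UNIV. \<Sum>j\<in>UNIV. \<integral>x. pderiv i (dv i j) x * (v x $ j * \<phi> x) \<partial>lborel)
    + (mu + lambda) * (\<Sum>j\<in>UNIV. \<integral>x. pderiv j divv x * (v x $ j * \<phi> x) \<partial>lborel)"
  proof -
    have i3: "integrable lborel (\<lambda>x. pderiv i (dv i j) x * (v x $ j * \<phi> x))" for i j
      unfolding mult.assoc[symmetric] by (auto intro!: int continuous_intros)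
    have i4: "integrable lborel (\<lambda>x. pderiv j divv x * (v x $ j * \<phi> x))" for j
      unfolding mult.assoc[symmetric] by (auto intro!: int continuous_intros)
    have i2: "integrable lborel (\<lambda>x. (\<Sum>j\<in>UNIV. pderiv j press x * v x $ j) * \<phi> x)"
      by (auto intro!: int continuous_intros)
    have pt: "(\<Sum>j\<in>UNIV. force j x * v x $ j) * \<phi> x = - ((\<Sum>j\<in>UNIV. pderiv j press x * v x $ j) * \<phi> x)
       + mu * (\<Sum>i\<in>UNIV. \<Sum>j\<in>UNIV. pderiv i (dv i j) x * (v x $ j * \<phi> x))
       + (mu + lambda) * (\<Sum>j\<in>UNIV. pderiv j divv x * (v x $ j * \<phi> x))" for x
    proof -
      have "(\<Sum>j\<in>UNIV. force j x * v x $ j) * \<phi> x =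
        (\<Sum>j\<in>UNIV. - (pderiv j press x * v x $ j * \<phi> x) + mu * (\<Sum>i\<in>UNIV. pderiv i (dv i j) x * (v x $ j * \<phi> x))
         + (mu + lambda) * (pderiv j divv x * (v x $ j * \<phi> x)))"
        unfolding sum_distrib_right
      proof (rule sum.cong[OF refl])
        fix j
        have "(\<Sum>i\<in>UNIV. pderiv i (dv i j) x * (v x $ j * \<phi> x)) = (\<Sum>i\<in>UNIV. pderiv i (dv i j) x) * (v x $ j * \<phi> x)"
          by (simp add: sum_distrib_right)
        then show "force j x * v x $ j * \<phi> x = - (pderiv j press x * v x $ j * \<phi> x)
          + mu * (\<Sum>i\<in>UNIV. pderiv i (dv i j) x * (v x $ j * \<phi> x)) + (mu + lambda) * (pderiv j divv x * (v x $ j * \<phi> x))"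
          by (simp add: momentum' algebra_simps)
      qed
      also have "\<dots> = - ((\<Sum>j\<in>UNIV. pderiv j press x * v x $ j) * \<phi> x)
       + mu * (\<Sum>j\<in>UNIV. \<Sum>i\<in>UNIV. pderiv i (dv i j) x * (v x $ j * \<phi> x))
       + (mu + lambda) * (\<Sum>j\<in>UNIV. pderiv j divv x * (v x $ j * \<phi> x))"
        by (simp add: sum.distrib sum_negf sum_subtractf sum_distrib_left sum_distrib_right)
      also have "(\<Sum>j\<in>UNIV. \<Sum>i\<in>UNIV. pderiv i (dv i j) x * (v x $ j * \<phi> x)) = (\<Sum>i\<in>UNIV. \<Sum>j\<in>UNIV. pderiv i (dv i j) x * (v x $ j * \<phi> x))"
        by (rule sum.swap)
      finally show ?thesis .
    qed
    show ?thesis unfolding pt using i2 i3 i4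
      by (simp add: Bochner_Integration.integral_add Bochner_Integration.integral_sum)
  qed
  show ?energy using mom unfolding e1 e2 e3 e4 by (simp add: algebra_simps)

  \<comment> \<open>The identity for exchanging derivatives, applied to a velocity component and the
    test field; expanding the products and summing gives the second identity.\<close>
  have sw: "(\<integral>x. dv j i x * (dv i j x * \<phi> x + v x $ j * pderiv i \<phi> x) \<partial>lborel) =
    (\<integral>x. dv i i x * (dv j j x * \<phi> x + v x $ j * pderiv j \<phi> x) \<partial>lborel)" for i j
    using integral_pderiv_swap[OF v_C1[of i] vp, of j i j] unfolding dvp dv_def .
  have il: "integrable lborel (\<lambda>x. dv j i x * (dv k l x * \<phi> x + v x $ m * pderiv n \<phi> x))" for i j k l m n
    unfolding distrib_left mult.assoc[symmetric]
    by (intro Bochner_Integration.integrable_add int int' continuous_intros) auto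
  have "(\<integral>x. (\<Sum>i\<in>UNIV. \<Sum>j\<in>UNIV. dv j i x * (dv i j x * \<phi> x + v x $ j * pderiv i \<phi> x)) \<partial>lborel) =
     (\<integral>x. (\<Sum>i\<in>UNIV. \<Sum>j\<in>UNIV. dv i i x * (dv j j x * \<phi> x + v x $ j * pderiv j \<phi> x)) \<partial>lborel)"
    using il by (simp add: sw)
  moreover have "(\<Sum>i\<in>UNIV. \<Sum>j\<in>UNIV. dv j i x * (dv i j x * \<phi> x + v x $ j * pderiv i \<phi> x)) =
     (\<Sum>i\<in>UNIV. \<Sum>j\<in>UNIV. dv j i x * dv i j x) * \<phi> x + (\<Sum>i\<in>UNIV. \<Sum>j\<in>UNIV. dv j i x * v x $ j * pderiv i \<phi> x)" for x
    by (simp add: sum_distrib_right sum_distrib_left sum.distrib distrib_left mult_ac)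
  moreover have "(\<Sum>i\<in>UNIV. \<Sum>j\<in>UNIV. dv i i x * (dv j j x * \<phi> x + v x $ j * pderiv j \<phi> x)) = (divv x)\<^sup>2 * \<phi> x + divv x * ?vp x" for x
    unfolding power2_eq_square sum_distrib_left[symmetric] sum.distrib sum_distrib_right[symmetric] divv_def[symmetric]
    by (simp add: algebra_simps)
  moreover have "integrable lborel (\<lambda>x. (\<Sum>i\<in>UNIV. \<Sum>j\<in>UNIV. dv j i x * dv i j x) * \<phi> x)"
    "integrable lborel (\<lambda>x. \<Sum>i\<in>UNIV. \<Sum>j\<in>UNIV. dv j i x * v x $ j * pderiv i \<phi> x)"
    "integrable lborel (\<lambda>x. (divv x)\<^sup>2 * \<phi> x)" "integrable lborel (\<lambda>x. divv x * ?vp x)"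
    by (intro Bochner_Integration.integrable_sum int int' intv continuous_intros; simp)+
  ultimately show ?stress by simp
qed

end

subsection \<open>The energy estimate\<close>

definition ann :: "real \<Rightarrow> ('a::real_normed_vector) set" where
  "ann R = {x. R \<le> norm x \<and> norm x \<le> 2 * R}"

lemma compact_ann: "compact (ann R :: 'a::euclidean_space set)"
proof -
  have "ann R = cball 0 (2 * R) - ball (0::'a) R" by (auto simp: ann_def)
  then show ?thesis by (simp add: compact_diff)
qed

lemma ann_borel [measurable]: "(ann R :: 'a::euclidean_space set) \<in> sets borel"
  by (simp add: compact_ann borel_compact)

lemma integrable_indicator_compact:
  fixes f :: "'a::euclidean_space \<Rightarrow> real"
  assumes "compact S" "continuous_on UNIV f"
  shows "integrable lborel (\<lambda>x. indicator S x * f x)"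
  using borel_integrable_compact[of S f] assms continuous_on_subset by fastforce

text \<open>With u = (norm x ^ 2 / R ^ 2 - 1) / 3, which runs from 0 to 1 across
  \<open>ann R\<close>, this is (1 - u^2)^2. It is flat to first order at both ends, and since it is
  a square, its gradient is bounded by its own square root.\<close>

definition cutoff :: "real \<Rightarrow> 'a::real_normed_vector \<Rightarrow> real" where
  "cutoff R x = max 0 (1 - max 0 (((norm x)\<^sup>2 / R\<^sup>2 - 1) / 3) powr 2) powr 2"

lemma cutoff_C1: "C1 (cutoff R :: real^'n::finite \<Rightarrow> real)"
  and pderiv_cutoff: "pderiv i (cutoff R) (x :: real^'n) =
    - 8 / 3 * max 0 (1 - max 0 (((norm x)\<^sup>2 / R\<^sup>2 - 1) / 3) powr 2) * max 0 (((norm x)\<^sup>2 / R\<^sup>2 - 1) / 3) * x $ i / R\<^sup>2"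
proof -
  note D = pospow_has_derivative[of 2, simplified]
  have F: "((\<lambda>s. max 0 (1 - max 0 ((s - 1) / 3) powr 2) powr 2) has_real_derivative
      (2 * max 0 (1 - max 0 ((s - 1) / 3) powr 2)) * (- (2 * max 0 ((s - 1) / 3) * (1 / 3)))) (at s)" for s :: real
  proof -
    have "((\<lambda>s. (s - 1) / 3) has_real_derivative 1 / 3) (at s)" by (auto intro!: derivative_eq_intros)
    from DERIV_chain2[OF D this]
    have "((\<lambda>s. 1 - max 0 ((s - 1) / 3) powr 2) has_real_derivative 0 - 2 * max 0 ((s - 1) / 3) * (1 / 3)) (at s)"
      by (intro DERIV_diff DERIV_const) simp
    from DERIV_chain2[OF D this] show ?thesis by simp
  qed
  have F': "continuous_on UNIV (\<lambda>s::real. (2 * max 0 (1 - max 0 ((s - 1) / 3) powr 2)) * (- (2 * max 0 ((s - 1) / 3) * (1 / 3))))"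
    by (intro continuous_intros continuous_on_powr') auto
  note c = C1_compose[OF norm_sq_C1[of "R\<^sup>2"] F F']
  have eq: "cutoff R = (\<lambda>x::real^'n. max 0 (1 - max 0 (((norm x)\<^sup>2 / R\<^sup>2 - 1) / 3) powr 2) powr 2)"
    by (auto simp: cutoff_def)
  show "C1 (cutoff R :: real^'n \<Rightarrow> real)" unfolding eq by (rule c(1))
  show "pderiv i (cutoff R) (x :: real^'n) =
    - 8 / 3 * max 0 (1 - max 0 (((norm x)\<^sup>2 / R\<^sup>2 - 1) / 3) powr 2) * max 0 (((norm x)\<^sup>2 / R\<^sup>2 - 1) / 3) * x $ i / R\<^sup>2"
    unfolding eq c(2) pderiv_norm_sq by simp
qed

lemma cutoff_nonneg: "cutoff R x \<ge> 0"
  by (simp add: cutoff_def)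

lemma cutoff_inside:
  assumes "R > 0" "norm x \<le> R"
  shows "cutoff R x = 1"
proof -
  have "(norm x)\<^sup>2 \<le> R\<^sup>2" using assms by (intro power_mono) auto
  then have "max 0 (((norm x)\<^sup>2 / R\<^sup>2 - 1) / 3) = 0" using assms by simp
  then show ?thesis by (simp add: cutoff_def)
qed

lemma cutoff_arg_ge_1:
  fixes R n :: real
  assumes "R > 0" "n > 2 * R"
  shows "(n\<^sup>2 / R\<^sup>2 - 1) / 3 \<ge> 1"
proof -
  have "(2 * R)\<^sup>2 \<le> n\<^sup>2" using assms by (intro power_mono) auto
  then have "n\<^sup>2 / R\<^sup>2 \<ge> 4" using assms by (simp add: field_simps power_mult_distrib)
  then show ?thesis by simp
qed

lemma cutoff_factor_outside:
  fixes R n :: real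
  assumes "R > 0" "n > 2 * R"
  shows "max 0 (1 - max 0 ((n\<^sup>2 / R\<^sup>2 - 1) / 3) powr 2) = 0"
proof -
  let ?u = "(n\<^sup>2 / R\<^sup>2 - 1) / 3"
  have u: "?u \<ge> 1" by (rule cutoff_arg_ge_1[OF assms])
  then have "max 0 ?u powr 2 = ?u\<^sup>2" by simp
  moreover have "?u\<^sup>2 \<ge> 1" using u by (rule one_le_power)
  ultimately show ?thesis by simp
qed

lemma cutoff_outside:
  assumes "R > 0" "norm x > 2 * R"
  shows "cutoff R x = 0"
  unfolding cutoff_def cutoff_factor_outside[OF assms] by simp

lemma cutoff_csupp: "R > 0 \<Longrightarrow> csupp (cutoff R)"
  by (rule csuppI[OF cutoff_outside])

text \<open>On the annulus the explicit derivative gives the constant 8/3 * 2 = 16/3, rounded up to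
  6. The version with \<open>sqrt\<close> is the one that lets terms containing a velocity gradient
  be absorbed into the localised energy.\<close>

lemma pderiv_cutoff_bound:
  fixes x :: "real^'n::finite"
  assumes R: "R > 0"
  shows "\<bar>pderiv i (cutoff R) x\<bar> \<le> 6 / R * sqrt (cutoff R x) * indicator (ann R) x"
    and "\<bar>pderiv i (cutoff R) x\<bar> \<le> 6 / R * indicator (ann R) x"
proof -
  let ?u = "((norm x)\<^sup>2 / R\<^sup>2 - 1) / 3"
  let ?a = "max 0 (1 - max 0 ?u powr 2)"
  have a1: "0 \<le> ?a" "?a \<le> 1" by auto
  have sq: "sqrt (cutoff R x) = ?a"
    by (simp add: cutoff_def)
  have "\<bar>pderiv i (cutoff R) x\<bar> \<le> 6 / R * ?a * indicator (ann R) x"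
  proof (cases "x \<in> ann R")
    case True
    then have n: "R \<le> norm x" "norm x \<le> 2 * R" by (auto simp: ann_def)
    have "(norm x)\<^sup>2 \<le> (2 * R)\<^sup>2" using n by (intro power_mono) auto
    then have u: "max 0 ?u \<le> 1" using R by (simp add: field_simps power_mult_distrib)
    have xi: "\<bar>x $ i\<bar> \<le> 2 * R" using component_le_norm_cart[of x i] n by linarith
    have "\<bar>pderiv i (cutoff R) x\<bar> = (8 / 3 / R\<^sup>2) * (?a * (max 0 ?u * \<bar>x $ i\<bar>))"
      unfolding pderiv_cutoff using a1(1) by (simp add: abs_mult)
    also have "\<dots> \<le> (8 / 3 / R\<^sup>2) * (?a * (1 * (2 * R)))"
      using u xi a1 R by (intro mult_left_mono mult_mono) auto
    also have "\<dots> = 16 / 3 / R * ?a" using R by (simp add: power2_eq_square)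
    also have "\<dots> \<le> 6 / R * ?a" using R a1 by (intro mult_right_mono divide_right_mono) auto
    finally show ?thesis using True by simp
  next
    case False
    then consider "norm x < R" | "norm x > 2 * R" by (auto simp: ann_def)
    then show ?thesis
    proof cases
      case 1
      then have "(norm x)\<^sup>2 \<le> R\<^sup>2" by (intro power_mono) auto
      then have "max 0 ?u = 0" using R by simp
      then show ?thesis unfolding pderiv_cutoff using False by simp
    next
      case 2
      then show ?thesis unfolding pderiv_cutoff cutoff_factor_outside[OF R 2] by simp
    qed
  qed
  then show "\<bar>pderiv i (cutoff R) x\<bar> \<le> 6 / R * sqrt (cutoff R x) * indicator (ann R) x"
    unfolding sq .
  also have "\<dots> \<le> 6 / R * 1 * indicator (ann R) x"
    unfolding sq using a1 R by (intro mult_right_mono mult_left_mono) auto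
  finally show "\<bar>pderiv i (cutoff R) x\<bar> \<le> 6 / R * indicator (ann R) x" by simp
qed

lemma amgm_weighted:
  fixes a b e :: real
  assumes "e > 0"
  shows "a * b \<le> e * a\<^sup>2 + b\<^sup>2 / (4 * e)"
proof -
  have "0 \<le> (2 * e * a - b)\<^sup>2" by simp
  then have "4 * e * (a * b) \<le> 4 * e * (e * a\<^sup>2) + b\<^sup>2" by (simp add: power2_eq_square algebra_simps)
  then show ?thesis using assms by (simp add: field_simps)
qed

context stationary_flow
begin

text \<open>Since \<open>rho v\<close> is divergence free, \<open>c * rho\<close> may be subtracted
  from the pressure at no cost; this makes it as good as subtracting \<open>P0\<close>. Let
  \<open>r0\<close> be the density with pressure \<open>P0\<close> and \<open>c\<close> the value of
  pressure over density there. As this ratio increases with the density, \<open>c * rho x\<close>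
  always lies between \<open>P0\<close> and \<open>press x\<close>.\<close>

lemma pressure_linearization:
  assumes P0: "P0 \<ge> 0"
  obtains c where "\<And>x. \<bar>press x - c * rho x\<bar> \<le> \<bar>press x - P0\<bar>"
proof -
  define r0 where "r0 = (P0 / A) powr (1 / gamma)"
  define c where "c = A * r0 powr (gamma - 1)"
  have r0: "r0 \<ge> 0" by (simp add: r0_def)
  have g: "gamma > 0" "gamma - 1 > 0" using gam by auto
  have split: "t powr gamma = t * t powr (gamma - 1)" if "t \<ge> 0" for t :: real
    using that by (cases "t = 0") (auto simp: powr_mult_base)
  have P0': "P0 = c * r0"
  proof -
    have "A * r0 powr gamma = P0" using P0 A g by (simp add: r0_def powr_powr)
    then show ?thesis using split[OF r0] by (simp add: c_def mult_ac)
  qed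
  have c0: "c \<ge> 0" using A by (simp add: c_def)
  have p: "press x = A * rho x powr (gamma - 1) * rho x" for x
    using split[OF rho_nonneg[of x]] by (simp add: press_def mult_ac)
  show ?thesis
  proof (rule that[of c])
    fix x
    show "\<bar>press x - c * rho x\<bar> \<le> \<bar>press x - P0\<bar>"
    proof (cases "r0 \<le> rho x")
      case True
      have "r0 powr (gamma - 1) \<le> rho x powr (gamma - 1)" using True r0 g by (intro powr_mono2) auto
      then have "c \<le> A * rho x powr (gamma - 1)" using A by (simp add: c_def)
      then have "c * rho x \<le> press x" unfolding p using rho_nonneg by (rule mult_right_mono)
      moreover have "c * r0 \<le> c * rho x" using True c0 by (rule mult_left_mono)
      ultimately show ?thesis using P0' by linarith
    next
      case False
      have "rho x powr (gamma - 1) \<le> r0 powr (gamma - 1)" using False rho_nonneg g by (intro powr_mono2) auto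
      then have "A * rho x powr (gamma - 1) \<le> c" using A by (simp add: c_def)
      then have "press x \<le> c * rho x" unfolding p using rho_nonneg by (rule mult_right_mono)
      moreover have "c * rho x \<le> c * r0" using False c0 by (intro mult_left_mono) auto
      ultimately show ?thesis using P0' by linarith
    qed
  qed
qed

text \<open>The localised energy is coercive with constant \<open>\<theta>\<close> for either sign
  of mu + lambda. If it is nonnegative, the divergence term is dropped and mu remains; if negative,
  the stress identity bounds the divergence part by the whole energy up to boundary terms, and 2 mu
  + lambda remains. \<open>P0\<close> may be chosen anew for every \<open>R\<close>.\<close>

lemma energy_estimate:
  obtains C where "C > 0"
    "\<And>R P0. R > 0 \<Longrightarrow> P0 \<ge> 0 \<Longrightarrow> (\<integral>x. indicator (cball 0 R) x * gradsq x \<partial>lborel) \<le>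
      C * ((\<integral>x. indicator (ann R) x * norm (v x) ^ 3 \<partial>lborel) / R
         + (\<integral>x. indicator (ann R) x * (\<bar>press x - P0\<bar> * norm (v x)) \<partial>lborel) / R
         + (\<integral>x. indicator (ann R) x * (\<bar>divv x\<bar> * norm (v x)) \<partial>lborel) / R
         + (\<integral>x. indicator (ann R) x * (norm (v x))\<^sup>2 \<partial>lborel) / R\<^sup>2)"
proof -
  define d where "d = real CARD('n)"
  define \<theta> where "\<theta> = min mu (2 * mu + lambda)"
  define \<nu> where "\<nu> = mu + lambda"
  \<comment> \<open>Weight for the arithmetic-geometric mean, chosen such that
    \<open>(mu + \<bar>\<nu>\<bar>) * e = \<theta> / 2\<close>: the gradient terms on the right
    consume half of the coercivity.\<close>
  define e where "e = \<theta> / (2 * (mu + \<bar>\<nu>\<bar>))"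
  define C where "C = 2 / \<theta> * (3 * d * M + 6 * d * (gamma / (gamma - 1)) + 12 * d * \<bar>\<nu>\<bar> + (mu + \<bar>\<nu>\<bar>) * (9 * d\<^sup>2 / e))"
  have pos: "\<theta> > 0" "d > 0" "M \<ge> 0" "e > 0"
    using mu lam rho_nonneg[of 0] rho_le[of 0] by (auto simp: \<theta>_def d_def e_def)
  have gp: "gamma / (gamma - 1) > 0" using gam by simp
  have "(mu + \<bar>\<nu>\<bar>) * (9 * d\<^sup>2 / e) > 0" using pos mu by (intro mult_pos_pos divide_pos_pos) auto
  moreover have "6 * d * (gamma / (gamma - 1)) \<ge> 0"
    using mult_nonneg_nonneg[of "6 * d" "gamma / (gamma - 1)"] pos gp by linarith
  moreover have "3 * d * M \<ge> 0" "12 * d * \<bar>\<nu>\<bar> \<ge> 0" using pos by auto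
  ultimately have "3 * d * M + 6 * d * (gamma / (gamma - 1)) + 12 * d * \<bar>\<nu>\<bar> + (mu + \<bar>\<nu>\<bar>) * (9 * d\<^sup>2 / e) > 0"
    by linarith
  then have C: "C > 0" unfolding C_def using pos by (intro mult_pos_pos) simp_all
  show ?thesis
  proof (rule that[OF C])
    fix R P0 :: real assume R: "R > 0" and P0: "P0 \<ge> 0"
    let ?\<phi> = "cutoff R :: real^'n \<Rightarrow> real"
    let ?\<chi> = "indicator (ann R) :: real^'n \<Rightarrow> real"
    let ?vp = "\<lambda>x. \<Sum>i\<in>UNIV. v x $ i * pderiv i ?\<phi> x"
    note \<phi> = cutoff_C1[of R, where 'n='n] cutoff_csupp[OF R, where 'a="real^'n"]
    define I3 where "I3 = (\<integral>x. ?\<chi> x * norm (v x) ^ 3 \<partial>lborel)"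
    define IP where "IP = (\<integral>x. ?\<chi> x * (\<bar>press x - P0\<bar> * norm (v x)) \<partial>lborel)"
    define ID where "ID = (\<integral>x. ?\<chi> x * (\<bar>divv x\<bar> * norm (v x)) \<partial>lborel)"
    define I2 where "I2 = (\<integral>x. ?\<chi> x * (norm (v x))\<^sup>2 \<partial>lborel)"
    define E where "E = (\<integral>x. gradsq x * ?\<phi> x \<partial>lborel)"
    have nn: "I3 \<ge> 0" "IP \<ge> 0" "ID \<ge> 0" "I2 \<ge> 0"
      unfolding I3_def IP_def ID_def I2_def by (intro integral_nonneg_AE; simp)+
    have int: "integrable lborel (\<lambda>x. g x * ?\<phi> x)" if "continuous_on UNIV g" for g
      using that \<phi> by (intro integrable_csupp continuous_intros csupp_mult2) auto
    have vp_le: "\<bar>?vp x\<bar> \<le> 6 * d / R * (?\<chi> x * norm (v x))" for x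
    proof -
      have "\<bar>?vp x\<bar> \<le> (\<Sum>i\<in>UNIV. \<bar>v x $ i\<bar> * \<bar>pderiv i ?\<phi> x\<bar>)"
        by (rule order_trans[OF sum_abs]) (simp add: abs_mult)
      also have "\<dots> \<le> (\<Sum>i\<in>(UNIV::'n set). norm (v x) * (6 / R * ?\<chi> x))"
        by (intro sum_mono mult_mono component_le_norm_cart pderiv_cutoff_bound(2)[OF R]) auto
      finally show ?thesis by (simp add: d_def mult_ac)
    qed
    have vp_cont: "continuous_on UNIV ?vp"
      using \<phi> by (intro continuous_intros) auto
    have flux_le: "\<bar>\<integral>x. g x * ?vp x \<partial>lborel\<bar> \<le> K * (6 * d / R) * (\<integral>x. ?\<chi> x * (h x * norm (v x)) \<partial>lborel)"
      if g: "continuous_on UNIV g" and h: "continuous_on UNIV h" and K: "K \<ge> 0" "\<And>x. \<bar>g x\<bar> \<le> K * h x" for g h K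
    proof -
      have "\<bar>\<integral>x. g x * ?vp x \<partial>lborel\<bar> \<le> (\<integral>x. \<bar>g x * ?vp x\<bar> \<partial>lborel)" by (rule integral_abs_bound)
      also have "\<dots> \<le> (\<integral>x. K * (6 * d / R) * (?\<chi> x * (h x * norm (v x))) \<partial>lborel)"
      proof (rule integral_mono)
        show "integrable lborel (\<lambda>x. K * (6 * d / R) * (?\<chi> x * (h x * norm (v x))))"
          using h by (intro integrable_mult_right integrable_indicator_compact compact_ann continuous_intros) auto
        show "integrable lborel (\<lambda>x. \<bar>g x * ?vp x\<bar>)"
        proof (rule Bochner_Integration.integrable_bound)
          show "integrable lborel (\<lambda>x. K * (6 * d / R) * (?\<chi> x * (h x * norm (v x))))"
            using h by (intro integrable_mult_right integrable_indicator_compact compact_ann continuous_intros) auto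
          show "(\<lambda>x. \<bar>g x * ?vp x\<bar>) \<in> borel_measurable lborel"
            using borel_measurable_continuous_onI[OF continuous_on_mult[OF g vp_cont]] by simp
          show "AE x in lborel. norm \<bar>g x * ?vp x\<bar> \<le> norm (K * (6 * d / R) * (?\<chi> x * (h x * norm (v x))))"
          proof (rule AE_I2)
            fix x
            have "\<bar>g x * ?vp x\<bar> \<le> (K * h x) * (6 * d / R * (?\<chi> x * norm (v x)))"
              unfolding abs_mult by (intro mult_mono K vp_le) (use K(2)[of x] in auto)
            then show "norm \<bar>g x * ?vp x\<bar> \<le> norm (K * (6 * d / R) * (?\<chi> x * (h x * norm (v x))))"
              by (simp only: real_norm_def abs_abs) (smt (verit) mult.assoc mult.commute mult.left_commute)
          qed
        qed
        fix x
        have "\<bar>g x * ?vp x\<bar> \<le> (K * h x) * (6 * d / R * (?\<chi> x * norm (v x)))"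
          unfolding abs_mult by (intro mult_mono K vp_le) (use K(2)[of x] in auto)
        then show "\<bar>g x * ?vp x\<bar> \<le> K * (6 * d / R) * (?\<chi> x * (h x * norm (v x)))"
          by (simp add: mult_ac)
      qed
      finally show ?thesis by simp
    qed
    have X1: "\<bar>\<integral>x. rho x * (norm (v x))\<^sup>2 * ?vp x \<partial>lborel\<bar> \<le> M * (6 * d / R) * I3"
      using flux_le[of "\<lambda>x. rho x * (norm (v x))\<^sup>2" "\<lambda>x. (norm (v x))\<^sup>2" M] rho_nonneg rho_le pos
      unfolding I3_def by (simp add: continuous_intros abs_mult mult_right_mono power3_eq_cube power2_eq_square)
    obtain c where c: "\<And>x. \<bar>press x - c * rho x\<bar> \<le> \<bar>press x - P0\<bar>"
      using pressure_linearization[OF P0] by blast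
    \<comment> \<open>The subtraction of \<open>c * rho\<close> is exact by conservation of mass;
      the constant \<open>P0\<close> enters only through the pointwise comparison.\<close>
    have X2: "\<bar>\<integral>x. press x * ?vp x \<partial>lborel\<bar> \<le> (6 * d / R) * IP"
    proof -
      have i: "integrable lborel (\<lambda>x. g x * ?vp x)" if "continuous_on UNIV g" for g
      proof (rule integrable_csupp)
        show "continuous_on UNIV (\<lambda>x. g x * ?vp x)" using that vp_cont by (rule continuous_on_mult)
        have "?vp x = 0" if "norm x > 2 * R" for x
          using vp_le[of x] that by (simp add: ann_def)
        then show "csupp (\<lambda>x. g x * ?vp x)"
          by (intro csuppI[where B="2*R"]) (simp only: mult_zero_right)
      qed
      have "(\<integral>x. rho x * ?vp x \<partial>lborel) = 0"
        using mass_weak[OF \<phi>] by (simp add: sum_distrib_left mult.assoc)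
      then have "(\<integral>x. press x * ?vp x \<partial>lborel) = (\<integral>x. press x * ?vp x - c * (rho x * ?vp x) \<partial>lborel)"
        using i by (subst Bochner_Integration.integral_diff) auto
      also have "\<dots> = (\<integral>x. (press x - c * rho x) * ?vp x \<partial>lborel)" by (simp add: algebra_simps)
      also have "\<bar>\<dots>\<bar> \<le> 1 * (6 * d / R) * IP"
        unfolding IP_def by (rule flux_le) (auto intro!: continuous_intros c)
      finally show ?thesis by simp
    qed
    have X4: "\<bar>\<integral>x. divv x * ?vp x \<partial>lborel\<bar> \<le> (6 * d / R) * ID"
      using flux_le[of divv "\<lambda>x. \<bar>divv x\<bar>" 1] unfolding ID_def by (simp add: continuous_intros)
    \<comment> \<open>Stated for a general matrix \<open>g\<close>, since it is applied to the
      velocity gradient and to its transpose.\<close>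
    have cross: "\<bar>\<integral>x. (\<Sum>i\<in>UNIV. \<Sum>j\<in>UNIV. g i j x * v x $ j * pderiv i ?\<phi> x) \<partial>lborel\<bar> \<le> e * E + 9 * d\<^sup>2 / e / R\<^sup>2 * I2"
      if g: "\<And>i j. continuous_on UNIV (g i j)" and gs: "\<And>x. (\<Sum>i\<in>UNIV. \<Sum>j\<in>UNIV. (g i j x)\<^sup>2) = gradsq x" for g
    proof -
      let ?S = "\<lambda>x. \<Sum>i\<in>UNIV. \<Sum>j\<in>UNIV. g i j x * v x $ j * pderiv i ?\<phi> x"
      have S_le: "\<bar>?S x\<bar> \<le> e * (gradsq x * ?\<phi> x) + 9 * d\<^sup>2 / e / R\<^sup>2 * (?\<chi> x * (norm (v x))\<^sup>2)" for x
      proof -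
        have "\<bar>?S x\<bar> \<le> (\<Sum>i\<in>UNIV. \<Sum>j\<in>UNIV. \<bar>g i j x * v x $ j * pderiv i ?\<phi> x\<bar>)"
          by (rule order_trans[OF sum_abs]) (intro sum_mono sum_abs)
        also have "\<dots> \<le> (\<Sum>i\<in>(UNIV::'n set). \<Sum>j\<in>(UNIV::'n set). e * (g i j x)\<^sup>2 * ?\<phi> x + 9 / e / R\<^sup>2 * (?\<chi> x * (norm (v x))\<^sup>2))"
        proof (intro sum_mono)
          fix i j
          have "\<bar>g i j x * v x $ j * pderiv i ?\<phi> x\<bar> = \<bar>g i j x\<bar> * (\<bar>v x $ j\<bar> * \<bar>pderiv i ?\<phi> x\<bar>)"
            by (simp add: abs_mult)
          also have "\<dots> \<le> \<bar>g i j x\<bar> * (norm (v x) * (6 / R * sqrt (?\<phi> x) * ?\<chi> x))"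
            by (intro mult_mono mult_left_mono component_le_norm_cart pderiv_cutoff_bound(1)[OF R]) auto
          also have "\<dots> = (\<bar>g i j x\<bar> * sqrt (?\<phi> x)) * (6 / R * ?\<chi> x * norm (v x))" by simp
          also have "\<dots> \<le> e * (\<bar>g i j x\<bar> * sqrt (?\<phi> x))\<^sup>2 + (6 / R * ?\<chi> x * norm (v x))\<^sup>2 / (4 * e)"
            by (rule amgm_weighted[OF pos(4)])
          also have "\<dots> = e * (g i j x)\<^sup>2 * ?\<phi> x + 9 / e / R\<^sup>2 * (?\<chi> x * (norm (v x))\<^sup>2)"
            using cutoff_nonneg[of R x] by (simp add: power_mult_distrib power_divide indicator_def)
          finally show "\<bar>g i j x * v x $ j * pderiv i ?\<phi> x\<bar> \<le> e * (g i j x)\<^sup>2 * ?\<phi> x + 9 / e / R\<^sup>2 * (?\<chi> x * (norm (v x))\<^sup>2)" .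
        qed
        also have "\<dots> = e * (gradsq x * ?\<phi> x) + 9 * d\<^sup>2 / e / R\<^sup>2 * (?\<chi> x * (norm (v x))\<^sup>2)"
        proof -
          have "(\<Sum>i\<in>(UNIV::'n set). \<Sum>j\<in>(UNIV::'n set). e * (g i j x)\<^sup>2 * ?\<phi> x) = e * (gradsq x * ?\<phi> x)"
            by (simp add: gs[symmetric] sum_distrib_left sum_distrib_right mult_ac)
          then show ?thesis by (simp add: sum.distrib d_def power2_eq_square)
        qed
        finally show ?thesis .
      qed
      have ig: "integrable lborel (\<lambda>x. e * (gradsq x * ?\<phi> x))"
        by (intro integrable_mult_right int gradsq_continuous)
      have iv: "integrable lborel (\<lambda>x. 9 * d\<^sup>2 / e / R\<^sup>2 * (?\<chi> x * (norm (v x))\<^sup>2))"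
        by (intro integrable_mult_right integrable_indicator_compact compact_ann continuous_intros) auto
      have iS: "integrable lborel ?S"
      proof (rule Bochner_Integration.integrable_bound[OF Bochner_Integration.integrable_add[OF ig iv]])
        have "continuous_on UNIV ?S" using g \<phi> by (intro continuous_intros) auto
        then show "?S \<in> borel_measurable lborel" using borel_measurable_continuous_onI by simp
        show "AE x in lborel. norm (?S x) \<le> norm (e * (gradsq x * ?\<phi> x) + 9 * d\<^sup>2 / e / R\<^sup>2 * (?\<chi> x * (norm (v x))\<^sup>2))"
          by (intro AE_I2) (unfold real_norm_def, rule order_trans[OF S_le abs_ge_self])
      qed
      have "\<bar>\<integral>x. ?S x \<partial>lborel\<bar> \<le> (\<integral>x. \<bar>?S x\<bar> \<partial>lborel)" by (rule integral_abs_bound)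
      also have "\<dots> \<le> (\<integral>x. e * (gradsq x * ?\<phi> x) + 9 * d\<^sup>2 / e / R\<^sup>2 * (?\<chi> x * (norm (v x))\<^sup>2) \<partial>lborel)"
        by (intro integral_mono integrable_abs iS Bochner_Integration.integrable_add ig iv S_le)
      also have "\<dots> = e * E + 9 * d\<^sup>2 / e / R\<^sup>2 * I2"
        unfolding E_def I2_def using ig iv by (subst Bochner_Integration.integral_add) auto
      finally show ?thesis .
    qed
    have gs': "(\<Sum>i\<in>UNIV. \<Sum>j\<in>UNIV. (dv j i x)\<^sup>2) = gradsq x" for x
      unfolding gradsq_def by (rule sum.swap)
    have X3: "\<bar>\<integral>x. (\<Sum>i\<in>UNIV. \<Sum>j\<in>UNIV. dv i j x * v x $ j * pderiv i ?\<phi> x) \<partial>lborel\<bar> \<le> e * E + 9 * d\<^sup>2 / e / R\<^sup>2 * I2"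
      by (rule cross) (simp_all add: gradsq_def)
    have X5: "\<bar>\<integral>x. (\<Sum>i\<in>UNIV. \<Sum>j\<in>UNIV. dv j i x * v x $ j * pderiv i ?\<phi> x) \<partial>lborel\<bar> \<le> e * E + 9 * d\<^sup>2 / e / R\<^sup>2 * I2"
      by (rule cross) (simp_all add: gs')
    define S1 where "S1 = (\<integral>x. rho x * (norm (v x))\<^sup>2 * ?vp x \<partial>lborel)"
    define S2 where "S2 = (\<integral>x. press x * ?vp x \<partial>lborel)"
    define S3 where "S3 = (\<integral>x. (\<Sum>i\<in>UNIV. \<Sum>j\<in>UNIV. dv i j x * v x $ j * pderiv i ?\<phi> x) \<partial>lborel)"
    define S4 where "S4 = (\<integral>x. divv x * ?vp x \<partial>lborel)"
    define S5 where "S5 = (\<integral>x. (\<Sum>i\<in>UNIV. \<Sum>j\<in>UNIV. dv j i x * v x $ j * pderiv i ?\<phi> x) \<partial>lborel)"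
    define DD where "DD = (\<integral>x. (divv x)\<^sup>2 * ?\<phi> x \<partial>lborel)"
    define Q where "Q = (\<integral>x. (\<Sum>i\<in>UNIV. \<Sum>j\<in>UNIV. dv j i x * dv i j x) * ?\<phi> x \<partial>lborel)"
    have en: "mu * E + \<nu> * DD = 1/2 * S1 + gamma / (gamma - 1) * S2 - mu * S3 - \<nu> * S4"
      using energy_identity[OF \<phi>] unfolding E_def DD_def S1_def S2_def S3_def S4_def \<nu>_def .
    have st: "Q - DD = S4 - S5"
      using stress_identity[OF \<phi>] unfolding Q_def DD_def S4_def S5_def .
    have QE: "Q \<le> E"
      unfolding Q_def E_def
    proof (rule integral_mono)
      show "integrable lborel (\<lambda>x. (\<Sum>i\<in>UNIV. \<Sum>j\<in>UNIV. dv j i x * dv i j x) * ?\<phi> x)"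
        by (intro int continuous_intros) auto
      show "integrable lborel (\<lambda>x. gradsq x * ?\<phi> x)" by (intro int gradsq_continuous)
      fix x
      have "(\<Sum>i\<in>UNIV. \<Sum>j\<in>UNIV. dv j i x * dv i j x) \<le> (\<Sum>i\<in>UNIV. \<Sum>j\<in>UNIV. ((dv j i x)\<^sup>2 + (dv i j x)\<^sup>2) / 2)"
      proof (intro sum_mono)
        fix i j
        show "dv j i x * dv i j x \<le> ((dv j i x)\<^sup>2 + (dv i j x)\<^sup>2) / 2"
          using sum_squares_bound[of "dv j i x" "dv i j x"] by simp
      qed
      also have "\<dots> = gradsq x"
      proof -
        have "(\<Sum>i\<in>UNIV. \<Sum>j\<in>UNIV. ((dv j i x)\<^sup>2 + (dv i j x)\<^sup>2) / 2) = ((\<Sum>i\<in>UNIV. \<Sum>j\<in>UNIV. (dv j i x)\<^sup>2) + (\<Sum>i\<in>UNIV. \<Sum>j\<in>UNIV. (dv i j x)\<^sup>2)) / 2"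
          by (simp add: sum.distrib sum_divide_distrib[symmetric])
        then show ?thesis unfolding gs' gradsq_def by simp
      qed
      finally show "(\<Sum>i\<in>UNIV. \<Sum>j\<in>UNIV. dv j i x * dv i j x) * ?\<phi> x \<le> gradsq x * ?\<phi> x"
        by (rule mult_right_mono) (rule cutoff_nonneg)
    qed
    have E0: "E \<ge> 0" "DD \<ge> 0"
      unfolding E_def DD_def gradsq_def by (intro integral_nonneg_AE AE_I2 mult_nonneg_nonneg sum_nonneg; simp add: cutoff_nonneg)+
    have "\<theta> * E \<le> 1/2 * \<bar>S1\<bar> + gamma / (gamma - 1) * \<bar>S2\<bar> + mu * \<bar>S3\<bar> + 2 * \<bar>\<nu>\<bar> * \<bar>S4\<bar> + \<bar>\<nu>\<bar> * \<bar>S5\<bar>"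
    proof -
      define T1 T2 T3 T4 T5 where "T1 = \<bar>S1\<bar>" and "T2 = gamma / (gamma - 1) * \<bar>S2\<bar>" and "T3 = mu * \<bar>S3\<bar>"
        and "T4 = \<bar>\<nu>\<bar> * \<bar>S4\<bar>" and "T5 = \<bar>\<nu>\<bar> * \<bar>S5\<bar>"
      note T = T1_def T2_def T3_def T4_def T5_def
      define U where "U = mu * E + \<nu> * DD"
      have b: "T4 \<ge> 0" "T5 \<ge> 0" unfolding T by auto
      have "S1 \<le> T1" unfolding T by simp
      moreover have "gamma / (gamma - 1) * S2 \<le> T2" unfolding T using gp by (intro mult_left_mono) auto
      moreover have "- (mu * S3) \<le> T3" unfolding T using mu mult_left_mono[of "- S3" "\<bar>S3\<bar>" mu] by simp
      moreover have "- (\<nu> * S4) \<le> T4" unfolding T using abs_ge_minus_self[of "\<nu> * S4"] by (simp add: abs_mult)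
      ultimately have U: "U \<le> 1/2 * T1 + T2 + T3 + T4" using en unfolding U_def by linarith
      have "\<theta> * E \<le> U + T4 + T5"
      proof (cases "\<nu> \<ge> 0")
        case True
        have "\<theta> * E \<le> mu * E" using E0 by (intro mult_right_mono) (auto simp: \<theta>_def)
        moreover have "\<nu> * DD \<ge> 0" using True E0 by simp
        ultimately show ?thesis using b unfolding U_def by linarith
      next
        case False
        \<comment> \<open>Here \<open>\<nu>\<close> is negative. From \<open>Q \<le> E\<close> and
          \<open>Q - DD = S4 - S5\<close> the excess \<open>DD - E\<close> is at most
          \<open>\<bar>S4\<bar> + \<bar>S5\<bar>\<close>.\<close>
        have "\<theta> * E \<le> (2 * mu + lambda) * E" using E0 by (intro mult_right_mono) (auto simp: \<theta>_def)
        moreover have "(2 * mu + lambda) * E = U + (- \<nu>) * (DD - E)"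
          by (simp add: U_def \<nu>_def algebra_simps)
        moreover have "(- \<nu>) * (DD - E) \<le> (- \<nu>) * (\<bar>S4\<bar> + \<bar>S5\<bar>)"
          using False QE st by (intro mult_left_mono) auto
        moreover have "(- \<nu>) * (\<bar>S4\<bar> + \<bar>S5\<bar>) = T4 + T5"
          using False by (simp add: T algebra_simps)
        ultimately show ?thesis by linarith
      qed
      with U b have "\<theta> * E \<le> 1/2 * T1 + T2 + T3 + 2 * T4 + T5" by linarith
      then show ?thesis unfolding T by (simp only: mult.assoc)
    qed
    also have "\<dots> \<le> 1/2 * (M * (6 * d / R) * I3) + gamma / (gamma - 1) * ((6 * d / R) * IP)
       + mu * (e * E + 9 * d\<^sup>2 / e / R\<^sup>2 * I2) + 2 * \<bar>\<nu>\<bar> * ((6 * d / R) * ID) + \<bar>\<nu>\<bar> * (e * E + 9 * d\<^sup>2 / e / R\<^sup>2 * I2)"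
      using X1 X2 X3 X4 X5 gp mu unfolding S1_def S2_def S3_def S4_def S5_def
      by (intro add_mono mult_left_mono) auto
    also have "\<dots> = \<theta> / 2 * E + 3 * d * M * (I3 / R) + 6 * d * (gamma / (gamma - 1)) * (IP / R)
       + 12 * d * \<bar>\<nu>\<bar> * (ID / R) + (mu + \<bar>\<nu>\<bar>) * (9 * d\<^sup>2 / e) * (I2 / R\<^sup>2)"
    proof -
      have "mu + \<bar>\<nu>\<bar> \<noteq> 0" using mu by linarith
      then have "(mu + \<bar>\<nu>\<bar>) * e = \<theta> / 2" by (simp add: e_def del: distrib_left_numeral)
      then have "mu * (e * E) + \<bar>\<nu>\<bar> * (e * E) = \<theta> / 2 * E" by (metis distrib_right mult.assoc)
      then show ?thesis by (simp add: algebra_simps add_divide_distrib)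
    qed
    also have "\<dots> \<le> \<theta> / 2 * E + (3 * d * M + 6 * d * (gamma / (gamma - 1)) + 12 * d * \<bar>\<nu>\<bar> + (mu + \<bar>\<nu>\<bar>) * (9 * d\<^sup>2 / e))
       * (I3 / R + IP / R + ID / R + I2 / R\<^sup>2)"
    proof -
      have *: "a * x + b * y + c * z + f * w \<le> (a + b + c + f) * (x + y + z + w)"
        if "a \<ge> 0" "b \<ge> 0" "c \<ge> 0" "f \<ge> 0" "x \<ge> 0" "y \<ge> 0" "z \<ge> 0" "w \<ge> 0" for a b c f x y z w :: real
      proof -
        have "(a + b + c + f) * (x + y + z + w) - (a * x + b * y + c * z + f * w) =
          a * (y + z + w) + b * (x + z + w) + c * (x + y + w) + f * (x + y + z)" by (simp add: algebra_simps)
        moreover have "\<dots> \<ge> 0" using that by (intro add_nonneg_nonneg mult_nonneg_nonneg) auto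
        ultimately show ?thesis by linarith
      qed
      show ?thesis unfolding add.assoc
        by (rule add_left_mono, unfold add.assoc[symmetric], rule *)
         (use pos gam mu nn R in \<open>auto intro!: mult_nonneg_nonneg divide_nonneg_nonneg simp del: zero_le_divide_iff\<close>)
    qed
    finally have "\<theta> * E \<le> \<theta> / 2 * E + (3 * d * M + 6 * d * (gamma / (gamma - 1)) + 12 * d * \<bar>\<nu>\<bar> + (mu + \<bar>\<nu>\<bar>) * (9 * d\<^sup>2 / e))
       * (I3 / R + IP / R + ID / R + I2 / R\<^sup>2)" .
    moreover have "E \<le> 2 / \<theta> * Y" if "\<theta> * E \<le> \<theta> / 2 * E + Y" for Y
      using that pos(1) by (simp add: field_simps)
    ultimately have "E \<le> C * (I3 / R + IP / R + ID / R + I2 / R\<^sup>2)"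
      unfolding C_def by (simp only: mult.assoc)
    moreover have "(\<integral>x. indicator (cball 0 R) x * gradsq x \<partial>lborel) \<le> E"
      unfolding E_def
    proof (rule integral_mono)
      show "integrable lborel (\<lambda>x. indicator (cball 0 R) x * gradsq x)"
        by (intro integrable_indicator_compact gradsq_continuous) auto
      show "integrable lborel (\<lambda>x. gradsq x * ?\<phi> x)" by (intro int gradsq_continuous)
      fix x
      have "gradsq x \<ge> 0" unfolding gradsq_def by (intro sum_nonneg) auto
      then show "indicator (cball 0 R) x * gradsq x \<le> gradsq x * ?\<phi> x"
        using cutoff_inside[OF R, of x] cutoff_nonneg[of R x] by (auto simp: indicator_def)
    qed
    ultimately show "(\<integral>x. indicator (cball 0 R) x * gradsq x \<partial>lborel) \<le>
      C * (I3 / R + IP / R + ID / R + I2 / R\<^sup>2)" by linarith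
  qed
qed

end

subsection \<open>Decomposition of the effective flux into scales\<close>

text \<open>On a ball only the values of \<open>w\<close> within the sum of the two radii are seen,
  so a merely continuous \<open>w\<close> may be truncated into the class
  \<open>bcs\<close>.\<close>

lemma conv_localize:
  assumes k: "\<And>z. norm z > a \<Longrightarrow> k z = 0" and x: "norm x \<le> b" and c: "a + b \<le> c"
  shows "conv k w x = conv k (\<lambda>y. indicator (cball 0 c) y * w y) x"
  unfolding conv_def
proof (rule Bochner_Integration.integral_cong[OF refl])
  fix y
  show "k (x - y) * w y = k (x - y) * (indicator (cball 0 c) y * w y)"
  proof (cases "norm y \<le> c")
    case False
    have "norm y \<le> norm x + norm (x - y)" using norm_triangle_ineq4[of x "x - y"] by simp
    then show ?thesis using False x c by (subst k) auto
  qed simp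
qed

lemma continuous_indicator_bcs:
  fixes w :: "'a::euclidean_space \<Rightarrow> real"
  assumes "continuous_on UNIV w" "compact S"
  shows "bcs (\<lambda>y. indicator S y * w y)"
proof -
  obtain B where B: "\<And>x. x \<in> S \<Longrightarrow> norm x \<le> B"
    using compact_imp_bounded[OF assms(2)] by (auto simp: bounded_iff)
  have "compact (w ` S)"
    using assms by (intro compact_continuous_image) (auto intro: continuous_on_subset)
  then obtain C where C: "\<And>x. x \<in> S \<Longrightarrow> \<bar>w x\<bar> \<le> C"
    using compact_imp_bounded by (force simp: bounded_iff)
  show ?thesis
  proof (rule bcsI[where B=B and C="max 0 C"])
    have [measurable]: "w \<in> borel_measurable borel" "S \<in> sets borel"
      using assms by (auto intro: borel_measurable_continuous_onI borel_compact)
    show "(\<lambda>y. indicator S y * w y) \<in> borel_measurable borel" by measurable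
    show "indicator S x * w x = 0" if "norm x > B" for x using B[of x] that by (auto simp: indicator_def)
    show "\<bar>indicator S x * w x\<bar> \<le> max 0 C" for x using C[of x] by (auto simp: indicator_def)
  qed
qed

lemma continuous_kernel_integrable:
  fixes w :: "'a::euclidean_space \<Rightarrow> real"
  assumes "bcs k" "continuous_on UNIV w"
  shows "integrable lborel (\<lambda>y. k (x - y) * w y)"
proof -
  obtain B where B: "\<forall>x. norm x > B \<longrightarrow> k x = 0" using assms(1) by (auto simp: bcs_def csupp_def)
  have eq: "(\<lambda>y. k (x - y) * (indicator (cball 0 (B + norm x)) y * w y)) = (\<lambda>y. k (x - y) * w y)"
  proof
    fix y
    show "k (x - y) * (indicator (cball 0 (B + norm x)) y * w y) = k (x - y) * w y"
    proof (cases "norm y \<le> B + norm x")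
      case False
      have "norm y \<le> norm x + norm (x - y)" using norm_triangle_ineq4[of x "x - y"] by simp
      then have "k (x - y) = 0" using False B by auto
      then show ?thesis by simp
    qed simp
  qed
  have "bcs (\<lambda>y. k (x - y) * (indicator (cball 0 (B + norm x)) y * w y))"
    by (intro bcs_mult bcs_minus_shift assms(1) continuous_indicator_bcs assms(2)) auto
  then show ?thesis unfolding eq by (rule bcs_integrable)
qed

text \<open>Seen as a sum of \<open>dker\<close> over dyadic scales, its derivatives have
  \<open>L1\<close> norm bounded by a multiple of their number. Seen as one curl-free kernel with
  divergence \<open>bump l - bump R\<close>, its derivatives act on \<open>L2\<close> with a norm
  independent of that number. Interpolation exploits this discrepancy.\<close>

definition newton_diff :: "real \<Rightarrow> real \<Rightarrow> 'n \<Rightarrow> real^'n::finite \<Rightarrow> real" where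
  "newton_diff l R i x = newton l i x - newton R i x"

lemma newton_diff_C1: "C1 (newton_diff l R i)"
  unfolding newton_diff_def by (intro C1_diff newton_C1)

lemma pderiv_newton_diff: "pderiv j (newton_diff l R i) x = pderiv j (newton l i) x - pderiv j (newton R i) x"
  unfolding newton_diff_def by (rule pderiv_diff) (auto intro: C1_differentiable newton_C1)

lemma pderiv_newton_diff_sym: "pderiv j (newton_diff l R i) = pderiv i (newton_diff l R j)"
  by (rule ext) (simp add: pderiv_newton_diff pderiv_newton_sym[of j _ i])

lemma divergence_newton_diff:
  "l > 0 \<Longrightarrow> R > 0 \<Longrightarrow> (\<Sum>i\<in>UNIV. pderiv i (newton_diff l R i) x) = bump l x - bump R x"
  by (simp add: pderiv_newton_diff sum_subtractf divergence_newton)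

lemma newton_diff_outside: "0 < l \<Longrightarrow> l \<le> R \<Longrightarrow> norm x \<ge> R \<Longrightarrow> newton_diff l R i x = 0"
  by (simp add: newton_diff_def newton_outside)

lemma pderiv_newton_diff_outside: "0 < l \<Longrightarrow> l \<le> R \<Longrightarrow> norm x > R \<Longrightarrow> pderiv j (newton_diff l R i) x = 0"
proof -
  assume l: "0 < l" "l \<le> R" and x: "norm x > R"
  have "open {x::real^'a. norm x > R}" by (intro open_Collect_less continuous_intros)
  then have "(newton_diff l R i has_derivative (\<lambda>_. 0)) (at x)"
    by (rule has_derivative_transform_within_open[OF has_derivative_const[of 0]])
      (use l x in \<open>auto simp: newton_diff_outside\<close>)
  then show ?thesis by (simp add: pderivI)
qed

lemma newton_diff_csupp: "0 < l \<Longrightarrow> l \<le> R \<Longrightarrow> csupp (newton_diff l R i)"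
  by (rule csuppI[where B=R]) (simp add: newton_diff_outside)

lemma pderiv_newton_diff_bcs: "0 < l \<Longrightarrow> l \<le> R \<Longrightarrow> bcs (pderiv j (newton_diff l R i))"
  by (intro continuous_bcs csupp_pderiv newton_diff_csupp) (auto simp: newton_diff_C1)

lemma pderiv_newton_diff_telescope:
  "pderiv j (newton_diff l (2 ^ n * l) i) x = (\<Sum>m<n. pderiv j (dker (2 ^ m * l) i) x)"
  by (induction n) (auto simp: pderiv_newton_diff pderiv_dker mult.assoc)

lemma pderiv_newton_diff_L1:
  assumes "l > 0"
  shows "(\<integral>x. \<bar>pderiv j (newton_diff l (2 ^ n * l) i) x\<bar> \<partial>lborel) \<le>
    n * (\<integral>x. \<bar>pderiv j (dker 1 i) x\<bar> \<partial>lborel)"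
proof -
  have b: "bcs (pderiv j (dker (2 ^ m * l) i))" for m using assms by (intro pderiv_dker_bcs) simp
  have "l \<le> 2 ^ n * l" using assms by simp
  then have "(\<integral>x. \<bar>pderiv j (newton_diff l (2 ^ n * l) i) x\<bar> \<partial>lborel) \<le>
    (\<integral>x. (\<Sum>m<n. \<bar>pderiv j (dker (2 ^ m * l) i) x\<bar>) \<partial>lborel)"
    using assms b
    by (intro integral_mono bcs_integrable bcs_abs pderiv_newton_diff_bcs Bochner_Integration.integrable_sum)
      (auto simp: pderiv_newton_diff_telescope)
  also have "\<dots> = (\<Sum>m<n. \<integral>x. \<bar>pderiv j (dker (2 ^ m * l) i) x\<bar> \<partial>lborel)"
    by (intro Bochner_Integration.integral_sum bcs_integrable bcs_abs b)
  also have "\<dots> = n * (\<integral>x. \<bar>pderiv j (dker 1 i) x\<bar> \<partial>lborel)"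
  proof -
    have "(\<integral>x. \<bar>pderiv j (dker (2 ^ m * l) i) x\<bar> \<partial>lborel) = (\<integral>x. \<bar>pderiv j (dker 1 i) x\<bar> \<partial>lborel)" for m
      by (rule pderiv_dker_L1) (use assms in simp)
    then show ?thesis by (simp only: sum_constant card_lessThan)
  qed
  finally show ?thesis .
qed

text \<open>The divergence is the difference of two nonnegative bumps of equal mass, so its
  \<open>L1\<close> norm is at most twice that mass for all \<open>l\<close> and \<open>R\<close>;
  squaring gives the 4.\<close>

lemma newton_diff_L2:
  fixes w :: "real^'n::finite \<Rightarrow> real"
  assumes l: "0 < l" "l \<le> R" and w: "bcs w"
  shows "(\<integral>x. (conv (pderiv i (newton_diff l R j)) w x)\<^sup>2 \<partial>lborel) \<le>
    4 * (bump_mass TYPE('n))\<^sup>2 * (\<integral>x. (w x)\<^sup>2 \<partial>lborel)"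
proof -
  let ?m = "bump_mass TYPE('n)"
  have R: "R > 0" using l by simp
  have b: "bcs (\<lambda>x::real^'n. bump l x - bump R x)" by (intro bcs_diff bump_bcs l R)
  have "(\<integral>x. \<bar>bump l (x::real^'n) - bump R x\<bar> \<partial>lborel) \<le> (\<integral>x. bump l (x::real^'n) + bump R x \<partial>lborel)"
  proof (intro integral_mono bcs_integrable bcs_abs b bcs_add bump_bcs l R)
    fix x :: "real^'n"
    show "\<bar>bump l x - bump R x\<bar> \<le> bump l x + bump R x"
      using bump_nonneg[OF l(1), of x] bump_nonneg[OF R, of x] by linarith
  qed
  also have "\<dots> = 2 * ?m"
    using bcs_integrable[OF bump_bcs[OF l(1)]] bcs_integrable[OF bump_bcs[OF R]]
    by (subst Bochner_Integration.integral_add) (auto simp: integral_bump l R)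
  finally have "(\<integral>x. \<bar>bump l (x::real^'n) - bump R x\<bar> \<partial>lborel)\<^sup>2 \<le> (2 * ?m)\<^sup>2"
    by (intro power_mono) auto
  then have m: "(\<integral>x. \<bar>bump l (x::real^'n) - bump R x\<bar> \<partial>lborel)\<^sup>2 * (\<integral>x. (w x)\<^sup>2 \<partial>lborel) \<le> 4 * ?m\<^sup>2 * (\<integral>x. (w x)\<^sup>2 \<partial>lborel)"
    by (intro mult_right_mono) (auto simp: power_mult_distrib)
  have "(\<integral>x. (conv (pderiv i (newton_diff l R j)) w x)\<^sup>2 \<partial>lborel) \<le>
    (\<integral>x. (conv (\<lambda>x. \<Sum>i\<in>UNIV. pderiv i (newton_diff l R i) x) w x)\<^sup>2 \<partial>lborel)"
    by (rule conv_L2_symmetric_jacobian) (use l w in \<open>auto intro: newton_diff_C1 newton_diff_csupp pderiv_newton_diff_sym\<close>)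
  also have "\<dots> = (\<integral>x. (conv (\<lambda>x. bump l x - bump R x) w x)\<^sup>2 \<partial>lborel)"
    using l R by (simp add: divergence_newton_diff)
  also have "\<dots> \<le> (\<integral>x. \<bar>bump l (x::real^'n) - bump R x\<bar> \<partial>lborel)\<^sup>2 * (\<integral>x. (w x)\<^sup>2 \<partial>lborel)"
    by (rule conv_L2[OF b w])
  finally show ?thesis using m by linarith
qed

context stationary_flow
begin

text \<open>The test field is \<open>dker l\<close>, reflected and centred at x. The flux version
  has the derivative on the kernel and decays at large scales; the force version has a kernel whose
  \<open>L1\<close> norm is of order \<open>l\<close> and is good at small scales.\<close>

lemma eff_step_flux:
  assumes l: "l > 0"
  shows "conv (bump l) eff x - conv (bump (2 * l)) eff x =
      - (\<Sum>j\<in>UNIV. \<Sum>i\<in>UNIV. conv (pderiv i (dker l j)) (flux i j) x)"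
  and eff_step_force: "conv (bump l) eff x - conv (bump (2 * l)) eff x = - (\<Sum>j\<in>UNIV. conv (dker l j) (force j) x)"
proof -
  define Z where "Z j = (\<lambda>y. dker l j (x - y))" for j
  have Z1: "C1 (Z j)" and Zp: "pderiv i (Z j) y = - pderiv i (dker l j) (x - y)" for i j y
    using C1_affine'[OF dker_C1[of l j], of x "-1"] pderiv_affine[OF dker_C1[of l j], of i x "-1" y]
    unfolding Z_def by auto
  have Zc: "csupp (Z j)" for j
    unfolding Z_def by (rule bcs_csupp[OF bcs_minus_shift[OF dker_bcs[OF l]]])
  have Zs: "pderiv i (Z j) = pderiv j (Z i)" for i j
    by (rule ext) (simp add: Zp pderiv_dker_sym[of i l j])
  have l2: "2 * l > 0" using l by simp
  have "(\<integral>y. eff y * (\<Sum>j\<in>UNIV. pderiv j (Z j) y) \<partial>lborel) =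
    (\<integral>y. bump (2 * l) (x - y) * eff y - bump l (x - y) * eff y \<partial>lborel)"
    by (simp add: Zp sum_negf divergence_dker[OF l] algebra_simps)
  also have "\<dots> = conv (bump (2 * l)) eff x - conv (bump l) eff x"
    unfolding conv_def
    by (rule Bochner_Integration.integral_diff) (intro continuous_kernel_integrable bump_bcs l l2 eff_continuous)+
  finally have L: "(\<integral>y. eff y * (\<Sum>j\<in>UNIV. pderiv j (Z j) y) \<partial>lborel) = conv (bump (2 * l)) eff x - conv (bump l) eff x" .
  have W: "(\<integral>y. flux i j y * pderiv i (Z j) y \<partial>lborel) = - conv (pderiv i (dker l j)) (flux i j) x" for i j
    by (simp add: Zp conv_def mult.commute)
  have F: "(\<integral>y. force j y * Z j y \<partial>lborel) = conv (dker l j) (force j) x" for j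
    by (simp add: Z_def conv_def mult.commute)
  note w = weak_identity[of Z, OF Z1 Zc Zs]
  show "conv (bump l) eff x - conv (bump (2 * l)) eff x =
      - (\<Sum>j\<in>UNIV. \<Sum>i\<in>UNIV. conv (pderiv i (dker l j)) (flux i j) x)"
    using w(1) unfolding L W by (simp add: sum_negf)
  show "conv (bump l) eff x - conv (bump (2 * l)) eff x = - (\<Sum>j\<in>UNIV. conv (dker l j) (force j) x)"
    using w(1) w(2) unfolding L F by simp
qed

lemma eff_telescope:
  "conv (bump l) eff x - conv (bump (2 ^ n * l)) eff x =
    (\<Sum>m<n. conv (bump (2 ^ m * l)) eff x - conv (bump (2 * (2 ^ m * l))) eff x)"
  by (induction n) (auto simp: mult.assoc)

text \<open>The scale \<open>2 ^ m * l\<close> costs its own length times the \<open>L1\<close> norm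
  of the force, and the geometric sum is at most its upper end. Points up to 2 R see the force only
  up to 3 R, because the supports have radius
  \<open>2 * (2 ^ m * l) \<le> 2 ^ n * l \<le> R\<close>.\<close>

lemma small_scales:
  assumes l: "l > 0" and R: "2 ^ n * l \<le> R"
  shows "(\<integral>x. indicator (cball 0 (2 * R)) x * \<bar>conv (bump l) eff x - conv (bump (2 ^ n * l)) eff x\<bar> \<partial>lborel) \<le>
    2 ^ n * l * (\<Sum>j\<in>UNIV. (\<integral>x. \<bar>dker 1 j x\<bar> \<partial>lborel) * (\<integral>x. indicator (cball 0 (3 * R)) x * \<bar>force j x\<bar> \<partial>lborel))"
proof -
  let ?f = "\<lambda>j y. indicator (cball 0 (3 * R)) y * force j y"
  have fb: "bcs (?f j)" for j by (intro continuous_indicator_bcs force_continuous) auto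
  have lm: "2 ^ m * l > 0" for m :: nat using l by simp
  have cb: "bcs (conv (dker (2 ^ m * l) j) (?f j))" for m j by (intro bcs_conv dker_bcs lm fb)
  have le: "indicator (cball 0 (2 * R)) x * \<bar>conv (bump l) eff x - conv (bump (2 ^ n * l)) eff x\<bar> \<le>
     (\<Sum>m<n. \<Sum>j\<in>UNIV. \<bar>conv (dker (2 ^ m * l) j) (?f j) x\<bar>)" for x
  proof (cases "norm x \<le> 2 * R")
    case True
    have "conv (dker (2 ^ m * l) j) (force j) x = conv (dker (2 ^ m * l) j) (?f j) x" if "m < n" for m j
    proof (rule conv_localize[OF _ True])
      show "dker (2 ^ m * l) j z = 0" if "norm z > 2 * (2 ^ m * l)" for z
        by (rule dker_outside[OF lm]) (use that in simp)
      have "(2::real) ^ Suc m \<le> 2 ^ n" using that by (intro power_increasing) auto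
      then have "2 * 2 ^ m * l \<le> 2 ^ n * l" using l by (intro mult_right_mono) auto
      then show "2 * (2 ^ m * l) + 2 * R \<le> 3 * R" using R by simp
    qed
    then have "conv (bump l) eff x - conv (bump (2 ^ n * l)) eff x = (\<Sum>m<n. - (\<Sum>j\<in>UNIV. conv (dker (2 ^ m * l) j) (?f j) x))"
      unfolding eff_telescope by (intro sum.cong refl) (simp add: eff_step_force[OF lm])
    also have "\<bar>\<dots>\<bar> \<le> (\<Sum>m<n. \<Sum>j\<in>UNIV. \<bar>conv (dker (2 ^ m * l) j) (?f j) x\<bar>)"
      by (rule order_trans[OF sum_abs]) (intro sum_mono, simp add: sum_abs)
    finally show ?thesis using True by simp
  qed (auto intro!: sum_nonneg)
  have "(\<integral>x. indicator (cball 0 (2 * R)) x * \<bar>conv (bump l) eff x - conv (bump (2 ^ n * l)) eff x\<bar> \<partial>lborel) \<le>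
    (\<integral>x. (\<Sum>m<n. \<Sum>j\<in>UNIV. \<bar>conv (dker (2 ^ m * l) j) (?f j) x\<bar>) \<partial>lborel)"
  proof (rule integral_mono_AE')
    show "integrable lborel (\<lambda>x. \<Sum>m<n. \<Sum>j\<in>UNIV. \<bar>conv (dker (2 ^ m * l) j) (?f j) x\<bar>)"
      by (intro Bochner_Integration.integrable_sum bcs_integrable bcs_abs cb)
  qed (auto intro!: AE_I2 le sum_nonneg)
  also have "\<dots> = (\<Sum>m<n. \<Sum>j\<in>UNIV. \<integral>x. \<bar>conv (dker (2 ^ m * l) j) (?f j) x\<bar> \<partial>lborel)"
    by (subst Bochner_Integration.integral_sum,
        intro Bochner_Integration.integrable_sum bcs_integrable bcs_abs cb,
        intro sum.cong refl Bochner_Integration.integral_sum bcs_integrable bcs_abs cb)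
  also have "\<dots> \<le> (\<Sum>m<n. \<Sum>j\<in>UNIV. (2 ^ m * l) * ((\<integral>x. \<bar>dker 1 j x\<bar> \<partial>lborel) * (\<integral>x. indicator (cball 0 (3 * R)) x * \<bar>force j x\<bar> \<partial>lborel)))"
  proof (intro sum_mono)
    fix m j
    show "(\<integral>x. \<bar>conv (dker (2 ^ m * l) j) (?f j) x\<bar> \<partial>lborel) \<le>
      (2 ^ m * l) * ((\<integral>x. \<bar>dker 1 j x\<bar> \<partial>lborel) * (\<integral>x. indicator (cball 0 (3 * R)) x * \<bar>force j x\<bar> \<partial>lborel))"
      using conv_L1[OF dker_bcs[OF lm] fb, of m j j] unfolding dker_L1[OF lm] by (simp add: abs_mult mult_ac)
  qed
  also have "\<dots> = (\<Sum>m<n. 2 ^ m) * l * (\<Sum>j\<in>UNIV. (\<integral>x. \<bar>dker 1 j x\<bar> \<partial>lborel) * (\<integral>x. indicator (cball 0 (3 * R)) x * \<bar>force j x\<bar> \<partial>lborel))"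
    by (simp only: sum_distrib_left[symmetric] sum_distrib_right[symmetric])
  also have "\<dots> \<le> 2 ^ n * l * (\<Sum>j\<in>UNIV. (\<integral>x. \<bar>dker 1 j x\<bar> \<partial>lborel) * (\<integral>x. indicator (cball 0 (3 * R)) x * \<bar>force j x\<bar> \<partial>lborel))"
  proof -
    have "(\<Sum>m<n. (2::real) ^ m) \<le> 2 ^ n" by (induction n) auto
    then show ?thesis using l by (intro mult_right_mono sum_nonneg mult_nonneg_nonneg integral_nonneg_AE) auto
  qed
  finally show ?thesis .
qed

text \<open>The scales are summed up before absolute values are taken. The cancellation between them
  is what keeps the \<open>L2\<close> norm bounded.\<close>

lemma medium_scales:
  assumes l: "l > 0" and R: "R = 2 ^ n * l" and x: "norm x \<le> 2 * R"
  shows "\<bar>conv (bump l) eff x - conv (bump R) eff x\<bar> \<le>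
    (\<Sum>j\<in>UNIV. \<Sum>i\<in>UNIV. \<bar>conv (pderiv i (newton_diff l R j)) (\<lambda>y. indicator (cball 0 (4 * R)) y * flux i j y) x\<bar>)"
proof -
  have lm: "2 ^ m * l > 0" for m :: nat using l by simp
  have lR: "0 < l" "l \<le> R" using l R by auto
  have fc: "continuous_on UNIV (flux i j)" for i j by simp
  have int: "integrable lborel (\<lambda>y. pderiv i (dker (2 ^ m * l) j) (x - y) * flux i j y)" for m i j
    by (intro continuous_kernel_integrable pderiv_dker_bcs lm fc)
  have "conv (bump l) eff x - conv (bump R) eff x =
     (\<Sum>m<n. - (\<Sum>j\<in>UNIV. \<Sum>i\<in>UNIV. conv (pderiv i (dker (2 ^ m * l) j)) (flux i j) x))"
    unfolding R eff_telescope by (intro sum.cong refl) (simp add: eff_step_flux[OF lm])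
  also have "\<dots> = - (\<Sum>j\<in>UNIV. \<Sum>i\<in>UNIV. \<Sum>m<n. conv (pderiv i (dker (2 ^ m * l) j)) (flux i j) x)"
    unfolding sum_negf by (subst sum.swap, rule arg_cong[where f=uminus], intro sum.cong refl, rule sum.swap)
  also have "\<bar>\<dots>\<bar> \<le> (\<Sum>j\<in>UNIV. \<Sum>i\<in>UNIV. \<bar>\<Sum>m<n. conv (pderiv i (dker (2 ^ m * l) j)) (flux i j) x\<bar>)"
    unfolding abs_minus_cancel by (rule order_trans[OF sum_abs]) (intro sum_mono sum_abs)
  also have "\<dots> = (\<Sum>j\<in>UNIV. \<Sum>i\<in>UNIV. \<bar>conv (pderiv i (newton_diff l R j)) (\<lambda>y. indicator (cball 0 (4 * R)) y * flux i j y) x\<bar>)"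
  proof (intro sum.cong refl arg_cong[where f=abs])
    fix i j
    have "(\<Sum>m<n. conv (pderiv i (dker (2 ^ m * l) j)) (flux i j) x) = conv (pderiv i (newton_diff l R j)) (flux i j) x"
      unfolding conv_def R pderiv_newton_diff_telescope sum_distrib_right
      by (rule Bochner_Integration.integral_sum[symmetric]) (rule int)
    also have "\<dots> = conv (pderiv i (newton_diff l R j)) (\<lambda>y. indicator (cball 0 (4 * R)) y * flux i j y) x"
      by (rule conv_localize[OF pderiv_newton_diff_outside[OF lR] x]) (use lR in auto)
    finally show "(\<Sum>m<n. conv (pderiv i (dker (2 ^ m * l) j)) (flux i j) x) =
      conv (pderiv i (newton_diff l R j)) (\<lambda>y. indicator (cball 0 (4 * R)) y * flux i j y) x" .
  qed
  finally show ?thesis .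
qed

end

subsection \<open>Moment bounds\<close>

text \<open>Pointwise substitute for Hoelder: integrated, it trades a moment of order
  \<open>a\<close> for a measure plus a moment of order \<open>q\<close>, with the height
  \<open>t\<close> free to be chosen.\<close>

lemma powr_interpolation:
  fixes y t a q :: real
  assumes "y \<ge> 0" "t > 0" "0 \<le> a" "a \<le> q"
  shows "y powr a \<le> t powr a + t powr (a - q) * y powr q"
proof (cases "y \<le> t")
  case True
  then have "y powr a \<le> t powr a" using assms by (intro powr_mono2) auto
  then show ?thesis by (simp add: add_increasing2)
next
  case False
  then have "y > 0" using assms by simp
  then have "y powr a = y powr (a - q) * y powr q" by (simp add: powr_add[symmetric])
  also have "\<dots> \<le> t powr (a - q) * y powr q"
    using False assms by (intro mult_right_mono powr_mono2') auto
  finally show ?thesis by (simp add: add_increasing)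
qed

text \<open>Young's inequality with the factors 1 / r and 1 / r' replaced by 1, which leaves a
  simple comparison of the second factor with the power r - 1 of the first. The parameter
  \<open>s\<close> balances the two terms.\<close>

lemma young_powr:
  fixes a b s r r' :: real
  assumes "a \<ge> 0" "b \<ge> 0" "s > 0" "r > 1" "r' = r / (r - 1)"
  shows "a * b \<le> s powr r * a powr r + s powr (- r') * b powr r'"
proof -
  have *: "x * y \<le> x powr r + y powr r'" if xy: "x \<ge> 0" "y \<ge> 0" for x y :: real
  proof (cases "x = 0 \<or> y = 0")
    case False
    then have p: "x > 0" "y > 0" using xy by auto
    show ?thesis
    proof (cases "y \<le> x powr (r - 1)")
      case True
      then have "x * y \<le> x * x powr (r - 1)" using p by simp
      also have "\<dots> = x powr r" using p by (simp add: powr_mult_base)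
      finally show ?thesis by (simp add: add_increasing2)
    next
      case 2: False
      have "x = (x powr (r - 1)) powr (1 / (r - 1))" using p assms by (simp add: powr_powr)
      also have "\<dots> \<le> y powr (1 / (r - 1))" using 2 assms by (intro powr_mono2) auto
      finally have "x * y \<le> y powr (1 / (r - 1)) * y" using p by simp
      also have "\<dots> = y powr (1 + 1 / (r - 1))" using p by (simp add: powr_add)
      also have "1 + 1 / (r - 1) = r'" using assms by (simp add: field_simps)
      finally show ?thesis by (simp add: add_increasing)
    qed
  qed auto
  have "a * b = (s * a) * (b / s)" using assms by simp
  also have "\<dots> \<le> (s * a) powr r + (b / s) powr r'" by (rule *) (use assms in auto)
  also have "\<dots> = s powr r * a powr r + s powr (- r') * b powr r'"
    using assms by (simp add: powr_mult powr_divide powr_minus field_simps)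
  finally show ?thesis .
qed

lemma mult_le_sum_squares: "a * b \<le> a\<^sup>2 + b\<^sup>2" for a b :: real
proof -
  have "0 \<le> (a - b)\<^sup>2 + a\<^sup>2 + b\<^sup>2" by simp
  then show ?thesis by (simp add: power2_diff)
qed

lemma pderiv_dker_bound:
  obtains c where "c > 0" "\<And>i j (z::real^'n::finite). \<bar>pderiv i (dker 1 j) z\<bar> \<le> c"
proof -
  have "\<forall>i j. \<exists>c>0. \<forall>z::real^'n. \<bar>pderiv i (dker 1 j) z\<bar> \<le> c"
    using bcsE[OF pderiv_dker_bcs[of 1]] by (metis zero_less_one)
  then obtain c where c: "\<And>i j. c i j > 0" "\<And>i j (z::real^'n). \<bar>pderiv i (dker 1 j) z\<bar> \<le> c i j" by metis
  have "c i j \<le> (\<Sum>i\<in>UNIV. \<Sum>j\<in>UNIV. c i j)" for i j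
    by (rule order_trans[OF member_le_sum[where f="\<lambda>j. c i j" and i=j]
        member_le_sum[where f="\<lambda>i. \<Sum>j\<in>UNIV. c i j"]]) (auto simp: sum_nonneg less_imp_le c)
  then have "\<bar>pderiv i (dker 1 j) z\<bar> \<le> (\<Sum>i\<in>UNIV. \<Sum>j\<in>UNIV. c i j)" for i j and z :: "real^'n"
    using c(2) order_trans by blast
  moreover have "(\<Sum>i\<in>UNIV. \<Sum>j\<in>UNIV. c i j) > 0" by (intro sum_pos c) auto
  ultimately show ?thesis using that by blast
qed

locale decaying_flow = stationary_flow rho v mu lambda A gamma M
  for rho :: "real^'n::finite \<Rightarrow> real" and v :: "real^'n \<Rightarrow> real^'n" and mu lambda A gamma M :: real +
  assumes d2: "CARD('n) \<ge> 2"
    and div_int: "integrable lborel (\<lambda>x. (divv x)\<^sup>2)"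
    and v_int: "integrable lborel (\<lambda>x. norm (v x) powr (3 * real CARD('n) / (real CARD('n) - 1)))"
    and v_int': "CARD('n) \<ge> 4 \<Longrightarrow> integrable lborel (\<lambda>x. norm (v x) powr (2 * real CARD('n) / (real CARD('n) - 2)))"
begin

definition d :: real where "d = real CARD('n)"
definition q :: real where "q = 3 * d / (d - 1)"
definition vol :: real where "vol = unit_ball_vol d"
definition vI :: real where "vI = (\<integral>x. norm (v x) powr q \<partial>lborel)"
definition X :: "nat \<Rightarrow> real" where "X k = (\<integral>x. indicator (ann (2 ^ k)) x * norm (v x) powr q \<partial>lborel)"

lemma d_ge: "d \<ge> 2" using d2 by (simp add: d_def)

lemma q_d: "q * (d - 1) / 3 = d" and q_gt_3: "q > 3"
  using d_ge by (auto simp: q_def field_simps)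

lemma vq_int: "integrable lborel (\<lambda>x. norm (v x) powr q)"
  using v_int by (simp add: q_def d_def)

lemma vol_nonneg: "vol \<ge> 0" by (simp add: vol_def d_def)

lemma vI_nonneg: "vI \<ge> 0" unfolding vI_def by (intro integral_nonneg_AE) auto

lemma measure_ball: "R > 0 \<Longrightarrow> measure lborel (cball (x::real^'n) R) = vol * R powr d"
  by (simp add: measure_cball vol_def d_def powr_realpow)

lemma norm_powr_continuous: "a > 0 \<Longrightarrow> continuous_on UNIV (\<lambda>x. norm (v x) powr a)"
  by (intro continuous_on_powr' continuous_intros) auto

lemma moment_bound:
  assumes "compact S" "t > 0" "0 < a" "a \<le> Q"
  shows "(\<integral>x. indicator S x * norm (v x) powr a \<partial>lborel) \<le>
    t powr a * measure lborel S + t powr (a - Q) * (\<integral>x. indicator S x * norm (v x) powr Q \<partial>lborel)"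
proof -
  have q0: "Q > 0" using assms by simp
  have int: "integrable lborel (\<lambda>x. indicator S x * norm (v x) powr b)" if "b > 0" for b
    by (intro integrable_indicator_compact norm_powr_continuous assms that)
  have S: "integrable lborel (indicator S :: _ \<Rightarrow> real)"
    using integrable_indicator_compact[OF assms(1), of "\<lambda>_. 1"] by simp
  have "(\<integral>x. indicator S x * norm (v x) powr a \<partial>lborel) \<le>
     (\<integral>x. t powr a * indicator S x + t powr (a - Q) * (indicator S x * norm (v x) powr Q) \<partial>lborel)"
    using powr_interpolation[of "norm (v _)" t a Q] assms
    by (intro integral_mono Bochner_Integration.integrable_add integrable_mult_right int S q0)
      (auto simp: indicator_def)
  also have "\<dots> = t powr a * measure lborel S + t powr (a - Q) * (\<integral>x. indicator S x * norm (v x) powr Q \<partial>lborel)"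
    using int[OF q0] S by (subst Bochner_Integration.integral_add) auto
  finally show ?thesis .
qed

text \<open>The height \<open>t\<close> satisfies \<open>t powr q * R powr d = 1\<close>, so both
  terms of the interpolation have the same order. The exponent \<open>d - a * (d - 1) / 3\<close> is
  0 for a = q and 1 for a = 3: a cubic term divided by R is exactly critical.\<close>

lemma ball_moment:
  assumes R: "R > 0" and a: "0 < a" "a \<le> q"
  shows "(\<integral>x. indicator (cball z R) x * norm (v x) powr a \<partial>lborel) \<le> (vol + vI) * R powr (d - a * (d - 1) / 3)"
proof -
  define t where "t = R powr (- (d - 1) / 3)"
  have q0: "q > 0" using q_gt_3 by simp
  have e1: "t powr a * R powr d = R powr (d - a * (d - 1) / 3)"
    by (simp add: t_def powr_powr flip: powr_add) (simp add: algebra_simps diff_divide_distrib)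
  have ex: "(- (d - 1) / 3) * (a - q) = d - a * (d - 1) / 3"
    using q_d by (simp add: algebra_simps diff_divide_distrib)
  have e2: "t powr (a - q) = R powr (d - a * (d - 1) / 3)"
    by (simp only: t_def powr_powr ex)
  have "(\<integral>x. indicator (cball z R) x * norm (v x) powr q \<partial>lborel) \<le> vI"
    unfolding vI_def by (intro integral_mono integrable_indicator_compact norm_powr_continuous q0 vq_int)
      (auto simp: indicator_def)
  then have "t powr (a - q) * (\<integral>x. indicator (cball z R) x * norm (v x) powr q \<partial>lborel) \<le> t powr (a - q) * vI"
    by (rule mult_left_mono) simp
  moreover have "t > 0" using R by (simp add: t_def)
  then have "(\<integral>x. indicator (cball z R) x * norm (v x) powr a \<partial>lborel) \<le> t powr a * (vol * R powr d)
     + t powr (a - q) * (\<integral>x. indicator (cball z R) x * norm (v x) powr q \<partial>lborel)"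
    using moment_bound[of "cball z R" t a q] a unfolding measure_ball[OF R] by simp
  ultimately have "(\<integral>x. indicator (cball z R) x * norm (v x) powr a \<partial>lborel) \<le> t powr a * (vol * R powr d) + t powr (a - q) * vI"
    by linarith
  also have "\<dots> = (vol + vI) * R powr (d - a * (d - 1) / 3)"
    unfolding e2 using e1 by (simp add: algebra_simps)
  finally show ?thesis .
qed

text \<open>As on balls, but with the height lowered by the factor \<open>k powr (- 1 / q)\<close>
  to match the moment 1 / k that is available on the annulus. A moment of order \<open>a\<close>
  thus gains \<open>k powr (- a / q)\<close>.\<close>

lemma ann_moment:
  assumes k: "k \<ge> 1" "X k \<le> 1 / k" and a: "0 < a" "a \<le> q"
  shows "(\<integral>x. indicator (ann (2 ^ k)) x * norm (v x) powr a \<partial>lborel) \<le>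
    (2 powr d * vol + 1) * real k powr (- a / q) * (2 ^ k) powr (d - a * (d - 1) / 3)"
proof -
  define R :: real where "R = 2 ^ k"
  define e where "e = real k powr (- 1 / q)"
  define t where "t = e * R powr (- (d - 1) / 3)"
  have q0: "q > 0" using q_gt_3 by simp
  have R: "R > 0" by (simp add: R_def)
  have e: "e > 0" using k by (simp add: e_def)
  have ea: "e powr a = real k powr (- a / q)" by (simp add: e_def powr_powr)
  have eq: "e powr q = 1 / real k" using q0 k by (simp only: e_def powr_powr) (simp add: powr_minus_divide)
  have e1: "t powr a * R powr d = e powr a * R powr (d - a * (d - 1) / 3)"
    using e by (simp add: t_def powr_mult powr_powr mult.assoc flip: powr_add) (simp add: algebra_simps diff_divide_distrib)
  have ex: "(- (d - 1) / 3) * (a - q) = d - a * (d - 1) / 3"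
    using q_d by (simp add: algebra_simps diff_divide_distrib)
  have "t powr (a - q) = e powr (a - q) * R powr (d - a * (d - 1) / 3)"
    using e R by (simp only: t_def powr_mult powr_powr ex)
  then have e2: "t powr (a - q) * e powr q = e powr a * R powr (d - a * (d - 1) / 3)"
    using e by (simp add: powr_diff)
  have "measure lborel (ann R :: (real^'n) set) \<le> measure lborel (cball (0::real^'n) (2 * R))"
  proof (rule measure_mono_fmeasurable)
    show "ann R \<subseteq> cball (0::real^'n) (2 * R)" by (auto simp: ann_def)
    show "cball (0::real^'n) (2 * R) \<in> fmeasurable lborel" by (rule fmeasurable_compact) simp
  qed (use compact_ann borel_compact in auto)
  also have "\<dots> = 2 powr d * vol * R powr d" using R by (simp add: measure_ball powr_mult)
  finally have m: "measure lborel (ann R :: (real^'n) set) \<le> 2 powr d * vol * R powr d" .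
  have "t > 0" using R e by (simp add: t_def)
  from moment_bound[OF compact_ann this a, of R]
  have "(\<integral>x. indicator (ann R) x * norm (v x) powr a \<partial>lborel) \<le>
    t powr a * measure lborel (ann R :: (real^'n) set) + t powr (a - q) * X k"
    by (simp add: X_def R_def)
  also have "\<dots> \<le> t powr a * (2 powr d * vol * R powr d) + t powr (a - q) * e powr q"
    using m k eq by (intro add_mono mult_left_mono) auto
  also have "\<dots> = (2 powr d * vol + 1) * (t powr a * R powr d)"
    unfolding e2 e1[symmetric] by (simp add: algebra_simps)
  finally show ?thesis unfolding e1 ea by (simp add: R_def mult.assoc)
qed

text \<open>At scale l the kernel is of order l powr (- d) on a ball of radius 2 l, where the second
  moment of \<open>v\<close> is of order l powr (d - \<beta>) with \<beta> = 2 * (d - 1) / 3. This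
  leaves the decay l powr (- \<beta>), uniformly in x because the moment bound holds for every
  centre, and hence a geometric series.\<close>

lemma far_scales:
  obtains C where "C \<ge> 0" "\<And>R n x. R > 0 \<Longrightarrow>
    \<bar>conv (bump R) eff x - conv (bump (2 ^ n * R)) eff x\<bar> \<le> C * R powr (- 2 * (d - 1) / 3)"
proof -
  obtain c where c: "c > 0" "\<And>i j (z::real^'n). \<bar>pderiv i (dker 1 j) z\<bar> \<le> c"
    using pderiv_dker_bound by blast
  define \<beta> where "\<beta> = 2 * (d - 1) / 3"
  define C1 where "C1 = d\<^sup>2 * (c * M * ((vol + vI) * 2 powr (d - \<beta>)))"
  define \<rho> where "\<rho> = 2 powr (- \<beta>)"
  have M: "M \<ge> 0" using rho_nonneg[of 0] rho_le[of 0] by linarith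
  have \<beta>: "\<beta> > 0" using d_ge by (simp add: \<beta>_def)
  have \<rho>: "0 < \<rho>" "\<rho> < 1" using \<beta> by (auto simp: \<rho>_def powr_less_one)
  have C1: "C1 \<ge> 0" using c M vol_nonneg vI_nonneg by (simp add: C1_def)
  have step: "\<bar>conv (bump l) eff x - conv (bump (2 * l)) eff x\<bar> \<le> C1 * l powr (- \<beta>)" if l: "l > 0" for l x
  proof -
    have one: "\<bar>conv (pderiv i (dker l j)) (flux i j) x\<bar> \<le> c * M * ((vol + vI) * 2 powr (d - \<beta>)) * l powr (- \<beta>)" for i j
    proof -
      have "\<bar>conv (pderiv i (dker l j)) (flux i j) x\<bar> \<le> (\<integral>y. \<bar>pderiv i (dker l j) (x - y) * flux i j y\<bar> \<partial>lborel)"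
        unfolding conv_def by (rule integral_abs_bound)
      also have "\<dots> \<le> (\<integral>y. c / l ^ CARD('n) * M * (indicator (cball x (2 * l)) y * norm (v y) powr 2) \<partial>lborel)"
      proof (rule integral_mono)
        show "integrable lborel (\<lambda>y. \<bar>pderiv i (dker l j) (x - y) * flux i j y\<bar>)"
          by (intro integrable_abs continuous_kernel_integrable pderiv_dker_bcs l) simp
        show "integrable lborel (\<lambda>y. c / l ^ CARD('n) * M * (indicator (cball x (2 * l)) y * norm (v y) powr 2))"
          by (intro integrable_mult_right integrable_indicator_compact norm_powr_continuous) auto
        fix y
        show "\<bar>pderiv i (dker l j) (x - y) * flux i j y\<bar> \<le> c / l ^ CARD('n) * M * (indicator (cball x (2 * l)) y * norm (v y) powr 2)"
        proof (cases "norm (x - y) \<le> 2 * l")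
          case True
          have "\<bar>pderiv i (dker l j) (x - y)\<bar> \<le> c / l ^ CARD('n)"
            unfolding pderiv_dker_scale[OF l] using c(2) l by (simp add: divide_right_mono)
          moreover have "\<bar>flux i j y\<bar> \<le> M * norm (v y) powr 2"
          proof -
            have "\<bar>flux i j y\<bar> = rho y * (\<bar>v y $ i\<bar> * \<bar>v y $ j\<bar>)" using rho_nonneg by (simp add: flux_def abs_mult)
            also have "\<dots> \<le> M * (norm (v y) * norm (v y))"
              by (intro mult_mono component_le_norm_cart rho_le M mult_nonneg_nonneg) auto
            finally show ?thesis by (simp add: power2_eq_square)
          qed
          ultimately have "\<bar>pderiv i (dker l j) (x - y)\<bar> * \<bar>flux i j y\<bar> \<le> c / l ^ CARD('n) * (M * norm (v y) powr 2)"
            using c l by (intro mult_mono) auto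
          then show ?thesis using True by (simp add: abs_mult dist_norm mult.assoc)
        next
          case False
          then have "pderiv i (dker l j) (x - y) = 0" by (intro pderiv_dker_outside l) simp
          then show ?thesis using c l M by simp
        qed
      qed
      also have "\<dots> = c / l ^ CARD('n) * M * (\<integral>y. indicator (cball x (2 * l)) y * norm (v y) powr 2 \<partial>lborel)"
        by simp
      also have "\<dots> \<le> c / l ^ CARD('n) * M * ((vol + vI) * (2 * l) powr (d - 2 * (d - 1) / 3))"
        using c l M q_gt_3 by (intro mult_left_mono ball_moment) auto
      also have "\<dots> = c * M * ((vol + vI) * 2 powr (d - \<beta>)) * l powr (- \<beta>)"
      proof -
        have ex: "d - 2 * (d - 1) / 3 = d - \<beta>" by (simp add: \<beta>_def)
        have "(2 * l) powr (d - \<beta>) = 2 powr (d - \<beta>) * (l powr d * l powr (- \<beta>))"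
          using l by (simp only: powr_mult powr_add[symmetric]) simp
        also have "l powr d = l ^ CARD('n)" using l by (simp add: d_def powr_realpow)
        finally have p: "(2 * l) powr (d - \<beta>) = 2 powr (d - \<beta>) * (l ^ CARD('n) * l powr (- \<beta>))" .
        show ?thesis unfolding ex p using l by simp
      qed
      finally show ?thesis .
    qed
    have "\<bar>conv (bump l) eff x - conv (bump (2 * l)) eff x\<bar> \<le>
      (\<Sum>j\<in>UNIV. \<Sum>i\<in>UNIV. \<bar>conv (pderiv i (dker l j)) (flux i j) x\<bar>)"
      unfolding eff_step_flux[OF l] abs_minus_cancel by (rule order_trans[OF sum_abs]) (intro sum_mono sum_abs)
    also have "\<dots> \<le> (\<Sum>j\<in>(UNIV::'n set). \<Sum>i\<in>(UNIV::'n set). c * M * ((vol + vI) * 2 powr (d - \<beta>)) * l powr (- \<beta>))"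
      by (intro sum_mono one)
    also have "\<dots> = C1 * l powr (- \<beta>)" by (simp add: C1_def d_def power2_eq_square)
    finally show ?thesis .
  qed
  show ?thesis
  proof (rule that[of "C1 / (1 - \<rho>)"])
    show "C1 / (1 - \<rho>) \<ge> 0" using C1 \<rho> by simp
    fix R n x assume R: "(R::real) > 0"
    have "\<bar>conv (bump R) eff x - conv (bump (2 ^ n * R)) eff x\<bar> \<le> (\<Sum>m<n. C1 * (2 ^ m * R) powr (- \<beta>))"
      unfolding eff_telescope by (rule order_trans[OF sum_abs]) (intro sum_mono step, use R in simp)
    also have "\<dots> = C1 * R powr (- \<beta>) * (\<Sum>m<n. \<rho> ^ m)"
    proof -
      have "(2 ^ m * R) powr (- \<beta>) = \<rho> ^ m * R powr (- \<beta>)" for m :: nat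
        using R by (simp add: powr_mult \<rho>_def powr_power flip: powr_realpow) (simp add: powr_powr mult.commute)
      then show ?thesis by (simp add: sum_distrib_left mult_ac)
    qed
    also have "\<dots> \<le> C1 * R powr (- \<beta>) * (1 / (1 - \<rho>))"
    proof -
      have "(\<Sum>m<n. \<rho> ^ m) = (1 - \<rho> ^ n) / (1 - \<rho>)" using \<rho> by (simp add: sum_gp_strict)
      also have "\<dots> \<le> 1 / (1 - \<rho>)" using \<rho> by (intro divide_right_mono) auto
      finally show ?thesis using C1 by (intro mult_left_mono) auto
    qed
    finally show "\<bar>conv (bump R) eff x - conv (bump (2 ^ n * R)) eff x\<bar> \<le> C1 / (1 - \<rho>) * R powr (- 2 * (d - 1) / 3)"
    proof -
      have "- 2 * (d - 1) / 3 = - \<beta>" by (simp add: \<beta>_def field_simps)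
      moreover assume "\<bar>conv (bump R) eff x - conv (bump (2 ^ n * R)) eff x\<bar> \<le> C1 * R powr (- \<beta>) * (1 / (1 - \<rho>))"
      ultimately show ?thesis by (simp add: mult_ac)
    qed
  qed
qed

text \<open>The slow part of norm v / R on the annulus, the weight against which the oscillation of
  the pressure is integrated. The truncation makes it at most 1 / R, as the \<open>L1\<close> bound
  on small scales requires; where the speed exceeds 1 it is dominated by its q-th power.\<close>

definition g :: "nat \<Rightarrow> real^'n \<Rightarrow> real" where
  "g k x = indicator (ann (2 ^ k)) x * norm (v x) * (if norm (v x) \<le> 1 then 1 else 0) * (1 / 2 ^ k)"

lemma v_measurable [measurable]: "v \<in> borel_measurable borel"
  by (rule borel_measurable_continuous_onI) simp

lemma g_bcs: "bcs (g k)"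
proof -
  have "bcs (\<lambda>x. indicator (ann (2 ^ k)) x * norm (v x))"
    by (intro continuous_indicator_bcs compact_ann continuous_intros) simp
  then have "bcs (\<lambda>x. (indicator (ann (2 ^ k)) x * norm (v x)) * (if norm (v x) \<le> 1 then 1 else 0))"
    by (rule bcs_mult_bounded[where C=1]) auto
  from bcs_const_mult[OF this, of "1 / 2 ^ k"] show ?thesis
    by (simp add: g_def[abs_def] mult_ac)
qed

lemma g_nonneg: "g k x \<ge> 0"
  by (simp add: g_def)

lemma g_le: "g k x \<le> indicator (ann (2 ^ k)) x * norm (v x) / 2 ^ k"
  and g_le': "g k x \<le> indicator (ann (2 ^ k)) x / 2 ^ k"
  by (auto simp: g_def indicator_def divide_right_mono)

lemma g_outside: "norm x > 2 * 2 ^ k \<Longrightarrow> g k x = 0"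
  by (simp add: g_def ann_def)

lemma g_powr_integral:
  assumes a: "1 \<le> a" "a \<le> q"
  shows "(\<integral>x. g k x powr a \<partial>lborel) \<le> (\<integral>x. indicator (ann (2 ^ k)) x * norm (v x) powr a \<partial>lborel) * (2 ^ k) powr (- a)"
proof -
  have "(\<integral>x. g k x powr a \<partial>lborel) \<le> (\<integral>x. (indicator (ann (2 ^ k)) x * norm (v x) powr a) * (2 ^ k) powr (- a) \<partial>lborel)"
  proof (rule integral_mono)
    show "integrable lborel (\<lambda>x. g k x powr a)"
      using bcs_integrable[OF bcs_abs_powr[OF g_bcs, of a k]] a g_nonneg by simp
    show "integrable lborel (\<lambda>x. (indicator (ann (2 ^ k)) x * norm (v x) powr a) * (2 ^ k) powr (- a))"
      using a by (intro integrable_mult_left integrable_indicator_compact norm_powr_continuous compact_ann) auto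
    fix x
    have "g k x powr a \<le> (indicator (ann (2 ^ k)) x * norm (v x) / 2 ^ k) powr a"
      using a by (intro powr_mono2 g_le g_nonneg) auto
    also have "\<dots> = (indicator (ann (2 ^ k)) x * norm (v x) powr a) * (2 ^ k) powr (- a)"
      using a by (simp add: indicator_def powr_divide powr_minus_divide)
    finally show "g k x powr a \<le> (indicator (ann (2 ^ k)) x * norm (v x) powr a) * (2 ^ k) powr (- a)" .
  qed
  then show ?thesis by simp
qed

definition Pm :: real where "Pm = A * M powr gamma"

lemma press_bounds: "0 \<le> press x" "press x \<le> Pm"
  using A gam rho_nonneg[of x] rho_le[of x] by (auto simp: press_def Pm_def intro!: powr_mono2)

lemma M_nonneg: "M \<ge> 0" using rho_nonneg[of 0] rho_le[of 0] by linarith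

lemma Pm_nonneg: "Pm \<ge> 0" using press_bounds[of 0] by linarith

section \<open>Polynomial growth of the energy and of the force\<close>

lemma ball_moment_crude:
  assumes R: "R \<ge> 1" and a: "0 < a" "a \<le> q"
  shows "(\<integral>x. indicator (cball z R) x * norm (v x) powr a \<partial>lborel) \<le> (vol + vI) * R powr d"
proof -
  have "R powr (d - a * (d - 1) / 3) \<le> R powr d"
    using R a d_ge by (intro powr_mono) auto
  then have "(vol + vI) * R powr (d - a * (d - 1) / 3) \<le> (vol + vI) * R powr d"
    using vol_nonneg vI_nonneg by (intro mult_left_mono) auto
  moreover have "R > 0" using R by simp
  ultimately show ?thesis using ball_moment[of R a z] a by linarith
qed

lemma ann_moment_crude:
  assumes R: "R \<ge> 1" and a: "0 < a" "a \<le> q"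
  shows "(\<integral>x. indicator (ann R) x * norm (v x) powr a \<partial>lborel) \<le> (vol + vI) * 2 powr d * R powr d"
proof -
  have "(\<integral>x. indicator (ann R) x * norm (v x) powr a \<partial>lborel) \<le> (\<integral>x. indicator (cball 0 (2 * R)) x * norm (v x) powr a \<partial>lborel)"
    using a by (intro integral_mono integrable_indicator_compact norm_powr_continuous compact_ann)
      (auto simp: indicator_def ann_def)
  also have "\<dots> \<le> (vol + vI) * (2 * R) powr d" using R a by (intro ball_moment_crude) auto
  finally show ?thesis using R by (simp add: powr_mult mult_ac)
qed

lemma norm_power_eq: "norm (v x) ^ 3 = norm (v x) powr 3" "(norm (v x))\<^sup>2 = norm (v x) powr 2" "norm (v x) = norm (v x) powr 1"
  by auto

text \<open>\<open>P0 = 0\<close> and the crude bound R powr d for each annular integral are enough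
  for a polynomial rate. The exponent d obtained here fixes the threshold R powr (- d) below which
  scales are estimated through the force.\<close>

lemma energy_growth:
  obtains C where "C \<ge> 0" "\<And>R. R \<ge> 1 \<Longrightarrow> (\<integral>x. indicator (cball 0 R) x * gradsq x \<partial>lborel) \<le> C * R powr d"
proof -
  obtain C where C: "C > 0" "\<And>R P0. R > 0 \<Longrightarrow> P0 \<ge> 0 \<Longrightarrow> (\<integral>x. indicator (cball 0 R) x * gradsq x \<partial>lborel) \<le>
      C * ((\<integral>x. indicator (ann R) x * norm (v x) ^ 3 \<partial>lborel) / R
         + (\<integral>x. indicator (ann R) x * (\<bar>press x - P0\<bar> * norm (v x)) \<partial>lborel) / R
         + (\<integral>x. indicator (ann R) x * (\<bar>divv x\<bar> * norm (v x)) \<partial>lborel) / R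
         + (\<integral>x. indicator (ann R) x * (norm (v x))\<^sup>2 \<partial>lborel) / R\<^sup>2)"
    using energy_estimate by blast
  define V where "V = (vol + vI) * 2 powr d"
  define DD where "DD = (\<integral>x. (divv x)\<^sup>2 \<partial>lborel)"
  have V: "V \<ge> 0" using vol_nonneg vI_nonneg by (simp add: V_def)
  have DD: "DD \<ge> 0" by (simp add: DD_def)
  show ?thesis
  proof (rule that[of "C * (V + Pm * V + (DD + V) + V)"])
    show "C * (V + Pm * V + (DD + V) + V) \<ge> 0" using C V DD Pm_nonneg by simp
    fix R :: real assume R: "R \<ge> 1"
    have Rd: "R powr d \<ge> 1" using R d_ge by (intro ge_one_powr_ge_zero) auto
    have div_le: "x / R \<le> x" "x / R\<^sup>2 \<le> x" if "x \<ge> 0" for x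
    proof -
      have "R\<^sup>2 \<ge> 1" using R by (rule one_le_power)
      then show "x / R \<le> x" "x / R\<^sup>2 \<le> x"
        using R that by (auto simp: divide_le_eq mult_le_cancel_left1)
    qed
    note am = ann_moment_crude[OF R, folded V_def]
    have c1: "continuous_on UNIV (\<lambda>x. norm (v x))" by (intro continuous_intros) simp
    have i1: "(\<integral>x. indicator (ann R) x * norm (v x) ^ 3 \<partial>lborel) \<le> V * R powr d"
      unfolding norm_power_eq(1) using am[of 3] q_gt_3 by simp
    have i4: "(\<integral>x. indicator (ann R) x * (norm (v x))\<^sup>2 \<partial>lborel) \<le> V * R powr d"
      unfolding norm_power_eq(2) using am[of 2] q_gt_3 by simp
    have i2: "(\<integral>x. indicator (ann R) x * (\<bar>press x - 0\<bar> * norm (v x)) \<partial>lborel) \<le> Pm * V * R powr d"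
    proof -
      have "(\<integral>x. indicator (ann R) x * (\<bar>press x - 0\<bar> * norm (v x)) \<partial>lborel) \<le> (\<integral>x. Pm * (indicator (ann R) x * norm (v x)) \<partial>lborel)"
      proof (rule integral_mono)
        show "integrable lborel (\<lambda>x. indicator (ann R) x * (\<bar>press x - 0\<bar> * norm (v x)))"
          by (intro integrable_indicator_compact compact_ann continuous_intros) auto
        show "integrable lborel (\<lambda>x. Pm * (indicator (ann R) x * norm (v x)))"
          by (intro integrable_mult_right integrable_indicator_compact compact_ann c1)
        show "indicator (ann R) x * (\<bar>press x - 0\<bar> * norm (v x)) \<le> Pm * (indicator (ann R) x * norm (v x))" for x
          using press_bounds[of x] by (auto simp: indicator_def intro: mult_right_mono)
      qed
      also have "\<dots> = Pm * (\<integral>x. indicator (ann R) x * norm (v x) powr 1 \<partial>lborel)" by simp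
      also have "\<dots> \<le> Pm * (V * R powr d)" using am[of 1] q_gt_3 Pm_nonneg by (intro mult_left_mono) auto
      finally show ?thesis by simp
    qed
    have i3: "(\<integral>x. indicator (ann R) x * (\<bar>divv x\<bar> * norm (v x)) \<partial>lborel) \<le> (DD + V) * R powr d"
    proof -
      have "(\<integral>x. indicator (ann R) x * (\<bar>divv x\<bar> * norm (v x)) \<partial>lborel) \<le>
        (\<integral>x. (divv x)\<^sup>2 + indicator (ann R) x * (norm (v x))\<^sup>2 \<partial>lborel)"
      proof (rule integral_mono)
        show "integrable lborel (\<lambda>x. indicator (ann R) x * (\<bar>divv x\<bar> * norm (v x)))"
          by (intro integrable_indicator_compact compact_ann continuous_intros) auto
        show "integrable lborel (\<lambda>x. (divv x)\<^sup>2 + indicator (ann R) x * (norm (v x))\<^sup>2)"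
          by (intro Bochner_Integration.integrable_add div_int integrable_indicator_compact compact_ann continuous_intros) auto
        show "indicator (ann R) x * (\<bar>divv x\<bar> * norm (v x)) \<le> (divv x)\<^sup>2 + indicator (ann R) x * (norm (v x))\<^sup>2" for x
          using mult_le_sum_squares[of "\<bar>divv x\<bar>" "norm (v x)"] by (auto simp: indicator_def)
      qed
      also have "\<dots> = DD + (\<integral>x. indicator (ann R) x * (norm (v x))\<^sup>2 \<partial>lborel)"
        unfolding DD_def by (intro Bochner_Integration.integral_add div_int integrable_indicator_compact compact_ann continuous_intros) auto
      also have "\<dots> \<le> DD * R powr d + V * R powr d"
        using i4 mult_left_mono[OF Rd DD] by simp
      finally show ?thesis by (simp add: algebra_simps)
    qed
    have nn: "(\<integral>x. indicator (ann R) x * norm (v x) ^ 3 \<partial>lborel) \<ge> 0"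
       "(\<integral>x. indicator (ann R) x * (\<bar>press x - 0\<bar> * norm (v x)) \<partial>lborel) \<ge> 0"
       "(\<integral>x. indicator (ann R) x * (\<bar>divv x\<bar> * norm (v x)) \<partial>lborel) \<ge> 0"
       "(\<integral>x. indicator (ann R) x * (norm (v x))\<^sup>2 \<partial>lborel) \<ge> 0"
      by (intro integral_nonneg_AE AE_I2; simp)+
    have "(\<integral>x. indicator (cball 0 R) x * gradsq x \<partial>lborel) \<le>
      C * (V * R powr d + Pm * V * R powr d + (DD + V) * R powr d + V * R powr d)"
    proof (rule order_trans[OF C(2)[of R 0]])
      show "R > 0" using R by simp
      show "C * ((\<integral>x. indicator (ann R) x * norm (v x) ^ 3 \<partial>lborel) / R
         + (\<integral>x. indicator (ann R) x * (\<bar>press x - 0\<bar> * norm (v x)) \<partial>lborel) / R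
         + (\<integral>x. indicator (ann R) x * (\<bar>divv x\<bar> * norm (v x)) \<partial>lborel) / R
         + (\<integral>x. indicator (ann R) x * (norm (v x))\<^sup>2 \<partial>lborel) / R\<^sup>2)
        \<le> C * (V * R powr d + Pm * V * R powr d + (DD + V) * R powr d + V * R powr d)"
        using C(1) div_le[OF nn(1)] div_le[OF nn(2)] div_le[OF nn(3)] div_le[OF nn(4)] i1 i2 i3 i4
        by (intro mult_left_mono add_mono) linarith+
    qed simp
    then show "(\<integral>x. indicator (cball 0 R) x * gradsq x \<partial>lborel) \<le> C * (V + Pm * V + (DD + V) + V) * R powr d"
      by (simp add: algebra_simps)
  qed
qed

text \<open>The product of the velocity and its gradient is split into the second moment and the
  Dirichlet energy, both growing at most like R powr d.\<close>

lemma force_growth: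
  obtains C where "C \<ge> 0" "\<And>R j. R \<ge> 1 \<Longrightarrow> (\<integral>x. indicator (cball 0 R) x * \<bar>force j x\<bar> \<partial>lborel) \<le> C * R powr d"
proof -
  obtain C where C: "C \<ge> 0" "\<And>R. R \<ge> 1 \<Longrightarrow> (\<integral>x. indicator (cball 0 R) x * gradsq x \<partial>lborel) \<le> C * R powr d"
    using energy_growth by blast
  show ?thesis
  proof (rule that[of "M * (d * (vol + vI) + C)"])
    show "M * (d * (vol + vI) + C) \<ge> 0" using C M_nonneg vol_nonneg vI_nonneg d_ge by simp
    fix R :: real and j assume R: "R \<ge> 1"
    have i1: "integrable lborel (\<lambda>x. indicator (cball 0 R) x * (norm (v x))\<^sup>2)"
      by (intro integrable_indicator_compact continuous_intros) auto
    have i2: "integrable lborel (\<lambda>x. indicator (cball 0 R) x * gradsq x)"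
      by (intro integrable_indicator_compact gradsq_continuous) auto
    have "(\<integral>x. indicator (cball 0 R) x * \<bar>force j x\<bar> \<partial>lborel) \<le>
      (\<integral>x. M * (d * (indicator (cball 0 R) x * (norm (v x))\<^sup>2) + indicator (cball 0 R) x * gradsq x) \<partial>lborel)"
    proof (rule integral_mono)
      show "integrable lborel (\<lambda>x. indicator (cball 0 R) x * \<bar>force j x\<bar>)"
        by (intro integrable_indicator_compact continuous_intros force_continuous) auto
      show "integrable lborel (\<lambda>x. M * (d * (indicator (cball 0 R) x * (norm (v x))\<^sup>2) + indicator (cball 0 R) x * gradsq x))"
        by (intro integrable_mult_right Bochner_Integration.integrable_add i1 i2)
      fix x
      have "\<bar>force j x\<bar> \<le> (\<Sum>i\<in>UNIV. M * ((norm (v x))\<^sup>2 + (dv i j x)\<^sup>2))"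
        unfolding force_def
      proof (rule order_trans[OF sum_abs], rule sum_mono)
        fix i
        have "\<bar>rho x * v x $ i * dv i j x\<bar> = rho x * (\<bar>v x $ i\<bar> * \<bar>dv i j x\<bar>)"
          using rho_nonneg[of x] by (simp add: abs_mult)
        also have "\<dots> \<le> M * (norm (v x) * \<bar>dv i j x\<bar>)"
          using rho_le[of x] M_nonneg by (intro mult_mono component_le_norm_cart) auto
        also have "\<dots> \<le> M * ((norm (v x))\<^sup>2 + (dv i j x)\<^sup>2)"
          using mult_le_sum_squares[of "norm (v x)" "\<bar>dv i j x\<bar>"] M_nonneg
          by (intro mult_left_mono) auto
        finally show "\<bar>rho x * v x $ i * dv i j x\<bar> \<le> M * ((norm (v x))\<^sup>2 + (dv i j x)\<^sup>2)" .
      qed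
      also have "\<dots> = M * (d * (norm (v x))\<^sup>2 + (\<Sum>i\<in>UNIV. (dv i j x)\<^sup>2))"
        by (simp add: sum_distrib_left[symmetric] sum.distrib d_def)
      also have "\<dots> \<le> M * (d * (norm (v x))\<^sup>2 + gradsq x)"
        unfolding gradsq_def
        by (intro mult_left_mono add_left_mono sum_mono member_le_sum M_nonneg) auto
      finally show "indicator (cball 0 R) x * \<bar>force j x\<bar> \<le>
         M * (d * (indicator (cball 0 R) x * (norm (v x))\<^sup>2) + indicator (cball 0 R) x * gradsq x)"
        by (auto simp: indicator_def)
    qed
    also have "\<dots> = M * (d * (\<integral>x. indicator (cball 0 R) x * norm (v x) powr 2 \<partial>lborel) + (\<integral>x. indicator (cball 0 R) x * gradsq x \<partial>lborel))"
      using i1 i2 by simp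
    also have "\<dots> \<le> M * (d * ((vol + vI) * R powr d) + C * R powr d)"
      using C(2)[OF R] ball_moment_crude[OF R, of 2 0] M_nonneg d_ge q_gt_3
      by (intro mult_left_mono add_mono) auto
    finally show "(\<integral>x. indicator (cball 0 R) x * \<bar>force j x\<bar> \<partial>lborel) \<le> M * (d * (vol + vI) + C) * R powr d"
      by (simp add: algebra_simps)
  qed
qed

end

subsection \<open>The pressure term\<close>

lemma pderiv_dker_L1_bound:
  obtains c where "c > 0" "\<And>i j. (\<integral>x. \<bar>pderiv i (dker 1 j) (x::real^'n::finite)\<bar> \<partial>lborel) \<le> c"
proof -
  define c where "c i j = (\<integral>x. \<bar>pderiv i (dker 1 j) (x::real^'n)\<bar> \<partial>lborel)" for i j
  have c0: "c i j \<ge> 0" for i j unfolding c_def by (rule integral_nonneg_AE) simp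
  have "c i j \<le> (\<Sum>i\<in>UNIV. \<Sum>j\<in>UNIV. c i j)" for i j
    by (rule order_trans[OF member_le_sum[where f="\<lambda>j. c i j" and i=j]
        member_le_sum[where f="\<lambda>i. \<Sum>j\<in>UNIV. c i j"]]) (auto simp: sum_nonneg c0)
  then have "c i j \<le> 1 + (\<Sum>i\<in>UNIV. \<Sum>j\<in>UNIV. c i j)" for i j by (simp add: add_increasing)
  moreover have "1 + (\<Sum>i\<in>UNIV. \<Sum>j\<in>UNIV. c i j) > 0" using sum_nonneg[of UNIV "\<lambda>i. \<Sum>j\<in>UNIV. c i j"] c0
    by (simp add: sum_nonneg add_pos_nonneg)
  ultimately show ?thesis using that unfolding c_def by blast
qed

text \<open>The convolution with a merely continuous \<open>f\<close> need not vanish at infinity;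
  the factor \<open>h\<close> localises it.\<close>

lemma bcs_mult_conv:
  fixes h :: "'a::euclidean_space \<Rightarrow> real"
  assumes h: "bcs h" and k: "bcs k" and f: "continuous_on UNIV f"
  shows "bcs (\<lambda>x. h x * conv k f x)"
proof -
  obtain A where A: "\<forall>x. norm x > A \<longrightarrow> h x = 0" using h by (auto simp: bcs_def csupp_def)
  obtain B where B: "\<forall>x. norm x > B \<longrightarrow> k x = 0" using k by (auto simp: bcs_def csupp_def)
  have "(\<lambda>x. h x * conv k f x) = (\<lambda>x. h x * conv k (\<lambda>y. indicator (cball 0 (B + A)) y * f y) x)"
  proof
    fix x
    show "h x * conv k f x = h x * conv k (\<lambda>y. indicator (cball 0 (B + A)) y * f y) x"
      using conv_localize[of B k x A "B + A" f] A B by (cases "norm x \<le> A") auto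
  qed
  moreover have "bcs (\<lambda>x. h x * conv k (\<lambda>y. indicator (cball 0 (B + A)) y * f y) x)"
    by (intro bcs_mult h bcs_conv k continuous_indicator_bcs f) simp
  ultimately show ?thesis by simp
qed

context decaying_flow
begin

text \<open>The condition \<open>k \<ge> 1\<close> excludes k = 0, where 1 / k is 0 by
  convention.\<close>

definition good :: "nat \<Rightarrow> bool" where "good k \<longleftrightarrow> k \<ge> 1 \<and> X k \<le> 1 / k"

section \<open>The three ranges of scales tested against the weight\<close>

lemma g_integrable_eff:
  assumes "l > 0" "l' > 0"
  shows "integrable lborel (\<lambda>x. g k x * \<bar>conv (bump l) eff x - conv (bump l') eff x\<bar>)"
proof -
  have "bcs (\<lambda>x. \<bar>g k x * conv (bump l) eff x - g k x * conv (bump l') eff x\<bar>)"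
    by (intro bcs_abs bcs_diff bcs_mult_conv g_bcs bump_bcs assms eff_continuous)
  moreover have "(\<lambda>x. \<bar>g k x * conv (bump l) eff x - g k x * conv (bump l') eff x\<bar>) =
     (\<lambda>x. g k x * \<bar>conv (bump l) eff x - conv (bump l') eff x\<bar>)"
    using g_nonneg by (simp add: right_diff_distrib[symmetric] abs_mult)
  ultimately show ?thesis by (simp add: bcs_integrable)
qed

text \<open>The upper end R powr (- d) of this range cancels the growth R powr d of the force, and
  the bound 1 / R on \<open>g\<close> is what remains. The estimate does not depend on
  \<open>n\<close>, so the lower end may be taken arbitrarily small.\<close>

lemma small_bound:
  obtains C where "C \<ge> 0" "\<And>k n l. l > 0 \<Longrightarrow> 2 ^ n * l = 1 / 2 ^ (CARD('n) * k) \<Longrightarrow>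
    (\<integral>x. g k x * \<bar>conv (bump l) eff x - conv (bump (2 ^ n * l)) eff x\<bar> \<partial>lborel) \<le> C / 2 ^ k"
proof -
  obtain C where C: "C \<ge> 0" "\<And>R j. R \<ge> 1 \<Longrightarrow> (\<integral>x. indicator (cball 0 R) x * \<bar>force j x\<bar> \<partial>lborel) \<le> C * R powr d"
    using force_growth by blast
  define K where "K = (\<Sum>j\<in>UNIV. (\<integral>x. \<bar>dker 1 j (x::real^'n)\<bar> \<partial>lborel) * (C * 3 powr d))"
  show ?thesis
  proof (rule that[of K])
    show "K \<ge> 0" unfolding K_def using C by (intro sum_nonneg mult_nonneg_nonneg) auto
    fix k n :: nat and l :: real assume l: "l > 0" "2 ^ n * l = 1 / 2 ^ (CARD('n) * k)"
    let ?F = "\<lambda>x. \<bar>conv (bump l) eff x - conv (bump (2 ^ n * l)) eff x\<bar>"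
    define R :: real where "R = 2 ^ k"
    have R: "R \<ge> 1" by (simp add: R_def)
    have Rd: "2 ^ n * l * R powr d = 1"
      unfolding l(2) d_def R_def by (simp add: powr_realpow power_mult mult.commute)
    have "1 / 2 ^ (CARD('n) * k) \<le> (1::real)" by simp
    then have lR: "2 ^ n * l \<le> R" using R l by linarith
    have "(\<integral>x. g k x * ?F x \<partial>lborel) \<le> (\<integral>x. (1 / R) * (indicator (cball 0 (2 * R)) x * ?F x) \<partial>lborel)"
    proof (rule integral_mono)
      show "integrable lborel (\<lambda>x. g k x * ?F x)" using l by (intro g_integrable_eff) auto
      have "bcs (indicator (cball 0 (2 * R)) :: real^'n \<Rightarrow> real)"
        using continuous_indicator_bcs[of "\<lambda>_. 1" "cball 0 (2*R)"] by simp
      then have "bcs (\<lambda>x. \<bar>indicator (cball 0 (2 * R)) x * conv (bump l) eff x - indicator (cball 0 (2 * R)) x * conv (bump (2 ^ n * l)) eff x\<bar>)"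
        using l by (intro bcs_abs bcs_diff bcs_mult_conv bump_bcs eff_continuous) auto
      moreover have "(\<lambda>x. \<bar>indicator (cball 0 (2 * R)) x * conv (bump l) eff x - indicator (cball 0 (2 * R)) x * conv (bump (2 ^ n * l)) eff x\<bar>)
        = (\<lambda>x. indicator (cball 0 (2 * R)) x * ?F x)"
        by (simp add: right_diff_distrib[symmetric] abs_mult)
      ultimately show "integrable lborel (\<lambda>x. (1 / R) * (indicator (cball 0 (2 * R)) x * ?F x))"
        by (intro integrable_mult_right bcs_integrable) simp
      fix x
      have "g k x \<le> indicator (ann R) x / R" using g_le' by (simp add: R_def)
      also have "\<dots> \<le> (1 / R) * indicator (cball 0 (2 * R)) x" using R by (auto simp: indicator_def ann_def)
      finally have "g k x \<le> (1 / R) * indicator (cball 0 (2 * R)) x" .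
      then have "g k x * ?F x \<le> ((1 / R) * indicator (cball 0 (2 * R)) x) * ?F x" by (rule mult_right_mono) simp
      then show "g k x * ?F x \<le> (1 / R) * (indicator (cball 0 (2 * R)) x * ?F x)" by (simp only: mult.assoc)
    qed
    also have "\<dots> = (1 / R) * (\<integral>x. indicator (cball 0 (2 * R)) x * ?F x \<partial>lborel)" by simp
    also have "\<dots> \<le> (1 / R) * (2 ^ n * l * (\<Sum>j\<in>UNIV. (\<integral>x. \<bar>dker 1 j x\<bar> \<partial>lborel) * (\<integral>x. indicator (cball 0 (3 * R)) x * \<bar>force j x\<bar> \<partial>lborel)))"
      using R by (intro mult_left_mono small_scales l lR) auto
    also have "\<dots> \<le> (1 / R) * (2 ^ n * l * (\<Sum>j\<in>UNIV. (\<integral>x. \<bar>dker 1 j (x::real^'n)\<bar> \<partial>lborel) * (C * (3 * R) powr d)))"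
      using R l by (intro mult_left_mono sum_mono C) auto
    also have "\<dots> = (1 / R) * (2 ^ n * l * R powr d) * K"
      using R by (simp add: K_def powr_mult sum_distrib_left sum_distrib_right mult_ac)
    finally show "(\<integral>x. g k x * ?F x \<partial>lborel) \<le> K / 2 ^ k" unfolding Rd by (simp add: R_def)
  qed
qed

text \<open>The decay R powr (- 2 * (d - 1) / 3) of the far scales cancels exactly against the
  growth of the integral of \<open>g\<close>; the gain k powr (- 1 / q) of a good annulus
  survives.\<close>

lemma far_bound:
  obtains C where "C \<ge> 0" "\<And>k n. good k \<Longrightarrow>
    (\<integral>x. g k x * \<bar>conv (bump (2 ^ k)) eff x - conv (bump (2 ^ n * 2 ^ k)) eff x\<bar> \<partial>lborel) \<le> C * k powr (- 1 / q)"
proof -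
  obtain C where C: "C \<ge> 0" "\<And>R n x. R > 0 \<Longrightarrow>
    \<bar>conv (bump R) eff x - conv (bump (2 ^ n * R)) eff x\<bar> \<le> C * R powr (- 2 * (d - 1) / 3)"
    using far_scales by blast
  show ?thesis
  proof (rule that[of "C * (2 powr d * vol + 1)"])
    show "C * (2 powr d * vol + 1) \<ge> 0" using C vol_nonneg by simp
    fix k n :: nat assume k: "good k"
    define R :: real where "R = 2 ^ k"
    have R: "R > 0" by (simp add: R_def)
    have gi: "integrable lborel (g k)" by (rule bcs_integrable[OF g_bcs])
    have "(\<integral>x. g k x \<partial>lborel) \<le> (\<integral>x. indicator (ann R) x * norm (v x) powr 1 \<partial>lborel) * R powr (- 1)"
      using g_powr_integral[of 1 k] q_gt_3 g_nonneg by (simp add: R_def)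
    also have "\<dots> \<le> ((2 powr d * vol + 1) * real k powr (- 1 / q) * R powr (d - 1 * (d - 1) / 3)) * R powr (- 1)"
      using ann_moment[of k 1] k q_gt_3 unfolding good_def R_def by (intro mult_right_mono) auto
    finally have G: "(\<integral>x. g k x \<partial>lborel) \<le> (2 powr d * vol + 1) * real k powr (- 1 / q) * (R powr (d - 1 * (d - 1) / 3) * R powr (- 1))"
      by (simp only: mult.assoc)
    have e: "R powr (- 2 * (d - 1) / 3) * (R powr (d - 1 * (d - 1) / 3) * R powr (- 1)) = 1"
    proof -
      have "- 2 * (d - 1) / 3 + (d - 1 * (d - 1) / 3 + - 1) = 0" by (simp add: field_simps)
      then show ?thesis using R by (simp only: powr_add[symmetric]) simp
    qed
    have "(\<integral>x. g k x * \<bar>conv (bump R) eff x - conv (bump (2 ^ n * R)) eff x\<bar> \<partial>lborel) \<le>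
      (\<integral>x. C * R powr (- 2 * (d - 1) / 3) * g k x \<partial>lborel)"
    proof (rule integral_mono)
      show "integrable lborel (\<lambda>x. g k x * \<bar>conv (bump R) eff x - conv (bump (2 ^ n * R)) eff x\<bar>)"
        using R by (intro g_integrable_eff) auto
      show "integrable lborel (\<lambda>x. C * R powr (- 2 * (d - 1) / 3) * g k x)" using gi by simp
      show "g k x * \<bar>conv (bump R) eff x - conv (bump (2 ^ n * R)) eff x\<bar> \<le> C * R powr (- 2 * (d - 1) / 3) * g k x" for x
        using mult_left_mono[OF C(2)[OF R, of x n] g_nonneg[of k x]] by (simp only: mult_ac)
    qed
    also have "\<dots> = C * R powr (- 2 * (d - 1) / 3) * (\<integral>x. g k x \<partial>lborel)" by simp
    also have "\<dots> \<le> C * R powr (- 2 * (d - 1) / 3) * ((2 powr d * vol + 1) * real k powr (- 1 / q) * (R powr (d - 1 * (d - 1) / 3) * R powr (- 1)))"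
      using C(1) G by (intro mult_left_mono) auto
    also have "\<dots> = C * (2 powr d * vol + 1) * real k powr (- 1 / q) * (R powr (- 2 * (d - 1) / 3) * (R powr (d - 1 * (d - 1) / 3) * R powr (- 1)))"
      by (simp only: mult_ac)
    finally show "(\<integral>x. g k x * \<bar>conv (bump (2 ^ k)) eff x - conv (bump (2 ^ n * 2 ^ k)) eff x\<bar> \<partial>lborel) \<le> C * (2 powr d * vol + 1) * k powr (- 1 / q)"
      unfolding e by (simp add: R_def)
  qed
qed

lemma flux_localized_moment:
  assumes R: "R > 0" and r: "r > 0" "2 * r \<le> q"
  shows "(\<integral>x. \<bar>indicator (cball 0 R) x * flux i j x\<bar> powr r \<partial>lborel) \<le> M powr r * ((vol + vI) * R powr (d - 2 * r * (d - 1) / 3))"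
proof -
  have "(\<integral>x. \<bar>indicator (cball 0 R) x * flux i j x\<bar> powr r \<partial>lborel) \<le>
    (\<integral>x. M powr r * (indicator (cball 0 R) x * norm (v x) powr (2 * r)) \<partial>lborel)"
  proof (rule integral_mono)
    show "integrable lborel (\<lambda>x. \<bar>indicator (cball 0 R) x * flux i j x\<bar> powr r)"
      using r by (intro bcs_integrable bcs_abs_powr continuous_indicator_bcs) auto
    show "integrable lborel (\<lambda>x. M powr r * (indicator (cball 0 R) x * norm (v x) powr (2 * r)))"
      using r by (intro integrable_mult_right integrable_indicator_compact norm_powr_continuous) auto
    fix x
    have "\<bar>flux i j x\<bar> = rho x * (\<bar>v x $ i\<bar> * \<bar>v x $ j\<bar>)" using rho_nonneg by (simp add: flux_def abs_mult)
    also have "\<dots> \<le> M * (norm (v x) * norm (v x))"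
      by (intro mult_mono component_le_norm_cart rho_le M_nonneg mult_nonneg_nonneg) auto
    finally have "\<bar>flux i j x\<bar> powr r \<le> (M * (norm (v x) * norm (v x))) powr r"
      using r by (intro powr_mono2) auto
    also have "\<dots> = M powr r * norm (v x) powr (2 * r)"
      using M_nonneg by (simp add: powr_mult powr_add[symmetric])
    finally show "\<bar>indicator (cball 0 R) x * flux i j x\<bar> powr r \<le> M powr r * (indicator (cball 0 R) x * norm (v x) powr (2 * r))"
      using r by (auto simp: indicator_def)
  qed
  also have "\<dots> = M powr r * (\<integral>x. indicator (cball 0 R) x * norm (v x) powr (2 * r) \<partial>lborel)" by simp
  also have "\<dots> \<le> M powr r * ((vol + vI) * R powr (d - 2 * r * (d - 1) / 3))"
    using R r by (intro mult_left_mono ball_moment) auto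
  finally show ?thesis .
qed

text \<open>The interpolation exponent \<open>r\<close> is chosen strictly between \<open>6 d / (4 d - 1)\<close> and \<open>q / 2\<close>, so that the
  loss \<open>k powr ((2 - r) / r)\<close> from the number of scales is smaller than the gain \<open>k powr (1 / q)\<close> on a good annulus.\<close>

lemma medium_bound:
  obtains C where "C \<ge> 0" "\<And>k l. good k \<Longrightarrow> l = 1 / 2 ^ (CARD('n) * k) \<Longrightarrow>
    (\<integral>x. g k x * \<bar>conv (bump l) eff x - conv (bump (2 ^ k)) eff x\<bar> \<partial>lborel) \<le>
      C * (k powr (- 1 / (8 * d - 3)) + k powr (- 1 / (4 * d + 3)))"
proof -
  obtain c where c: "c > 0" "\<And>i j. (\<integral>x. \<bar>pderiv i (dker 1 j) (x::real^'n)\<bar> \<partial>lborel) \<le> c"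
    using pderiv_dker_L1_bound by blast
  \<comment> \<open>With this form the admissible interval runs from 12 d / (8 d - 2) to 12 d / (8 d
    - 8).\<close>
  define r where "r = 12 * d / (8 * d - 3)"
  define r' where "r' = 12 * d / (4 * d + 3)"
  \<comment> \<open>The midpoint between the loss (2 - r) / r = (4 d - 6) / (12 d) and the gain 1 /
    q = (4 d - 4) / (12 d). As the power of \<open>k\<close> in Young's parameter it makes both
    terms decay.\<close>
  define \<alpha> where "\<alpha> = (4 * d - 5) / (12 * d)"
  have r: "1 < r" "r < 2" "2 * r \<le> q" using d_ge by (auto simp: r_def q_def field_simps)
  have r': "1 \<le> r'" "r' \<le> q" using d_ge by (auto simp: r'_def q_def field_simps)
  have "r - 1 = (4 * d + 3) / (8 * d - 3)" using d_ge by (simp add: r_def field_simps)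
  then have conj: "r' = r / (r - 1)" using d_ge by (simp add: r_def r'_def)
  have ex: "- \<alpha> * r + (2 - r) = - 1 / (8 * d - 3)" "\<alpha> * r' + - r' / q = - 1 / (4 * d + 3)"
    "- 5 / 12 * r + (d - 2 * r * (d - 1) / 3) = 0" "5 / 12 * r' + (d - r' * (d - 1) / 3) + - r' = 0"
  proof -
    have p: "d \<noteq> 0" "8 * d - 3 \<noteq> 0" "4 * d + 3 \<noteq> 0" "d - 1 \<noteq> 0" using d_ge by auto
    have "- \<alpha> * r = - (4 * d - 5) / (8 * d - 3)" using p by (simp add: \<alpha>_def r_def)
    moreover have "2 - r = (4 * d - 6) / (8 * d - 3)" using p by (simp add: r_def field_simps)
    ultimately show "- \<alpha> * r + (2 - r) = - 1 / (8 * d - 3)" by (simp add: add_divide_distrib[symmetric])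
    have "\<alpha> * r' = (4 * d - 5) / (4 * d + 3)" using p by (simp add: \<alpha>_def r'_def)
    moreover have "- r' / q = - (4 * d - 4) / (4 * d + 3)"
    proof -
      have "r' / q = (12 * d / q) / (4 * d + 3)" by (simp add: r'_def)
      also have "12 * d / q = 4 * d - 4" using p by (simp add: q_def)
      finally show ?thesis by (simp only: minus_divide_left[symmetric])
    qed
    ultimately show "\<alpha> * r' + - r' / q = - 1 / (4 * d + 3)" by (simp add: add_divide_distrib[symmetric])
    have "r * (8 * d - 3) = 12 * d" using p by (simp add: r_def)
    then show "- 5 / 12 * r + (d - 2 * r * (d - 1) / 3) = 0" by (simp add: field_simps)
    have "r' * (4 * d + 3) = 12 * d" using p by (simp add: r'_def)
    then show "5 / 12 * r' + (d - r' * (d - 1) / 3) + - r' = 0" by (simp add: field_simps)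
  qed
  define m where "m = bump_mass TYPE('n)"
  define K0 where "K0 = 2 powr r * ((4 * m\<^sup>2) * r / (2 - r) + r / (r - 1))"
  have K0: "K0 \<ge> 0" unfolding K0_def using r by (intro mult_nonneg_nonneg add_nonneg_nonneg divide_nonneg_nonneg) auto
  define C1 where "C1 = K0 * ((d + 1) * c) powr (2 - r) * (M powr r * ((vol + vI) * 4 powr (d - 2 * r * (d - 1) / 3)))"
  define C2 where "C2 = 2 powr d * vol + 1"
  have C1: "C1 \<ge> 0" unfolding C1_def using K0 vol_nonneg vI_nonneg by (intro mult_nonneg_nonneg add_nonneg_nonneg) auto
  have C2: "C2 \<ge> 0" using vol_nonneg by (simp add: C2_def)
  show ?thesis
  proof (rule that[of "d\<^sup>2 * (C1 + C2)"])
    show "d\<^sup>2 * (C1 + C2) \<ge> 0" using C1 C2 by simp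
    fix k :: nat and l :: real assume k: "good k" and l: "l = 1 / 2 ^ (CARD('n) * k)"
    have k1: "k \<ge> 1" "X k \<le> 1 / k" using k by (auto simp: good_def)
    then have k0: "real k > 0" by simp
    define R :: real where "R = 2 ^ k"
    \<comment> \<open>The number of dyadic steps from R powr (- d) up to R.\<close>
    define n where "n = (CARD('n) + 1) * k"
    have R: "R > 0" by (simp add: R_def)
    have l0: "l > 0" using l by simp
    have Rn: "R = 2 ^ n * l" by (simp add: R_def n_def l power_add)
    then have lR: "l \<le> R" using l0 by simp
    define N where "N = n * c"
    have "n > 0" using k1 by (simp add: n_def)
    then have N: "N > 0" using c by (simp add: N_def)
    have Nk: "N = (d + 1) * c * real k" by (simp add: N_def n_def d_def algebra_simps)
    define T where "T j i = conv (pderiv i (newton_diff l R j)) (\<lambda>y. indicator (cball 0 (4 * R)) y * flux i j y)" for i j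
    have wb: "bcs (\<lambda>y. indicator (cball 0 (4 * R)) y * flux i j y)" for i j
      by (intro continuous_indicator_bcs) auto
    have Tb: "bcs (T j i)" for i j unfolding T_def by (intro bcs_conv pderiv_newton_diff_bcs l0 lR wb)
    \<comment> \<open>For this \<open>r\<close> the power - 5 / 12 of \<open>R\<close> cancels all
      powers of \<open>R\<close> in both terms of Young's inequality, so only powers of
      \<open>k\<close> are left.\<close>
    define s where "s = real k powr (- \<alpha>) * R powr (- 5 / 12)"
    have s: "s > 0" using k0 R by (simp add: s_def)
    have one: "(\<integral>x. g k x * \<bar>T j i x\<bar> \<partial>lborel) \<le> C1 * k powr (- 1 / (8 * d - 3)) + C2 * k powr (- 1 / (4 * d + 3))" for i j
    proof -
      have Ti: "integrable lborel (\<lambda>x. \<bar>T j i x\<bar> powr r)" using r by (intro bcs_integrable bcs_abs_powr Tb) auto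
      have gi: "integrable lborel (\<lambda>x. g k x powr r')"
        using bcs_integrable[OF bcs_abs_powr[OF g_bcs, of r' k]] r' g_nonneg by simp
      have "(\<integral>x. g k x * \<bar>T j i x\<bar> \<partial>lborel) \<le> (\<integral>x. s powr r * \<bar>T j i x\<bar> powr r + s powr (- r') * g k x powr r' \<partial>lborel)"
      proof (rule integral_mono)
        show "integrable lborel (\<lambda>x. g k x * \<bar>T j i x\<bar>)" by (intro bcs_integrable bcs_mult bcs_abs g_bcs Tb)
        show "integrable lborel (\<lambda>x. s powr r * \<bar>T j i x\<bar> powr r + s powr (- r') * g k x powr r')"
          by (intro Bochner_Integration.integrable_add integrable_mult_right Ti gi)
        show "g k x * \<bar>T j i x\<bar> \<le> s powr r * \<bar>T j i x\<bar> powr r + s powr (- r') * g k x powr r'" for x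
          using young_powr[of "\<bar>T j i x\<bar>" "g k x" s r r'] s r conj g_nonneg by (simp add: mult.commute)
      qed
      also have "\<dots> = s powr r * (\<integral>x. \<bar>T j i x\<bar> powr r \<partial>lborel) + s powr (- r') * (\<integral>x. g k x powr r' \<partial>lborel)"
        using Ti gi by simp
      also have "\<dots> \<le> C1 * k powr (- 1 / (8 * d - 3)) + C2 * k powr (- 1 / (4 * d + 3))"
      proof (rule add_mono)
        have "(\<integral>x. \<bar>T j i x\<bar> powr r \<partial>lborel) \<le> K0 * N powr (2 - r) *
           (\<integral>x. \<bar>indicator (cball 0 (4 * R)) x * flux i j x\<bar> powr r \<partial>lborel)"
          unfolding K0_def T_def
        proof (rule conv_interpolation)
          show "bcs (pderiv i (newton_diff l R j))" by (intro pderiv_newton_diff_bcs l0 lR)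
          show "(\<integral>x. \<bar>pderiv i (newton_diff l R j) x\<bar> \<partial>lborel) \<le> N"
            unfolding Rn N_def
            by (rule order_trans[OF pderiv_newton_diff_L1[OF l0]]) (intro mult_left_mono c, simp)
          show "(\<integral>x. (conv (pderiv i (newton_diff l R j)) w x)\<^sup>2 \<partial>lborel) \<le> 4 * m\<^sup>2 * (\<integral>x. (w x)\<^sup>2 \<partial>lborel)"
            if "bcs w" for w
            using newton_diff_L2[OF l0 lR that] by (simp add: m_def)
        qed (use N r wb in auto)
        also have "\<dots> \<le> K0 * N powr (2 - r) * (M powr r * ((vol + vI) * (4 * R) powr (d - 2 * r * (d - 1) / 3)))"
          using R r K0 by (intro mult_left_mono flux_localized_moment mult_nonneg_nonneg) auto
        finally have "s powr r * (\<integral>x. \<bar>T j i x\<bar> powr r \<partial>lborel) \<le>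
          s powr r * (K0 * N powr (2 - r) * (M powr r * ((vol + vI) * (4 * R) powr (d - 2 * r * (d - 1) / 3))))"
          by (rule mult_left_mono) simp
        also have "\<dots> = C1 * (real k powr (- \<alpha> * r) * real k powr (2 - r)) * (R powr (- 5 / 12 * r) * R powr (d - 2 * r * (d - 1) / 3))"
          using R k0 c d_ge unfolding Nk C1_def s_def by (simp add: powr_mult powr_powr mult_ac)
        also have "real k powr (- \<alpha> * r) * real k powr (2 - r) = real k powr (- 1 / (8 * d - 3))"
        proof -
          show ?thesis by (simp only: powr_add[symmetric] ex)
        qed
        also have "R powr (- 5 / 12 * r) * R powr (d - 2 * r * (d - 1) / 3) = 1"
        proof -
          show ?thesis using R by (simp only: powr_add[symmetric] ex) simp
        qed
        finally show "s powr r * (\<integral>x. \<bar>T j i x\<bar> powr r \<partial>lborel) \<le> C1 * k powr (- 1 / (8 * d - 3))" by simp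
        have "(\<integral>x. g k x powr r' \<partial>lborel) \<le> (\<integral>x. indicator (ann R) x * norm (v x) powr r' \<partial>lborel) * R powr (- r')"
          using g_powr_integral[OF r'] by (simp add: R_def)
        also have "\<dots> \<le> (C2 * real k powr (- r' / q) * R powr (d - r' * (d - 1) / 3)) * R powr (- r')"
          using ann_moment[OF k1, of r'] r' unfolding C2_def R_def by (intro mult_right_mono) auto
        finally have "s powr (- r') * (\<integral>x. g k x powr r' \<partial>lborel) \<le>
           s powr (- r') * ((C2 * real k powr (- r' / q) * R powr (d - r' * (d - 1) / 3)) * R powr (- r'))"
          by (rule mult_left_mono) simp
        also have "\<dots> = C2 * (real k powr (\<alpha> * r') * real k powr (- r' / q)) * (R powr (5 / 12 * r') * R powr (d - r' * (d - 1) / 3) * R powr (- r'))"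
          using R k0 unfolding s_def by (simp add: powr_mult powr_powr mult_ac)
        also have "real k powr (\<alpha> * r') * real k powr (- r' / q) = real k powr (- 1 / (4 * d + 3))"
        proof -
          show ?thesis by (simp only: powr_add[symmetric] ex)
        qed
        also have "R powr (5 / 12 * r') * R powr (d - r' * (d - 1) / 3) * R powr (- r') = 1"
        proof -
          show ?thesis using R by (simp only: powr_add[symmetric] ex) simp
        qed
        finally show "s powr (- r') * (\<integral>x. g k x powr r' \<partial>lborel) \<le> C2 * k powr (- 1 / (4 * d + 3))" by simp
      qed
      finally show ?thesis .
    qed
    have int: "integrable lborel (\<lambda>x. g k x * \<bar>T j i x\<bar>)" for i j by (intro bcs_integrable bcs_mult bcs_abs g_bcs Tb)
    have "(\<integral>x. g k x * \<bar>conv (bump l) eff x - conv (bump R) eff x\<bar> \<partial>lborel) \<le>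
      (\<integral>x. (\<Sum>j\<in>UNIV. \<Sum>i\<in>UNIV. g k x * \<bar>T j i x\<bar>) \<partial>lborel)"
    proof (rule integral_mono)
      show "integrable lborel (\<lambda>x. g k x * \<bar>conv (bump l) eff x - conv (bump R) eff x\<bar>)"
        by (intro g_integrable_eff l0 R)
      show "integrable lborel (\<lambda>x. \<Sum>j\<in>UNIV. \<Sum>i\<in>UNIV. g k x * \<bar>T j i x\<bar>)"
        by (intro Bochner_Integration.integrable_sum int)
      fix x
      show "g k x * \<bar>conv (bump l) eff x - conv (bump R) eff x\<bar> \<le> (\<Sum>j\<in>UNIV. \<Sum>i\<in>UNIV. g k x * \<bar>T j i x\<bar>)"
      proof (cases "norm x \<le> 2 * R")
        case True
        from mult_left_mono[OF medium_scales[OF l0 Rn True] g_nonneg[of k x]] show ?thesis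
          by (simp add: T_def sum_distrib_left)
      next
        case False
        then have "g k x = 0" using g_outside[of k x] by (simp add: R_def)
        then show ?thesis by simp
      qed
    qed
    also have "\<dots> = (\<Sum>j\<in>UNIV. \<Sum>i\<in>UNIV. \<integral>x. g k x * \<bar>T j i x\<bar> \<partial>lborel)"
      using int by (simp add: Bochner_Integration.integral_sum)
    also have "\<dots> \<le> (\<Sum>j\<in>(UNIV::'n set). \<Sum>i\<in>(UNIV::'n set). C1 * k powr (- 1 / (8 * d - 3)) + C2 * k powr (- 1 / (4 * d + 3)))"
      by (intro sum_mono one)
    also have "\<dots> = d\<^sup>2 * (C1 * k powr (- 1 / (8 * d - 3)) + C2 * k powr (- 1 / (4 * d + 3)))"
      by (simp add: d_def power2_eq_square)
    also have "\<dots> \<le> d\<^sup>2 * ((C1 + C2) * (k powr (- 1 / (8 * d - 3)) + k powr (- 1 / (4 * d + 3))))"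
    proof (rule mult_left_mono)
      have "a * x + b * y \<le> (a + b) * (x + y)" if "a \<ge> 0" "b \<ge> 0" "x \<ge> 0" "y \<ge> 0" for a b x y :: real
        using that mult_nonneg_nonneg[of a y] mult_nonneg_nonneg[of b x] by (simp add: algebra_simps)
      then show "C1 * k powr (- 1 / (8 * d - 3)) + C2 * k powr (- 1 / (4 * d + 3)) \<le> (C1 + C2) * (k powr (- 1 / (8 * d - 3)) + k powr (- 1 / (4 * d + 3)))"
        using C1 C2 by simp
    qed simp
    finally show "(\<integral>x. g k x * \<bar>conv (bump l) eff x - conv (bump (2 ^ k)) eff x\<bar> \<partial>lborel) \<le>
      d\<^sup>2 * (C1 + C2) * (k powr (- 1 / (8 * d - 3)) + k powr (- 1 / (4 * d + 3)))"
      by (simp only: R_def mult.assoc)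
  qed
qed

end

subsection \<open>Vanishing of the energy\<close>

lemma bcs_mult_continuous:
  fixes h f :: "'a::euclidean_space \<Rightarrow> real"
  assumes h: "bcs h" and f: "continuous_on UNIV f"
  shows "bcs (\<lambda>x. h x * f x)"
proof -
  obtain A where A: "\<forall>x. norm x > A \<longrightarrow> h x = 0" using h by (auto simp: bcs_def csupp_def)
  have "(\<lambda>x. h x * f x) = (\<lambda>x. h x * (indicator (cball 0 A) x * f x))"
    using A by (auto simp: indicator_def fun_eq_iff)
  moreover have "bcs (\<lambda>x. h x * (indicator (cball 0 A) x * f x))"
    by (intro bcs_mult h continuous_indicator_bcs f) simp
  ultimately show ?thesis by simp
qed

context decaying_flow
begin

definition kap :: real where "kap = 2 * mu + lambda"
text \<open>In this order: the error of the small scales, of the far scales, the two terms of the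
  middle range, and the accuracy prescribed at both ends of the chain of scales. The first one also
  pays for the region where the speed exceeds 1.\<close>

definition err :: "nat \<Rightarrow> real" where
  "err k = 1 / 2 ^ k + k powr (- 1 / q) + (k powr (- 1 / (8 * d - 3)) + k powr (- 1 / (4 * d + 3))) + 1 / k"

lemma kap_pos: "kap > 0" using lam mu by (simp add: kap_def)

lemma err_nonneg: "err k \<ge> 0" by (simp add: err_def)

lemma conv_eff: "l > 0 \<Longrightarrow> conv (bump l) eff x = conv (bump l) press x - kap * conv (bump l) divv x"
proof -
  assume l: "l > 0"
  have "conv (bump l) eff x = (\<integral>y. bump l (x - y) * press y - kap * (bump l (x - y) * divv y) \<partial>lborel)"
    unfolding conv_def eff_def kap_def by (rule Bochner_Integration.integral_cong) (auto simp: algebra_simps)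
  also have "\<dots> = conv (bump l) press x - kap * conv (bump l) divv x"
    unfolding conv_def
    using continuous_kernel_integrable[OF bump_bcs[OF l] C1_continuous[OF press_C1], of x]
      continuous_kernel_integrable[OF bump_bcs[OF l] C1_continuous[OF divv_C1], of x]
    by (subst Bochner_Integration.integral_diff) auto
  finally show ?thesis .
qed

text \<open>The deviation of the pressure from \<open>P0\<close> is telescoped through averages of
  \<open>eff\<close> from a tiny scale \<open>l1\<close> up to a huge scale \<open>R2\<close>.
  \<open>P0\<close> is the normalised pressure average at scale \<open>R2\<close> around the origin
  and so depends on \<open>k\<close>. The divergence enters at both ends; it is only in
  \<open>L2\<close> and is paired with \<open>g\<close> through the free parameter
  \<open>\<delta>\<close>.\<close>

lemma pressure_bound:
  obtains C where "C \<ge> 0" "\<And>k \<delta>. good k \<Longrightarrow> \<delta> > 0 \<Longrightarrow> \<exists>P0\<ge>0.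
    (\<integral>x. indicator (ann (2 ^ k)) x * (\<bar>press x - P0\<bar> * norm (v x)) \<partial>lborel) / 2 ^ k \<le>
    C * (err k + \<delta> + (\<integral>x. (g k x)\<^sup>2 \<partial>lborel) / \<delta>)"
proof -
  obtain Cs where Cs: "Cs \<ge> 0" "\<And>k n l. l > 0 \<Longrightarrow> 2 ^ n * l = 1 / 2 ^ (CARD('n) * k) \<Longrightarrow>
    (\<integral>x. g k x * \<bar>conv (bump l) eff x - conv (bump (2 ^ n * l)) eff x\<bar> \<partial>lborel) \<le> Cs / 2 ^ k"
    using small_bound by blast
  obtain Cm where Cm: "Cm \<ge> 0" "\<And>k l. good k \<Longrightarrow> l = 1 / 2 ^ (CARD('n) * k) \<Longrightarrow>
    (\<integral>x. g k x * \<bar>conv (bump l) eff x - conv (bump (2 ^ k)) eff x\<bar> \<partial>lborel) \<le>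
      Cm * (k powr (- 1 / (8 * d - 3)) + k powr (- 1 / (4 * d + 3)))"
    using medium_bound by blast
  obtain Cf where Cf: "Cf \<ge> 0" "\<And>k n. good k \<Longrightarrow>
    (\<integral>x. g k x * \<bar>conv (bump (2 ^ k)) eff x - conv (bump (2 ^ n * 2 ^ k)) eff x\<bar> \<partial>lborel) \<le> Cf * k powr (- 1 / q)"
    using far_bound by blast
  define m where "m = bump_mass TYPE('n)"
  have m: "m > 0" unfolding m_def by (rule bump_mass_pos)
  define L where "L = 5 * (CARD('n) + (CARD('n))\<^sup>2 / 2) * unit_ball_vol CARD('n) * 2 ^ CARD('n) * Pm"
  have L: "L \<ge> 0" using Pm_nonneg by (simp add: L_def)
  define DD where "DD = (\<integral>x. (divv x)\<^sup>2 \<partial>lborel)"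
  have DD: "DD \<ge> 0" by (simp add: DD_def)
  define C where "C = ((1 + 2 * L) + Cs + Cm + Cf + kap * m * (DD + 1) + kap * (m\<^sup>2 * DD + 1)) / m + Pm * vI"
  have C: "C \<ge> 0" unfolding C_def using m L DD Cs Cm Cf kap_pos Pm_nonneg vI_nonneg by simp
  show ?thesis
  proof (rule that[OF C])
    fix k :: nat and \<delta> :: real assume k: "good k" and \<delta>: "\<delta> > 0"
    have k1: "k \<ge> 1" "X k \<le> 1 / k" using k by (auto simp: good_def)
    define R :: real where "R = 2 ^ k"
    have R: "R > 0" by (simp add: R_def)
    define l :: real where "l = 1 / 2 ^ (CARD('n) * k)"
    have l: "l > 0" by (simp add: l_def)
    define Gi where "Gi = (\<integral>x. g k x \<partial>lborel)"
    have Gi: "Gi \<ge> 0" unfolding Gi_def by (intro integral_nonneg_AE AE_I2 g_nonneg)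
    define G2 where "G2 = (\<integral>x. (g k x)\<^sup>2 \<partial>lborel)"
    have G2: "G2 \<ge> 0" by (simp add: G2_def)
    \<comment> \<open>Accuracy for both ends of the chain, fixed before the scales \<open>l1\<close>
      and \<open>R2\<close> are chosen. Its product with the integral of \<open>g k\<close> is at
      most 1 / k.\<close>
    define e0 where "e0 = 1 / (real k * (1 + Gi))"
    have e0: "e0 > 0" using k1 Gi by (auto simp: e0_def intro!: divide_pos_pos mult_pos_pos)
    have e0G: "e0 * Gi \<le> 1 / k"
    proof -
      have "e0 * Gi = (1 / k) * (Gi / (1 + Gi))" by (simp add: e0_def)
      also have "\<dots> \<le> (1 / k) * 1" using Gi by (intro mult_left_mono) auto
      finally show ?thesis by simp
    qed
    obtain l0 where l0: "l0 > 0" "\<And>l x. 0 < l \<Longrightarrow> l < l0 \<Longrightarrow> norm x \<le> 2 * R \<Longrightarrow>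
      \<bar>(\<integral>y. bump l (x - y) * eff y \<partial>lborel) - bump_mass TYPE('n) * eff x\<bar> \<le> e0"
      using bump_average_limit[OF eff_continuous e0, of "2 * R"] R by auto
    \<comment> \<open>Descend dyadically from \<open>l\<close> until the averages of
      \<open>eff\<close> are within \<open>e0\<close> of their limit on the whole ball. The bound
      for small scales does not see the number of steps.\<close>
    obtain n1 where n1: "(1 / 2) ^ n1 < l0 / l" using real_arch_pow_inv[of "l0 / l" "1 / 2"] l0 l by auto
    define l1 where "l1 = l / 2 ^ n1"
    have l1: "l1 > 0" "l1 < l0" "2 ^ n1 * l1 = l"
      using n1 l by (auto simp: l1_def field_simps power_divide)
    \<comment> \<open>Ascend until the radius 2 R is so small against \<open>R2\<close> that the
      pressure averages on that ball are constant up to a multiple of \<open>e0\<close>. The bound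
      for far scales does not see the number of steps either.\<close>
    obtain n2 where n2: "(1 / 2) ^ n2 < min e0 (1 / 2)" using real_arch_pow_inv[of "min e0 (1 / 2)" "1 / 2"] e0 by auto
    define R2 where "R2 = 2 ^ n2 * R"
    have R2: "R2 > 0" using R by (simp add: R2_def)
    have n2': "2 * R \<le> R2" "2 * R / R2 \<le> 2 * e0"
      using n2 R by (auto simp: R2_def field_simps power_divide)
    define P0 where "P0 = conv (bump R2) press 0 / m"
    have pb: "0 \<le> conv (bump R2) press 0" "conv (bump R2) press 0 \<le> Pm * m"
    proof -
      have i: "integrable lborel (\<lambda>y::real^'n. bump R2 (0 - y))"
        by (rule bcs_integrable[OF bcs_minus_shift[OF bump_bcs[OF R2]]])
      show "0 \<le> conv (bump R2) press 0" unfolding conv_def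
        by (intro integral_nonneg_AE AE_I2 mult_nonneg_nonneg bump_nonneg R2 press_bounds)
      have "conv (bump R2) press 0 \<le> (\<integral>y. bump R2 (0 - y :: real^'n) * Pm \<partial>lborel)" unfolding conv_def
      proof (rule integral_mono)
        show "integrable lborel (\<lambda>y. bump R2 (0 - y) * press y)"
          by (intro continuous_kernel_integrable bump_bcs R2) simp
        show "integrable lborel (\<lambda>y::real^'n. bump R2 (0 - y) * Pm)" using i by simp
        show "bump R2 (0 - y) * press y \<le> bump R2 (0 - y) * Pm" for y
          by (intro mult_left_mono press_bounds bump_nonneg R2)
      qed
      also have "\<dots> = Pm * m"
        using integral_reflect[OF bcs_integrable[OF bump_bcs[OF R2]], of "0::real^'n"] integral_bump[OF R2, where 'n='n]
        by (simp add: m_def)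
      finally show "conv (bump R2) press 0 \<le> Pm * m" .
    qed
    have P0: "0 \<le> P0" "P0 \<le> Pm" using pb m by (auto simp: P0_def field_simps)
    define a1 where "a1 x = g k x * \<bar>conv (bump l1) eff x - conv (bump (2 ^ n1 * l1)) eff x\<bar>" for x
    define a2 where "a2 x = g k x * \<bar>conv (bump l) eff x - conv (bump R) eff x\<bar>" for x
    define a3 where "a3 x = g k x * \<bar>conv (bump R) eff x - conv (bump R2) eff x\<bar>" for x
    \<comment> \<open>The truncation puts div v into the class \<open>bcs\<close> without changing
      its averages at points with \<open>norm x \<le> 2 * R\<close>, and its \<open>L2\<close> norm
      is at most that of div v.\<close>
    define w where "w = (\<lambda>y. indicator (cball 0 (R2 + 2 * R)) y * divv y)"
    have wb: "bcs w" unfolding w_def by (intro continuous_indicator_bcs) auto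
    have cwb: "bcs (conv (bump R2) w)" by (intro bcs_conv bump_bcs R2 wb)
    have ai: "integrable lborel a1" "integrable lborel a2" "integrable lborel a3"
      unfolding a1_def a2_def a3_def using l1 l R R2 by (intro g_integrable_eff; simp)+
    have gi: "integrable lborel (g k)" "integrable lborel (\<lambda>x. (g k x)\<^sup>2)"
      by (intro bcs_integrable g_bcs bcs_power2)+
    have ci: "integrable lborel (\<lambda>x. (conv (bump R2) w x)\<^sup>2)" by (intro bcs_integrable bcs_power2 cwb)
    let ?U = "\<lambda>x. ((1 + 2 * L) * e0) * g k x + a1 x + a2 x + a3 x + kap * m * (\<delta> * (divv x)\<^sup>2 + (g k x)\<^sup>2 / (4 * \<delta>))
        + kap * (\<delta> * (conv (bump R2) w x)\<^sup>2 + (g k x)\<^sup>2 / (4 * \<delta>))"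
    have pw: "m * (g k x * \<bar>press x - P0\<bar>) \<le> ?U x" for x
    proof (cases "norm x \<le> 2 * R")
      case False
      then have "g k x = 0" using g_outside[of k x] by (simp add: R_def)
      then show ?thesis using kap_pos m \<delta> by (simp add: a1_def a2_def a3_def)
    next
      case True
      have c0: "\<bar>conv (bump l1) eff x - m * eff x\<bar> \<le> e0"
        using l0(2)[OF l1(1,2) True] by (simp add: conv_def m_def)
      have cw: "conv (bump R2) divv x = conv (bump R2) w x"
        unfolding w_def by (rule conv_localize[OF bump_outside[OF R2] True]) auto
      have xl: "norm x \<le> R2" using True n2' by simp
      have lip: "\<bar>conv (bump R2) press x - m * P0\<bar> \<le> 2 * L * e0"
      proof -
        have "m * P0 = conv (bump R2) press 0" using m by (simp add: P0_def)
        then have "\<bar>conv (bump R2) press x - m * P0\<bar> \<le> L * (norm x / R2)"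
          using bump_average_lipschitz[OF C1_continuous[OF press_C1], of Pm R2 x] press_bounds R2 xl
          by (simp add: conv_def L_def)
        also have "\<dots> \<le> L * (2 * e0)"
        proof (rule mult_left_mono[OF _ L])
          have "norm x / R2 \<le> 2 * R / R2" using True R2 by (intro divide_right_mono) auto
          then show "norm x / R2 \<le> 2 * e0" using n2'(2) by linarith
        qed
        finally show ?thesis by simp
      qed
      let ?B = "\<lambda>l. conv (bump l) eff x"
      \<comment> \<open>At the point itself the pressure is \<open>eff\<close> plus a multiple of
        div v; at scale \<open>R2\<close> the average of \<open>eff\<close> is split again into the
        averages of pressure and divergence. In between stand the three ranges of scales.\<close>
      have "m * (press x - P0) = (m * eff x - ?B l1) + (?B l1 - ?B l) + (?B l - ?B R) + (?B R - ?B R2)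
         + kap * m * divv x + (conv (bump R2) press x - m * P0) - kap * conv (bump R2) w x"
        unfolding conv_eff[OF R2] cw by (simp add: eff_def kap_def algebra_simps)
      moreover have "m * \<bar>press x - P0\<bar> = \<bar>m * (press x - P0)\<bar>" using m by (simp add: abs_mult)
      moreover have "\<bar>a1 + a2 + a3 + a4 + a5 + a6 - a7\<bar> \<le> \<bar>a1\<bar> + \<bar>a2\<bar> + \<bar>a3\<bar> + \<bar>a4\<bar> + \<bar>a5\<bar> + \<bar>a6\<bar> + \<bar>a7\<bar>"
        for a1 a2 a3 a4 a5 a6 a7 :: real
        by (intro order_trans[OF abs_triangle_ineq4] order_trans[OF abs_triangle_ineq] add_mono order_refl)
      ultimately have "m * \<bar>press x - P0\<bar> \<le> \<bar>m * eff x - ?B l1\<bar> + \<bar>?B l1 - ?B l\<bar> + \<bar>?B l - ?B R\<bar> + \<bar>?B R - ?B R2\<bar>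
         + \<bar>kap * m * divv x\<bar> + \<bar>conv (bump R2) press x - m * P0\<bar> + \<bar>kap * conv (bump R2) w x\<bar>"
        by (simp only:)
      moreover have "\<bar>m * eff x - ?B l1\<bar> \<le> e0" using c0 by (simp only: abs_minus_commute)
      ultimately have "m * \<bar>press x - P0\<bar> \<le> e0 + \<bar>?B l1 - ?B l\<bar> + \<bar>?B l - ?B R\<bar> + \<bar>?B R - ?B R2\<bar>
         + \<bar>kap * m * divv x\<bar> + 2 * L * e0 + \<bar>kap * conv (bump R2) w x\<bar>"
        using lip by linarith
      also have "\<dots> = e0 + \<bar>?B l1 - ?B l\<bar> + \<bar>?B l - ?B R\<bar> + \<bar>?B R - ?B R2\<bar>
         + kap * m * \<bar>divv x\<bar> + 2 * L * e0 + kap * \<bar>conv (bump R2) w x\<bar>"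
        using kap_pos m by (simp add: abs_mult)
      finally have "g k x * (m * \<bar>press x - P0\<bar>) \<le> g k x * (e0 + \<bar>?B l1 - ?B l\<bar> + \<bar>?B l - ?B R\<bar> + \<bar>?B R - ?B R2\<bar>
         + kap * m * \<bar>divv x\<bar> + 2 * L * e0 + kap * \<bar>conv (bump R2) w x\<bar>)"
        using g_nonneg by (rule mult_left_mono)
      also have "\<dots> = ((1 + 2 * L) * e0) * g k x + a1 x + a2 x + a3 x + kap * m * (\<bar>divv x\<bar> * g k x) + kap * (\<bar>conv (bump R2) w x\<bar> * g k x)"
        unfolding a1_def a2_def a3_def l1(3) by (simp add: algebra_simps)
      also have "\<dots> \<le> ?U x"
        using amgm_weighted[OF \<delta>, of "\<bar>divv x\<bar>" "g k x"] amgm_weighted[OF \<delta>, of "\<bar>conv (bump R2) w x\<bar>" "g k x"] kap_pos m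
        by (intro add_mono mult_left_mono order_refl) auto
      finally show ?thesis by (simp only: mult_ac)
    qed
    have pgi: "integrable lborel (\<lambda>x. g k x * \<bar>press x - P0\<bar>)"
      by (intro bcs_integrable bcs_mult_continuous g_bcs continuous_intros) simp
    have Ui: "integrable lborel ?U"
      by (intro Bochner_Integration.integrable_add integrable_mult_right integrable_divide gi ai ci div_int)
    have "m * (\<integral>x. g k x * \<bar>press x - P0\<bar> \<partial>lborel) = (\<integral>x. m * (g k x * \<bar>press x - P0\<bar>) \<partial>lborel)" by simp
    also have "\<dots> \<le> (\<integral>x. ?U x \<partial>lborel)"
      by (intro integral_mono integrable_mult_right pgi Ui pw)
    also have "\<dots> = ((1 + 2 * L) * e0) * Gi + (\<integral>x. a1 x \<partial>lborel) + (\<integral>x. a2 x \<partial>lborel) + (\<integral>x. a3 x \<partial>lborel)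
       + kap * m * (\<delta> * DD + G2 / (4 * \<delta>)) + kap * (\<delta> * (\<integral>x. (conv (bump R2) w x)\<^sup>2 \<partial>lborel) + G2 / (4 * \<delta>))"
      using gi ai ci div_int by (simp add: Gi_def G2_def DD_def)
    also have "\<dots> \<le> (1 + 2 * L) * (1 / k) + Cs / 2 ^ k + Cm * (k powr (- 1 / (8 * d - 3)) + k powr (- 1 / (4 * d + 3)))
       + Cf * k powr (- 1 / q) + kap * m * (\<delta> * DD + G2 / \<delta>) + kap * (\<delta> * (m\<^sup>2 * DD) + G2 / \<delta>)"
    proof (intro add_mono)
      show "((1 + 2 * L) * e0) * Gi \<le> (1 + 2 * L) * (1 / k)"
        unfolding mult.assoc using e0G L by (intro mult_left_mono) auto
      show "(\<integral>x. a1 x \<partial>lborel) \<le> Cs / 2 ^ k"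
        unfolding a1_def by (rule Cs(2)[OF l1(1)]) (simp add: l1(3) l_def)
      show "(\<integral>x. a2 x \<partial>lborel) \<le> Cm * (k powr (- 1 / (8 * d - 3)) + k powr (- 1 / (4 * d + 3)))"
        unfolding a2_def R_def by (rule Cm(2)[OF k l_def])
      show "(\<integral>x. a3 x \<partial>lborel) \<le> Cf * k powr (- 1 / q)"
        unfolding a3_def R2_def R_def by (rule Cf(2)[OF k])
      have q4: "G2 / (4 * \<delta>) \<le> G2 / \<delta>" using G2 \<delta> by (intro divide_left_mono) auto
      then show "kap * m * (\<delta> * DD + G2 / (4 * \<delta>)) \<le> kap * m * (\<delta> * DD + G2 / \<delta>)"
        using kap_pos m by (intro mult_left_mono add_left_mono) auto
      have "(\<integral>x. (conv (bump R2) w x)\<^sup>2 \<partial>lborel) \<le> (\<integral>x. \<bar>bump R2 (x::real^'n)\<bar> \<partial>lborel)\<^sup>2 * (\<integral>x. (w x)\<^sup>2 \<partial>lborel)"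
        by (rule conv_L2[OF bump_bcs[OF R2] wb])
      also have "(\<integral>x. \<bar>bump R2 (x::real^'n)\<bar> \<partial>lborel) = m"
        using integral_bump[OF R2, where 'n='n] bump_nonneg[OF R2, where 'a='n] by (simp add: m_def)
      also have "m\<^sup>2 * (\<integral>x. (w x)\<^sup>2 \<partial>lborel) \<le> m\<^sup>2 * DD"
        unfolding DD_def by (intro mult_left_mono integral_mono bcs_integrable bcs_power2 wb div_int)
          (auto simp: w_def indicator_def)
      finally have "\<delta> * (\<integral>x. (conv (bump R2) w x)\<^sup>2 \<partial>lborel) \<le> \<delta> * (m\<^sup>2 * DD)"
        using \<delta> by (intro mult_left_mono) auto
      then show "kap * (\<delta> * (\<integral>x. (conv (bump R2) w x)\<^sup>2 \<partial>lborel) + G2 / (4 * \<delta>)) \<le> kap * (\<delta> * (m\<^sup>2 * DD) + G2 / \<delta>)"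
        by (rule mult_left_mono[OF add_mono[OF _ q4]]) (use kap_pos in simp)
    qed
    also have "\<dots> \<le> ((1 + 2 * L) + Cs + Cm + Cf + kap * m * (DD + 1) + kap * (m\<^sup>2 * DD + 1)) * (err k + \<delta> + G2 / \<delta>)"
      (is "_ \<le> ?K * ?S")
    proof -
      have s: "0 \<le> 1 / (2::real) ^ k" "0 \<le> k powr (- 1 / q)" "0 \<le> k powr (- 1 / (8 * d - 3)) + k powr (- 1 / (4 * d + 3))"
         "0 \<le> 1 / real k" "0 \<le> G2 / \<delta>" using G2 \<delta> by auto
      have S: "1 / (2::real) ^ k \<le> ?S" "k powr (- 1 / q) \<le> ?S" "k powr (- 1 / (8 * d - 3)) + k powr (- 1 / (4 * d + 3)) \<le> ?S"
         "1 / real k \<le> ?S" "\<delta> \<le> ?S" "G2 / \<delta> \<le> ?S" "0 \<le> ?S"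
        unfolding err_def using s \<delta> by linarith+
      have S2: "\<delta> + G2 / \<delta> \<le> ?S" using err_nonneg[of k] by linarith
      have b: "\<delta> * y + G2 / \<delta> \<le> (y + 1) * ?S" if "y \<ge> 0" for y
      proof -
        have "\<delta> * y \<le> ?S * y" using S that by (intro mult_right_mono) auto
        moreover have "(y + 1) * s = s * y + s" for s :: real by (simp add: algebra_simps)
        ultimately show ?thesis using S(6) by (simp only:)
      qed
      have "(1 + 2 * L) * (1 / k) \<le> (1 + 2 * L) * ?S" using L S by (intro mult_left_mono) auto
      moreover have "Cs / 2 ^ k \<le> Cs * ?S" using mult_left_mono[OF S(1) Cs(1)] by simp
      moreover have "Cm * (k powr (- 1 / (8 * d - 3)) + k powr (- 1 / (4 * d + 3))) \<le> Cm * ?S" using S Cm by (intro mult_left_mono) auto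
      moreover have "Cf * k powr (- 1 / q) \<le> Cf * ?S" using S Cf by (intro mult_left_mono) auto
      moreover have "kap * m * (\<delta> * DD + G2 / \<delta>) \<le> kap * m * ((DD + 1) * ?S)"
        using kap_pos m b[OF DD] by (intro mult_left_mono) auto
      moreover have "kap * (\<delta> * (m\<^sup>2 * DD) + G2 / \<delta>) \<le> kap * ((m\<^sup>2 * DD + 1) * ?S)"
        using kap_pos DD b[of "m\<^sup>2 * DD"] by (intro mult_left_mono) auto
      moreover have "?K * ?S = (1 + 2 * L) * ?S + Cs * ?S + Cm * ?S + Cf * ?S + kap * m * ((DD + 1) * ?S) + kap * ((m\<^sup>2 * DD + 1) * ?S)"
        by (simp only: distrib_right mult.assoc)
      ultimately show ?thesis by linarith
    qed
    finally have main: "(\<integral>x. g k x * \<bar>press x - P0\<bar> \<partial>lborel) \<le> ?K / m * (err k + \<delta> + G2 / \<delta>)"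
      using m by (simp add: field_simps)
    have q0: "q > 0" using q_gt_3 by simp
    have "(\<integral>x. indicator (ann R) x * (\<bar>press x - P0\<bar> * norm (v x)) \<partial>lborel) / R =
       (\<integral>x. indicator (ann R) x * (\<bar>press x - P0\<bar> * norm (v x)) / R \<partial>lborel)" by simp
    also have "\<dots> \<le> (\<integral>x. g k x * \<bar>press x - P0\<bar> + Pm / R * norm (v x) powr q \<partial>lborel)"
    proof (rule integral_mono)
      show "integrable lborel (\<lambda>x. indicator (ann R) x * (\<bar>press x - P0\<bar> * norm (v x)) / R)"
        by (intro integrable_divide integrable_indicator_compact compact_ann continuous_intros) auto
      show "integrable lborel (\<lambda>x. g k x * \<bar>press x - P0\<bar> + Pm / R * norm (v x) powr q)"
        by (intro Bochner_Integration.integrable_add integrable_mult_right pgi vq_int)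
      fix x
      have pP: "\<bar>press x - P0\<bar> \<le> Pm" using press_bounds[of x] P0 by linarith
      show "indicator (ann R) x * (\<bar>press x - P0\<bar> * norm (v x)) / R \<le> g k x * \<bar>press x - P0\<bar> + Pm / R * norm (v x) powr q"
      proof (cases "x \<in> ann R")
        case True
        show ?thesis
        proof (cases "norm (v x) \<le> 1")
          case 1: True
          have "g k x = norm (v x) / R" using True 1 by (simp add: g_def R_def)
          moreover have "0 \<le> Pm / R * norm (v x) powr q" using Pm_nonneg R by simp
          ultimately show ?thesis using True by (simp add: mult.commute)
        next
          case False
          \<comment> \<open>Where the speed exceeds 1 the term is paid for by the global q-th
            moment, and the factor 1 / R makes it small.\<close>
          have "norm (v x) powr 1 \<le> norm (v x) powr q" using False q_gt_3 by (intro powr_mono) auto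
          then have "\<bar>press x - P0\<bar> * norm (v x) \<le> Pm * norm (v x) powr q"
            using pP Pm_nonneg by (intro mult_mono) auto
          then have "\<bar>press x - P0\<bar> * norm (v x) / R \<le> Pm * norm (v x) powr q / R"
            using R by (intro divide_right_mono) auto
          moreover have "0 \<le> g k x * \<bar>press x - P0\<bar>" using g_nonneg by simp
          ultimately show ?thesis using True by simp
        qed
      next
        case False
        then show ?thesis using g_nonneg[of k x] Pm_nonneg R by simp
      qed
    qed
    also have "\<dots> = (\<integral>x. g k x * \<bar>press x - P0\<bar> \<partial>lborel) + Pm / R * vI"
      using pgi vq_int by (simp add: vI_def)
    also have "\<dots> \<le> ?K / m * (err k + \<delta> + G2 / \<delta>) + Pm * vI * (err k + \<delta> + G2 / \<delta>)"
    proof (rule add_mono[OF main])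
      have "1 / R \<le> err k" by (simp add: err_def R_def)
      also have "\<dots> \<le> err k + \<delta> + G2 / \<delta>" using \<delta> G2 by simp
      finally have "Pm * vI * (1 / R) \<le> Pm * vI * (err k + \<delta> + G2 / \<delta>)"
        using Pm_nonneg vI_nonneg by (intro mult_left_mono) auto
      then show "Pm / R * vI \<le> Pm * vI * (err k + \<delta> + G2 / \<delta>)" by (simp add: mult_ac)
    qed
    also have "\<dots> = C * (err k + \<delta> + G2 / \<delta>)" by (simp only: C_def distrib_right)
    finally show "\<exists>P0\<ge>0. (\<integral>x. indicator (ann (2 ^ k)) x * (\<bar>press x - P0\<bar> * norm (v x)) \<partial>lborel) / 2 ^ k \<le>
      C * (err k + \<delta> + (\<integral>x. (g k x)\<^sup>2 \<partial>lborel) / \<delta>)"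
      using P0 unfolding R_def G2_def by blast
  qed
qed

section \<open>Good annuli and the limit along them\<close>

lemma gradsq_nonneg: "gradsq x \<ge> 0"
  unfolding gradsq_def by (intro sum_nonneg) auto

lemma good_frequently: "\<exists>k\<ge>N. good k"
proof (rule ccontr)
  assume *: "\<not> (\<exists>k\<ge>N. good k)"
  have q0: "q > 0" using q_gt_3 by simp
  define Y where "Y k = (\<integral>x. indicator (cball 0 (2 ^ k)) x * norm (v x) powr q \<partial>lborel)" for k :: nat
  have Yi: "integrable lborel (\<lambda>x. indicator (cball 0 (2 ^ k)) x * norm (v x) powr q)" for k :: nat
    by (intro integrable_indicator_compact norm_powr_continuous q0) auto
  have Y0: "Y k \<ge> 0" for k unfolding Y_def by (intro integral_nonneg_AE) auto
  have YI: "Y k \<le> vI" for k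
    unfolding Y_def vI_def by (intro integral_mono Yi vq_int) (auto simp: indicator_def)
  \<comment> \<open>Two dyadic steps are subtracted because the closed annulus contains its inner
    sphere, which also belongs to the ball of radius \<open>2 ^ Suc k\<close>. The overlap merely
    doubles the bound on the telescoping sum.\<close>
  have XY: "X (Suc k) \<le> Y (Suc (Suc k)) - Y k" for k
  proof -
    have "X (Suc k) \<le> (\<integral>x. indicator (cball 0 (2 ^ Suc (Suc k))) x * norm (v x) powr q - indicator (cball 0 (2 ^ k)) x * norm (v x) powr q \<partial>lborel)"
      unfolding X_def
    proof (rule integral_mono)
      show "integrable lborel (\<lambda>x. indicator (ann (2 ^ Suc k)) x * norm (v x) powr q)"
        by (intro integrable_indicator_compact norm_powr_continuous q0 compact_ann)
      show "integrable lborel (\<lambda>x. indicator (cball 0 (2 ^ Suc (Suc k))) x * norm (v x) powr q - indicator (cball 0 (2 ^ k)) x * norm (v x) powr q)"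
        by (intro Bochner_Integration.integrable_diff Yi)
      fix x :: "real^'n"
      have "(2::real) ^ k > 0" by simp
      then have "norm x \<le> 2 ^ k \<Longrightarrow> norm x \<le> 4 * 2 ^ k" "norm x \<le> 2 ^ k \<Longrightarrow> \<not> 2 * 2 ^ k \<le> norm x" by linarith+
      then show "indicator (ann (2 ^ Suc k)) x * norm (v x) powr q \<le>
        indicator (cball 0 (2 ^ Suc (Suc k))) x * norm (v x) powr q - indicator (cball 0 (2 ^ k)) x * norm (v x) powr q"
        by (auto simp: indicator_def ann_def)
    qed
    also have "\<dots> = Y (Suc (Suc k)) - Y k" unfolding Y_def by (intro Bochner_Integration.integral_diff Yi)
    finally show ?thesis .
  qed
  have X0: "X k \<ge> 0" for k unfolding X_def by (intro integral_nonneg_AE) auto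
  have "summable (\<lambda>k. X (Suc k))"
  proof (rule summableI_nonneg_bounded)
    fix n
    have "(\<Sum>k<n. X (Suc k)) \<le> (\<Sum>k<n. Y (Suc (Suc k)) - Y k)" by (intro sum_mono XY)
    also have "\<dots> = Y (Suc n) + Y n - Y 1 - Y 0" by (induction n) auto
    also have "\<dots> \<le> 2 * vI" using YI[of "Suc n"] YI[of n] Y0[of 1] Y0[of 0] by linarith
    finally show "(\<Sum>k<n. X (Suc k)) \<le> 2 * vI" .
  qed (rule X0)
  then have "summable X" by (simp add: summable_Suc_iff)
  then have "summable (\<lambda>k. inverse (real k))"
  proof (rule summable_comparison_test')
    fix k assume "N + 1 \<le> k"
    then have "\<not> good k" "k \<ge> 1" using * by auto
    then have "X k > 1 / real k" unfolding good_def by linarith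
    then show "norm (inverse (real k)) \<le> X k" by (simp add: inverse_eq_divide)
  qed
  then show False using not_summable_harmonic[where 'a=real] by simp
qed

text \<open>The squared \<open>L2\<close> norm of v / R on the annulus, the partner of div v in the
  pairing.\<close>

definition T2 :: "nat \<Rightarrow> real" where
  "T2 k = (\<integral>x. indicator (ann (2 ^ k)) x * (norm (v x))\<^sup>2 \<partial>lborel) / (2 ^ k)\<^sup>2"

text \<open>By the q-th moment this quantity has order R powr ((d - 4) / 3) times a negative power
  of \<open>k\<close> on good annuli, which settles d \<le> 4. For d > 4 the Sobolev exponent 2 d /
  (d - 2) makes it scale invariant, and the tail of that moment tends to 0 along all annuli.\<close>

lemma T2_small:
  assumes "e > 0"
  shows "eventually (\<lambda>k. good k \<longrightarrow> T2 k \<le> e) sequentially"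
proof (cases "CARD('n) \<le> 4")
  case True
  then have d4: "d \<le> 4" by (simp add: d_def)
  define C where "C = 2 powr d * vol + 1"
  have C: "C \<ge> 0" using vol_nonneg by (simp add: C_def)
  have b: "T2 k \<le> C * real k powr (- 2 / q)" if "good k" for k
  proof -
    have k: "k \<ge> 1" "X k \<le> 1 / k" using that by (auto simp: good_def)
    define R :: real where "R = 2 ^ k"
    have R: "R \<ge> 1" by (simp add: R_def)
    have "(\<integral>x. indicator (ann R) x * (norm (v x))\<^sup>2 \<partial>lborel) \<le> C * real k powr (- 2 / q) * R powr (d - 2 * (d - 1) / 3)"
      using ann_moment[OF k, of 2] q_gt_3 by (simp add: C_def R_def)
    also have "\<dots> \<le> C * real k powr (- 2 / q) * R powr 2"
    proof (intro mult_left_mono powr_mono)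
      show "d - 2 * (d - 1) / 3 \<le> 2" using d4 by (simp add: field_simps)
    qed (use R C in auto)
    finally show ?thesis using R by (simp add: T2_def R_def[symmetric] field_simps)
  qed
  have "(\<lambda>k. C * real k powr (- 2 / q)) \<longlonglongrightarrow> C * 0"
    using q_gt_3 by (intro tendsto_mult tendsto_const tendsto_neg_powr filterlim_real_sequentially) auto
  then have "eventually (\<lambda>k. C * real k powr (- 2 / q) < e) sequentially"
    using assms by (intro order_tendstoD(2)[of _ "C * 0"]) auto
  then show ?thesis by eventually_elim (use b in force)
next
  case False
  define p where "p = 2 * d / (d - 2)"
  have d5: "d > 4" using False by (simp add: d_def)
  have p: "p > 2" using d5 by (simp add: p_def field_simps)
  have pint: "integrable lborel (\<lambda>x. norm (v x) powr p)" using v_int' False by (simp add: p_def d_def)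
  define Z where "Z k = (\<integral>x. indicator (ann (2 ^ k)) x * norm (v x) powr p \<partial>lborel)" for k :: nat
  have Z: "Z \<longlonglongrightarrow> 0"
  proof -
    have "(\<lambda>k::nat. \<integral>x. indicator (ann (2 ^ k)) x * norm (v x) powr p \<partial>lborel) \<longlonglongrightarrow> (\<integral>x. 0 \<partial>(lborel :: (real^'n) measure))"
    proof (rule integral_dominated_convergence[OF _ _ pint])
      show "AE x in lborel. (\<lambda>k::nat. indicator (ann (2 ^ k)) x * norm (v x) powr p) \<longlonglongrightarrow> 0"
      proof (rule AE_I2)
        fix x :: "real^'n"
        obtain N where N: "norm x < 2 ^ N" using real_arch_pow[of 2 "norm x"] by auto
        have "eventually (\<lambda>k::nat. indicator (ann (2 ^ k)) x * norm (v x) powr p = 0) sequentially"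
          using eventually_ge_at_top[of N]
        proof eventually_elim
          case (elim k)
          then have "(2::real) ^ N \<le> 2 ^ k" by (intro power_increasing) auto
          then have "\<not> 2 ^ k \<le> norm x" using N by linarith
          then have "x \<notin> ann (2 ^ k)" by (simp add: ann_def)
          then show ?case by simp
        qed
        then show "(\<lambda>k::nat. indicator (ann (2 ^ k)) x * norm (v x) powr p) \<longlonglongrightarrow> 0"
          by (rule tendsto_eventually)
      qed
      show "AE x in lborel. norm (indicator (ann (2 ^ k)) x * norm (v x) powr p) \<le> norm (v x) powr p" for k :: nat
        by (rule AE_I2) (auto simp: indicator_def)
    qed measurable
    then show ?thesis by (simp add: Z_def[abs_def])
  qed
  define V where "V = 2 powr d * vol + 1"
  have V: "V > 0" using vol_nonneg by (simp add: V_def add_nonneg_pos)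
  \<comment> \<open>Chosen so that the measure term contributes e / 2. With the height \<eta> * R
    powr (- (d - 2) / 2) both terms scale like the square of R, and the other one carries the
    vanishing factor \<open>Z k\<close>.\<close>
  define \<eta> where "\<eta> = sqrt (e / (2 * V))"
  have \<eta>: "\<eta> > 0" using assms V by (simp add: \<eta>_def)
  have \<eta>2: "V * \<eta> powr 2 = e / 2" using assms V by (simp add: \<eta>_def)
  have b: "T2 k \<le> e / 2 + \<eta> powr (2 - p) * Z k" for k
  proof -
    define R :: real where "R = 2 ^ k"
    have R: "R > 0" by (simp add: R_def)
    define t where "t = \<eta> * R powr (- (d - 2) / 2)"
    have t: "t > 0" using R \<eta> by (simp add: t_def)
    have e1: "t powr 2 * R powr d = \<eta> powr 2 * R powr 2"
    proof -
      have "- (d - 2) / 2 * 2 + d = 2" by (simp add: field_simps)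
      then have "R powr (- (d - 2) / 2 * 2) * R powr d = R powr 2" by (simp only: powr_add[symmetric])
      then show ?thesis using R \<eta> by (simp only: t_def powr_mult powr_powr mult.assoc)
    qed
    have e2: "t powr (2 - p) = \<eta> powr (2 - p) * R powr 2"
    proof -
      have "2 - p = - 4 / (d - 2)" using d5 by (simp add: p_def field_simps)
      then have "- (d - 2) / 2 * (2 - p) = 2" using d5 by (simp add: field_simps)
      then show ?thesis using R \<eta> by (simp only: t_def powr_mult powr_powr)
    qed
    have "measure lborel (ann R :: (real^'n) set) \<le> measure lborel (cball (0::real^'n) (2 * R))"
    proof (rule measure_mono_fmeasurable)
      show "ann R \<subseteq> cball (0::real^'n) (2 * R)" by (auto simp: ann_def)
      show "cball (0::real^'n) (2 * R) \<in> fmeasurable lborel" by (rule fmeasurable_compact) simp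
    qed (use compact_ann borel_compact in auto)
    also have "\<dots> = 2 powr d * vol * R powr d" using R by (simp add: measure_ball powr_mult)
    also have "\<dots> \<le> V * R powr d" by (intro mult_right_mono) (auto simp: V_def)
    finally have m: "measure lborel (ann R :: (real^'n) set) \<le> V * R powr d" .
    have "(\<integral>x. indicator (ann R) x * norm (v x) powr 2 \<partial>lborel) \<le>
      t powr 2 * measure lborel (ann R :: (real^'n) set) + t powr (2 - p) * Z k"
      using moment_bound[OF compact_ann t, of 2 p R] p by (simp add: Z_def R_def)
    also have "\<dots> \<le> t powr 2 * (V * R powr d) + t powr (2 - p) * Z k"
      using m by (intro add_right_mono mult_left_mono) auto
    also have "t powr 2 * (V * R powr d) = V * (t powr 2 * R powr d)" by simp
    also have "\<dots> = (V * \<eta> powr 2) * R powr 2" unfolding e1 by simp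
    finally have "(\<integral>x. indicator (ann R) x * (norm (v x))\<^sup>2 \<partial>lborel) \<le> (e / 2 + \<eta> powr (2 - p) * Z k) * R\<^sup>2"
      unfolding \<eta>2 e2 using R by (simp add: algebra_simps)
    then show ?thesis using R by (simp add: T2_def R_def[symmetric] divide_le_eq)
  qed
  have "(\<lambda>k. \<eta> powr (2 - p) * Z k) \<longlonglongrightarrow> \<eta> powr (2 - p) * 0" by (intro tendsto_mult tendsto_const Z)
  then have "eventually (\<lambda>k. \<eta> powr (2 - p) * Z k < e / 2) sequentially"
    using assms by (intro order_tendstoD(2)[of _ "\<eta> powr (2 - p) * 0"]) auto
  then show ?thesis
  proof eventually_elim
    case (elim k)
    then show ?case using b[of k] by linarith
  qed
qed

lemma err_tendsto: "(\<lambda>k. err k + real k powr (- 3 / q)) \<longlonglongrightarrow> 0"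
proof -
  have p: "(\<lambda>k. real k powr s) \<longlonglongrightarrow> 0" if "s < 0" for s
    using that by (intro tendsto_neg_powr filterlim_real_sequentially)
  have "(\<lambda>k. 1 / (2::real) ^ k) \<longlonglongrightarrow> 0"
    using LIMSEQ_power_zero[of "1 / 2 :: real"] by (simp add: power_divide)
  moreover have "(\<lambda>k. 1 / real k) \<longlonglongrightarrow> 0" by (rule lim_1_over_n)
  moreover have "(\<lambda>k. real k powr (- 1 / q)) \<longlonglongrightarrow> 0" using q_gt_3 by (intro p) auto
  moreover have "(\<lambda>k. real k powr (- 3 / q)) \<longlonglongrightarrow> 0" using q_gt_3 by (intro p) auto
  moreover have "(\<lambda>k. real k powr (- 1 / (8 * d - 3))) \<longlonglongrightarrow> 0" using d_ge by (intro p) auto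
  moreover have "(\<lambda>k. real k powr (- 1 / (4 * d + 3))) \<longlonglongrightarrow> 0" using d_ge by (intro p) auto
  ultimately have "(\<lambda>k. 1 / 2 ^ k + k powr (- 1 / q) + (k powr (- 1 / (8 * d - 3)) + k powr (- 1 / (4 * d + 3))) + 1 / k + real k powr (- 3 / q))
     \<longlonglongrightarrow> 0 + 0 + (0 + 0) + 0 + 0"
    by (intro tendsto_add)
  then show ?thesis by (simp add: err_def[abs_def])
qed

text \<open>The cubic term gains k powr (- 3 / q). The pressure and divergence terms share the
  parameter \<open>\<delta>\<close>: they pay a multiple of \<open>\<delta>\<close> for the fixed
  \<open>L2\<close> norm of div v and \<open>T2 k / \<delta>\<close> for the velocity.\<close>

lemma energy_bound:
  obtains K where "K \<ge> 0" "\<And>k \<delta>. good k \<Longrightarrow> \<delta> > 0 \<Longrightarrow>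
    (\<integral>x. indicator (cball 0 (2 ^ k)) x * gradsq x \<partial>lborel) \<le> K * (err k + real k powr (- 3 / q) + \<delta> + T2 k / \<delta> + T2 k)"
proof -
  obtain C where C: "C > 0" "\<And>R P0. R > 0 \<Longrightarrow> P0 \<ge> 0 \<Longrightarrow> (\<integral>x. indicator (cball 0 R) x * gradsq x \<partial>lborel) \<le>
      C * ((\<integral>x. indicator (ann R) x * norm (v x) ^ 3 \<partial>lborel) / R
         + (\<integral>x. indicator (ann R) x * (\<bar>press x - P0\<bar> * norm (v x)) \<partial>lborel) / R
         + (\<integral>x. indicator (ann R) x * (\<bar>divv x\<bar> * norm (v x)) \<partial>lborel) / R
         + (\<integral>x. indicator (ann R) x * (norm (v x))\<^sup>2 \<partial>lborel) / R\<^sup>2)"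
    using energy_estimate by blast
  obtain Cp where Cp: "Cp \<ge> 0" "\<And>k \<delta>. good k \<Longrightarrow> \<delta> > 0 \<Longrightarrow> \<exists>P0\<ge>0.
    (\<integral>x. indicator (ann (2 ^ k)) x * (\<bar>press x - P0\<bar> * norm (v x)) \<partial>lborel) / 2 ^ k \<le>
    Cp * (err k + \<delta> + (\<integral>x. (g k x)\<^sup>2 \<partial>lborel) / \<delta>)"
    using pressure_bound by blast
  define V where "V = 2 powr d * vol + 1"
  have V: "V \<ge> 0" using vol_nonneg by (simp add: V_def)
  define DD where "DD = (\<integral>x. (divv x)\<^sup>2 \<partial>lborel)"
  have DD: "DD \<ge> 0" by (simp add: DD_def)
  show ?thesis
  proof (rule that[of "C * (V + Cp + (DD + 1) + 1)"])
    show "C * (V + Cp + (DD + 1) + 1) \<ge> 0" using C V Cp DD by simp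
    fix k :: nat and \<delta> :: real assume k: "good k" and \<delta>: "\<delta> > 0"
    have k1: "k \<ge> 1" "X k \<le> 1 / k" using k by (auto simp: good_def)
    define R :: real where "R = 2 ^ k"
    have R: "R > 0" by (simp add: R_def)
    let ?S = "err k + real k powr (- 3 / q) + \<delta> + T2 k / \<delta> + T2 k"
    have T0: "T2 k \<ge> 0" unfolding T2_def by (intro divide_nonneg_nonneg integral_nonneg_AE) auto
    have n: "0 \<le> T2 k / \<delta>" "0 \<le> real k powr (- 3 / q)" using T0 \<delta> by auto
    have S: "real k powr (- 3 / q) \<le> ?S" "\<delta> \<le> ?S" "T2 k / \<delta> \<le> ?S" "T2 k \<le> ?S" "err k + \<delta> + T2 k / \<delta> \<le> ?S" "?S \<ge> 0"
      using n T0 \<delta> err_nonneg[of k] by linarith+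
    have t1: "(\<integral>x. indicator (ann R) x * norm (v x) ^ 3 \<partial>lborel) / R \<le> V * ?S"
    proof -
      have "(\<integral>x. indicator (ann R) x * norm (v x) ^ 3 \<partial>lborel) \<le> V * real k powr (- 3 / q) * R powr (d - 3 * (d - 1) / 3)"
        using ann_moment[OF k1, of 3] q_gt_3 by (simp add: V_def R_def)
      also have "d - 3 * (d - 1) / 3 = 1" by (simp add: field_simps)
      finally have "(\<integral>x. indicator (ann R) x * norm (v x) ^ 3 \<partial>lborel) / R \<le> V * real k powr (- 3 / q)"
        using R by (simp add: divide_le_eq)
      also have "\<dots> \<le> V * ?S" using S V by (intro mult_left_mono) auto
      finally show ?thesis .
    qed
    have G2: "(\<integral>x. (g k x)\<^sup>2 \<partial>lborel) \<le> T2 k"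
      using g_powr_integral[of 2 k] q_gt_3 g_nonneg by (simp add: T2_def powr_minus_divide powr_numeral)
    obtain P0 where P0: "P0 \<ge> 0" "(\<integral>x. indicator (ann R) x * (\<bar>press x - P0\<bar> * norm (v x)) \<partial>lborel) / R \<le>
       Cp * (err k + \<delta> + (\<integral>x. (g k x)\<^sup>2 \<partial>lborel) / \<delta>)"
      using Cp(2)[OF k \<delta>] unfolding R_def by blast
    have t2: "(\<integral>x. indicator (ann R) x * (\<bar>press x - P0\<bar> * norm (v x)) \<partial>lborel) / R \<le> Cp * ?S"
    proof (rule order_trans[OF P0(2)], rule mult_left_mono[OF _ Cp(1)])
      have "(\<integral>x. (g k x)\<^sup>2 \<partial>lborel) / \<delta> \<le> T2 k / \<delta>" using G2 \<delta> by (intro divide_right_mono) auto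
      then show "err k + \<delta> + (\<integral>x. (g k x)\<^sup>2 \<partial>lborel) / \<delta> \<le> ?S" using S(5) by linarith
    qed
    have t3: "(\<integral>x. indicator (ann R) x * (\<bar>divv x\<bar> * norm (v x)) \<partial>lborel) / R \<le> (DD + 1) * ?S"
    proof -
      have i: "integrable lborel (\<lambda>x. indicator (ann R) x * (norm (v x))\<^sup>2)"
        by (intro integrable_indicator_compact compact_ann continuous_intros) auto
      have "(\<integral>x. indicator (ann R) x * (\<bar>divv x\<bar> * norm (v x)) \<partial>lborel) / R =
        (\<integral>x. indicator (ann R) x * (\<bar>divv x\<bar> * norm (v x)) / R \<partial>lborel)" by simp
      also have "\<dots> \<le> (\<integral>x. \<delta> * (divv x)\<^sup>2 + indicator (ann R) x * (norm (v x))\<^sup>2 / R\<^sup>2 / (4 * \<delta>) \<partial>lborel)"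
      proof (rule integral_mono)
        show "integrable lborel (\<lambda>x. indicator (ann R) x * (\<bar>divv x\<bar> * norm (v x)) / R)"
          by (intro integrable_divide integrable_indicator_compact compact_ann continuous_intros) auto
        show "integrable lborel (\<lambda>x. \<delta> * (divv x)\<^sup>2 + indicator (ann R) x * (norm (v x))\<^sup>2 / R\<^sup>2 / (4 * \<delta>))"
          by (intro Bochner_Integration.integrable_add integrable_mult_right div_int integrable_divide i)
        fix x
        show "indicator (ann R) x * (\<bar>divv x\<bar> * norm (v x)) / R \<le> \<delta> * (divv x)\<^sup>2 + indicator (ann R) x * (norm (v x))\<^sup>2 / R\<^sup>2 / (4 * \<delta>)"
          using amgm_weighted[OF \<delta>, of "\<bar>divv x\<bar>" "norm (v x) / R"] \<delta>
          by (cases "x \<in> ann R") (auto simp: power_divide)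
      qed
      also have "\<dots> = \<delta> * DD + T2 k / (4 * \<delta>)"
        using div_int i by (simp add: DD_def T2_def R_def)
      also have "\<dots> \<le> \<delta> * DD + T2 k / \<delta>" using T0 \<delta> by (intro add_left_mono divide_left_mono) auto
      also have "\<dots> \<le> DD * ?S + ?S"
        using mult_left_mono[OF S(2) DD] S(3) by (simp only: mult.commute[of \<delta>] add_mono)
      also have "\<dots> = (DD + 1) * ?S" by (simp only: distrib_right mult_1)
      finally show ?thesis .
    qed
    have t4: "(\<integral>x. indicator (ann R) x * (norm (v x))\<^sup>2 \<partial>lborel) / R\<^sup>2 \<le> 1 * ?S"
      using S(4) by (simp add: T2_def R_def)
    have "(\<integral>x. indicator (cball 0 R) x * gradsq x \<partial>lborel) \<le> C * (V * ?S + Cp * ?S + (DD + 1) * ?S + 1 * ?S)"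
      by (rule order_trans[OF C(2)[OF R P0(1)]]) (intro mult_left_mono add_mono t1 t2 t3 t4, use C in simp)
    also have "\<dots> = C * (V + Cp + (DD + 1) + 1) * ?S" by (simp only: distrib_right mult.assoc)
    finally show "(\<integral>x. indicator (cball 0 (2 ^ k)) x * gradsq x \<partial>lborel) \<le> C * (V + Cp + (DD + 1) + 1) * ?S"
      by (simp only: R_def)
  qed
qed

text \<open>Fix \<open>\<delta>\<close> and then take a good k beyond j with \<open>T2 k\<close> at
  most the square of \<open>\<delta>\<close>, so that also
  \<open>T2 k / \<delta> \<le> \<delta>\<close>. The energy on balls increases with the radius, so
  control along infinitely many k suffices.\<close>

lemma energy_zero: "(\<integral>x. indicator (cball 0 (2 ^ j)) x * gradsq x \<partial>lborel) = 0"
proof -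
  let ?E = "\<lambda>k::nat. \<integral>x. indicator (cball 0 (2 ^ k)) x * gradsq x \<partial>lborel"
  have E0: "?E j \<ge> 0" by (intro integral_nonneg_AE AE_I2) (simp add: gradsq_nonneg)
  obtain K where K: "K \<ge> 0" "\<And>k \<delta>. good k \<Longrightarrow> \<delta> > 0 \<Longrightarrow>
    ?E k \<le> K * (err k + real k powr (- 3 / q) + \<delta> + T2 k / \<delta> + T2 k)"
    using energy_bound by blast
  have small: "?E j \<le> K * (4 * \<delta>)" if \<delta>: "0 < \<delta>" "\<delta> < 1" for \<delta>
  proof -
    have "eventually (\<lambda>k. err k + real k powr (- 3 / q) < \<delta>) sequentially"
      using err_tendsto \<delta> by (intro order_tendstoD(2)) auto
    moreover have "eventually (\<lambda>k. good k \<longrightarrow> T2 k \<le> \<delta>\<^sup>2) sequentially" using \<delta> by (intro T2_small) simp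
    moreover have "eventually (\<lambda>k. k \<ge> j) sequentially" by (rule eventually_ge_at_top)
    ultimately have "eventually (\<lambda>k. err k + real k powr (- 3 / q) < \<delta> \<and> (good k \<longrightarrow> T2 k \<le> \<delta>\<^sup>2) \<and> k \<ge> j) sequentially"
      by eventually_elim auto
    then obtain N where N: "\<And>k. k \<ge> N \<Longrightarrow> err k + real k powr (- 3 / q) < \<delta> \<and> (good k \<longrightarrow> T2 k \<le> \<delta>\<^sup>2) \<and> k \<ge> j"
      by (auto simp: eventually_sequentially)
    obtain k where k: "k \<ge> N" "good k" using good_frequently by blast
    have T: "T2 k \<le> \<delta>\<^sup>2" "err k + real k powr (- 3 / q) < \<delta>" "k \<ge> j" using N[OF k(1)] k(2) by auto
    have T': "T2 k / \<delta> \<le> \<delta>" using T(1) \<delta> by (simp add: divide_le_eq power2_eq_square)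
    have "\<delta>\<^sup>2 \<le> \<delta>" using \<delta> by (simp add: power2_eq_square mult_left_le)
    then have "err k + real k powr (- 3 / q) + \<delta> + T2 k / \<delta> + T2 k \<le> 4 * \<delta>" using T T' by linarith
    then have "K * (err k + real k powr (- 3 / q) + \<delta> + T2 k / \<delta> + T2 k) \<le> K * (4 * \<delta>)" using K(1) by (rule mult_left_mono)
    moreover have "?E j \<le> ?E k"
    proof (rule integral_mono)
      show "integrable lborel (\<lambda>x. indicator (cball 0 (2 ^ j)) x * gradsq x)"
        "integrable lborel (\<lambda>x. indicator (cball 0 (2 ^ k)) x * gradsq x)"
        by (intro integrable_indicator_compact gradsq_continuous; simp)+
      have "(2::real) ^ j \<le> 2 ^ k" using T(3) by (intro power_increasing) auto
      then have "norm x \<le> 2 ^ k" if "norm x \<le> 2 ^ j" for x :: "real^'n" using that by linarith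
      then show "indicator (cball 0 (2 ^ j)) x * gradsq x \<le> indicator (cball 0 (2 ^ k)) x * gradsq x" for x
        using gradsq_nonneg[of x] by (auto simp: indicator_def)
    qed
    ultimately show ?thesis using K(2)[OF k(2) \<delta>(1)] by linarith
  qed
  show ?thesis
  proof (rule ccontr)
    assume "?E j \<noteq> 0"
    with E0 have pos: "?E j > 0" by linarith
    define \<delta> where "\<delta> = min (1 / 2) (?E j / (8 * (K + 1)))"
    have \<delta>: "0 < \<delta>" "\<delta> < 1" using pos K(1) by (auto simp: \<delta>_def)
    have "K * (4 * \<delta>) \<le> (K + 1) * (4 * \<delta>)" using \<delta> by (intro mult_right_mono) auto
    also have "\<dots> \<le> (K + 1) * (4 * (?E j / (8 * (K + 1))))" using K(1) by (intro mult_left_mono) (auto simp: \<delta>_def)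
    also have "\<dots> = ?E j / 2" using K(1) by (simp add: field_simps)
    finally show False using small[OF \<delta>] pos by linarith
  qed
qed

lemma gradsq_zero: "gradsq x = 0"
proof (rule ccontr)
  assume "gradsq x \<noteq> 0"
  then have a: "gradsq x > 0" using gradsq_nonneg[of x] by linarith
  have "isCont gradsq x" using gradsq_continuous by (simp add: continuous_on_eq_continuous_at)
  then have "eventually (\<lambda>y. gradsq y > gradsq x / 2) (at x)"
    using a by (intro order_tendstoD(1)[of gradsq "gradsq x"]) (auto simp: isCont_def)
  then obtain r where r: "r > 0" "\<And>y. y \<noteq> x \<Longrightarrow> dist y x < r \<Longrightarrow> gradsq y > gradsq x / 2"
    by (auto simp: eventually_at)
  have ge: "gradsq y \<ge> gradsq x / 2" if "y \<in> cball x (r / 2)" for y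
    using r(2)[of y] that a r(1) by (cases "y = x") (auto simp: dist_commute)
  obtain j where j: "norm x + r < 2 ^ j" using real_arch_pow[of 2 "norm x + r"] by auto
  have sub: "cball x (r / 2) \<subseteq> cball 0 (2 ^ j)"
  proof
    fix y assume y: "y \<in> cball x (r / 2)"
    have "norm y \<le> norm x + norm (x - y)" using norm_triangle_ineq4[of x "x - y"] by simp
    then show "y \<in> cball 0 (2 ^ j)" using y j r(1) by (simp add: dist_norm)
  qed
  have "(\<integral>y. indicator (cball x (r / 2)) y * (gradsq x / 2) \<partial>lborel) \<le> (\<integral>y. indicator (cball 0 (2 ^ j)) y * gradsq y \<partial>lborel)"
  proof (rule integral_mono)
    show "integrable lborel (\<lambda>y. indicator (cball x (r / 2)) y * (gradsq x / 2))"
      by (intro integrable_indicator_compact continuous_intros) auto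
    show "integrable lborel (\<lambda>x. indicator (cball 0 (2 ^ j)) x * gradsq x)"
      by (intro integrable_indicator_compact gradsq_continuous) auto
    show "indicator (cball x (r / 2)) y * (gradsq x / 2) \<le> indicator (cball 0 (2 ^ j)) y * gradsq y" for y
      using ge[of y] sub gradsq_nonneg[of y] by (auto simp: indicator_def)
  qed
  also have "\<dots> = 0" by (rule energy_zero)
  also have "(\<integral>y. indicator (cball x (r / 2)) y * (gradsq x / 2) \<partial>lborel) = measure lborel (cball x (r / 2)) * (gradsq x / 2)"
    by simp
  finally have "measure lborel (cball x (r / 2)) * (gradsq x / 2) \<le> 0" .
  moreover have "measure lborel (cball x (r / 2)) > 0" using r(1) by (intro content_cball_pos) simp
  ultimately show False using a by (simp add: mult_le_0_iff)
qed

section \<open>From vanishing gradient to trivial velocity and constant density\<close>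

lemma dv_zero: "dv i j x = 0"
proof -
  have "(\<Sum>j\<in>UNIV. (dv i j x)\<^sup>2) = 0"
    using gradsq_zero[of x] unfolding gradsq_def by (subst (asm) sum_nonneg_eq_0_iff) (auto intro: sum_nonneg)
  then have "(dv i j x)\<^sup>2 = 0" by (subst (asm) sum_nonneg_eq_0_iff) auto
  then show ?thesis by simp
qed

lemma constant_if_pderiv_zero:
  fixes f :: "real^'n \<Rightarrow> real"
  assumes "C1 f" "\<And>i x. pderiv i f x = 0"
  shows "f x = f y"
proof -
  have "(f has_derivative (\<lambda>h. 0)) (at z within UNIV)" for z
    using has_derivative_pderiv[OF C1_differentiable[OF assms(1)], of z] assms(2) by simp
  then show ?thesis using has_derivative_zero_constant[of UNIV f] by auto
qed

text \<open>A vanishing gradient leaves a constant, and a nonzero constant has infinite q-th moment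
  over the whole space.\<close>

lemma velocity_zero: "v x = 0"
proof -
  have c: "v y = v 0" for y
    using constant_if_pderiv_zero[OF v_C1, of _ y 0] dv_zero by (simp add: vec_eq_iff dv_def)
  have "v 0 = 0"
  proof (rule ccontr)
    assume "v 0 \<noteq> 0"
    then have "norm (v 0) powr q > 0" by simp
    moreover have "(\<lambda>x. norm (v x) powr q) = (\<lambda>x. norm (v 0) powr q)"
      by (rule ext, rule arg_cong[where f="\<lambda>y. norm y powr q"], rule c)
    then have "integrable lborel (\<lambda>x::real^'n. norm (v 0) powr q)" using vq_int by (simp only:)
    ultimately show False by (simp add: integrable_iff_bounded ennreal_mult_eq_top_iff)
  qed
  then show ?thesis using c by simp
qed

text \<open>For vanishing velocity gradient the momentum equation says that the pressure gradient
  vanishes, and the pressure law is injective on nonnegative densities.\<close>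

lemma density_constant: "rho x = rho y"
proof -
  have dv0: "dv i j = (\<lambda>_. 0)" for i j by (rule ext) (rule dv_zero)
  have dd0: "divv = (\<lambda>_. 0)" by (rule ext) (simp add: divv_def dv_zero)
  have "pderiv j press x = 0" for j x
    using momentum'[of j x] by (simp add: force_def dv0 dd0 pderiv_const)
  then have "press x = press y" by (intro constant_if_pderiv_zero press_C1)
  then have "rho x powr gamma = rho y powr gamma" using A by (simp add: press_def)
  then have "(rho x powr gamma) powr (1 / gamma) = (rho y powr gamma) powr (1 / gamma)" by simp
  then show ?thesis using gam rho_nonneg by (simp add: powr_powr)
qed

end

theorem theorem1p3:
  fixes rho :: "real^'n::finite \<Rightarrow> real"
    and v :: "real^'n \<Rightarrow> real^'n"
    and mu lambda A gamma :: real
  assumes d2: "CARD('n) \<ge> 2"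
    and mu: "mu > 0" and lam: "lambda + 2 * mu > 0" and A: "A > 0" and gam: "gamma > 1"
    and rho_nonneg: "\<forall>x. rho x \<ge> 0"
    and smooth_rho: "smooth rho"
    and smooth_v: "\<forall>j. smooth (\<lambda>x. v x $ j)"
    and mass: "\<forall>x. (\<Sum>i\<in>UNIV. pderiv i (\<lambda>y. rho y * v y $ i) x) = 0"
    and momentum: "\<forall>x j.
        (\<Sum>i\<in>UNIV. pderiv i (\<lambda>y. rho y * v y $ i * v y $ j) x)
        = - pderiv j (\<lambda>y. A * rho y powr gamma) x
          + mu * (\<Sum>i\<in>UNIV. pderiv i (pderiv i (\<lambda>y. v y $ j)) x)
          + (mu + lambda) * pderiv j (\<lambda>y. \<Sum>i\<in>UNIV. pderiv i (\<lambda>z. v z $ i) y) x"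
    and rho_bdd: "\<exists>C. \<forall>x. \<bar>rho x\<bar> \<le> C"
    and div_L2: "Lp_finite 2 (\<lambda>x. \<Sum>i\<in>UNIV. pderiv i (\<lambda>z. v z $ i) x)"
    and v_L3d: "Lp_finite (3 * real CARD('n) / (real CARD('n) - 1)) v"
    and v_L2d: "CARD('n) \<ge> 4 \<longrightarrow> Lp_finite (2 * real CARD('n) / (real CARD('n) - 2)) v"
  shows "(\<forall>x. v x = 0) \<and> (\<exists>c. \<forall>x. rho x = c)"
proof -
  obtain M where M: "\<And>x. \<bar>rho x\<bar> \<le> M" using rho_bdd by blast
  interpret stationary_flow rho v mu lambda A gamma M
  proof
    show "rho x \<le> M" for x using M[of x] by linarith
  qed (use assms in auto)
  interpret decaying_flow rho v mu lambda A gamma M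
  proof
    show "integrable lborel (\<lambda>x. (divv x)\<^sup>2)"
      using div_L2 by (simp add: Lp_finite_def divv_def dv_def)
    show "integrable lborel (\<lambda>x. norm (v x) powr (3 * real CARD('n) / (real CARD('n) - 1)))"
      using v_L3d by (simp add: Lp_finite_def)
    show "integrable lborel (\<lambda>x. norm (v x) powr (2 * real CARD('n) / (real CARD('n) - 2)))" if "CARD('n) \<ge> 4"
      using v_L2d that by (simp add: Lp_finite_def)
  qed (rule assms)
  show ?thesis using velocity_zero density_constant by blast
qed

end
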